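(* There exist a sequence $\{M_i\}$ of non-compact hyperbolic $3$-manifolds of finite volume with $\mathrm{vol}(M_i)\to\infty$ and a constant $c>0$ (independent of $i$) such that for every $\epsilon>0$ there is $i_0$ with $$\mathrm{Kiss}(M_i)\ \ge\ (1-\epsilon)\, c\,\frac{\mathrm{vol}(M_i)^{\frac{31}{27}}}{\log(\mathrm{vol}(M_i))}\qquad\text{for all } i>i_0 .$$
   Context: A hyperbolic $3$-manifold is a quotient $M=\Gamma\backslash\mathbb{H}^3$ where $\Gamma$ is a discrete torsion-free subgroup of $\mathrm{PSL}_2(\mathbb{C})=\mathrm{Isom}^+(\mathbb{H}^3)$. The systole $\mathrm{sys}(M)$ is the shortest length of a nontrivial closed geodesic of $M$, and the kissing number $\mathrm{Kiss}(M)$ is the number of free homotopy classes of oriented closed geodesics in $M$ of length $\mathrm{sys}(M)$. The paper writes the conclusion as $\mathrm{Kiss}(M_i)\gtrsim c\,\mathrm{vol}(M_i)^{31/27}/\log(\mathrm{vol}(M_i))$, where $f\gtrsim g$ means: for every $\epsilon>0$, $f\ge(1-\epsilon)g$ eventually. *)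

theory Defs
  imports "HOL-Analysis.Analysis"
begin

text \<open>Elements of SL(2,C) are 2x2 complex matrices of type complex^2^2.
A (torsion-free, discrete) subgroup Gamma of PSL(2,C) is represented by its
full preimage G in SL(2,C), a subgroup containing -I.\<close>

type_synonym cmat = "complex^2^2"

definition SL2 :: "cmat set" where
  "SL2 = {A. det A = 1}"

fun mpow :: "cmat \<Rightarrow> nat \<Rightarrow> cmat" where
  "mpow A 0 = mat 1"
| "mpow A (Suc n) = A ** mpow A n"

definition PSL_preimage_subgroup :: "cmat set \<Rightarrow> bool" where
  "PSL_preimage_subgroup G \<longleftrightarrow> G \<subseteq> SL2 \<and> mat 1 \<in> G \<and> - mat 1 \<in> G \<and>
     (\<forall>A\<in>G. \<forall>B\<in>G. A ** B \<in> G) \<and> (\<forall>A\<in>G. matrix_inv A \<in> G)"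

definition discrete_group :: "cmat set \<Rightarrow> bool" where
  "discrete_group G \<longleftrightarrow> (\<forall>A\<in>G. \<exists>e>0. \<forall>B\<in>G. dist A B < e \<longrightarrow> B = A)"

definition torsion_free :: "cmat set \<Rightarrow> bool" where
  "torsion_free G \<longleftrightarrow> (\<forall>A\<in>G. \<forall>n::nat. n \<ge> 1 \<longrightarrow> mpow A n \<in> {mat 1, - mat 1}
       \<longrightarrow> A \<in> {mat 1, - mat 1})"

definition kleinian_tf :: "cmat set \<Rightarrow> bool" where
  "kleinian_tf G \<longleftrightarrow> PSL_preimage_subgroup G \<and> discrete_group G \<and> torsion_free G"

definition H3 :: "(complex \<times> real) set" where
  "H3 = {p. snd p > 0}"

text \<open>Action of SL(2,C) on the upper half-space (Poincare extension).\<close>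
definition act :: "cmat \<Rightarrow> complex \<times> real \<Rightarrow> complex \<times> real" where
  "act A p = (let a = A$1$1; b = A$1$2; c = A$2$1; d = A$2$2; z = fst p; t = snd p;
       D = (cmod (c*z + d))^2 + (cmod c)^2 * t^2
     in (((a*z + b) * cnj (c*z + d) + a * cnj c * complex_of_real (t^2)) / complex_of_real D,
         t / D))"

definition hdist :: "complex \<times> real \<Rightarrow> complex \<times> real \<Rightarrow> real" where
  "hdist p q = arcosh (1 + ((cmod (fst p - fst q))^2 + (snd p - snd q)^2) / (2 * snd p * snd q))"

definition hvol :: "(complex \<times> real) measure" where
  "hvol = density lborel (\<lambda>p. ennreal (indicator H3 p / (snd p)^3))"

definition fund_dom :: "cmat set \<Rightarrow> (complex \<times> real) set \<Rightarrow> bool" where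
  "fund_dom G F \<longleftrightarrow> F \<in> sets lborel \<and> F \<subseteq> H3 \<and> (\<Union>A\<in>G. act A ` F) = H3 \<and>
     (\<forall>A\<in>G. \<forall>B\<in>G. act A ` F \<inter> act B ` F \<noteq> {} \<longrightarrow> B = A \<or> B = - A)"

definition covol :: "cmat set \<Rightarrow> ennreal" where
  "covol G = (SOME v. \<exists>F. fund_dom G F \<and> emeasure hvol F = v)"

definition vol :: "cmat set \<Rightarrow> real" where
  "vol G = enn2real (covol G)"

definition cocompact :: "cmat set \<Rightarrow> bool" where
  "cocompact G \<longleftrightarrow> (\<exists>K. compact K \<and> K \<subseteq> H3 \<and> (\<Union>A\<in>G. act A ` K) = H3)"

text \<open>Translation length; closed geodesics of M correspond to conjugacy classes of
loxodromic elements (positive translation length), with length = translation length.\<close>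
definition tlen :: "cmat \<Rightarrow> real" where
  "tlen A = Inf {hdist p (act A p) | p. p \<in> H3}"

definition loxodromic :: "cmat \<Rightarrow> bool" where
  "loxodromic A \<longleftrightarrow> tlen A > 0"

definition sys :: "cmat set \<Rightarrow> real" where
  "sys G = Inf {tlen A | A. A \<in> G \<and> loxodromic A}"

text \<open>Conjugacy class in Gamma = G/{+-I} of the image of A (free homotopy class).\<close>
definition conj_class :: "cmat set \<Rightarrow> cmat \<Rightarrow> cmat set" where
  "conj_class G A = {B. \<exists>C\<in>G. B = C ** A ** matrix_inv C \<or> B = - (C ** A ** matrix_inv C)}"

definition Kiss :: "cmat set \<Rightarrow> nat" where
  "Kiss G = card {conj_class G A | A. A \<in> G \<and> loxodromic A \<and> tlen A = sys G}"

end

theory Submission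
  imports Defs "HOL-Number_Theory.Totient" "HOL-Real_Asymp.Real_Asymp"
begin

text \<open>
  The manifolds are the congruence covers of the Bianchi orbifold of \<open>\<int>[\<omega>]\<close>, \<open>\<omega> = \<surd>-2\<close>, at
  a rational integer level \<open>q\<close>: \<open>\<Gamma>(q)\<close> consists of the matrices congruent to \<open>\<plusminus>1\<close> modulo \<open>q\<close>.

  If \<open>B \<in> SL\<^sub>2(\<int>[\<omega>])\<close> has trace \<open>q\<close>, then \<open>B\<^sup>2 = qB - 1\<close> lies in \<open>\<Gamma>(q)\<close> and has trace \<open>q\<^sup>2 - 2\<close>. Traces
  in \<open>\<Gamma>(q)\<close> are \<open>\<plusminus>2\<close> modulo \<open>q\<^sup>2\<close>, so \<open>B\<^sup>2\<close> and its conjugates realise the systole. The centraliser of \<open>B\<close>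
  has an image of order at most 2 in \<open>\<Gamma>/\<Gamma>(q)\<close> as soon as the lower left entry of \<open>B\<close> is small, so each
  conjugacy class of such \<open>B\<close> in \<open>\<Gamma>\<close> yields at least half the index of \<open>\<Gamma>(q)\<close>, that is a constant times
  the volume, many classes in \<open>\<Gamma>(q)\<close>.

  Matrices \<open>B\<close> of trace \<open>q\<close> whose lower left entry \<open>c\<close> has norm at most \<open>q/16\<close> are conjugate only if they
  agree up to upper unipotent conjugation: balancing an intertwiner by powers of \<open>B\<close> forces its lower left entry
  to vanish. Such \<open>B\<close> correspond to roots of \<open>r\<^sup>2 - qr + 1\<close> modulo \<open>c\<close>, and an average over \<open>q\<close> gives
  infinitely many \<open>q\<close> with at least \<open>q\<^sup>8\<^sup>/\<^sup>9\<close> of them (in fact \<open>q\<close> up to logarithms). The volume of \<open>\<Gamma>(q)\<close> is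
  \<open>O(q\<^sup>6)\<close>, and \<open>8/9 = 6 \<cdot> 4/27\<close>.
\<close>

section \<open>Matrices and the action on upper half-space\<close>

text \<open>The ring has two properties that the proof lives on. Its only units are 1 and -1, so
  upper triangular elements of \<open>Gam\<close> act as translations; and every complex number lies
  within squared distance 3/4 < 1 of it, so Euclidean reduction works for points and for matrices.

  For a single q the number of roots of r^2 - q r + 1 modulo c depends on whether q^2 - 4 is a
  square modulo the primes of c. Fixing c and r first makes the congruence r (q - r) = 1 linear in
  q: every r coprime to the norm of c then serves exactly one residue class of q. Hence the average
  over q, which yields infinitely many levels rather than all.

  The index of \<open>Gq q\<close> is never computed: \<open>card (Reps q)\<close> bounds the volume
  from above and the kissing number from below, so only its upper bound q^6 enters, through the
  exponent.

  \<open>covol\<close> chooses among the volumes of exact measurable fundamental domains. So one has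
  to be constructed, and the volume bounds must hold for every such domain, which rests on the
  invariance of \<open>hvol\<close>, read off from the Jacobian of the action.\<close>

lemma norm_sq_cnj: "(complex_of_real (cmod z))^2 = z * cnj z"
  using complex_norm_square[of z] by simp

definition mk :: "complex \<Rightarrow> complex \<Rightarrow> complex \<Rightarrow> complex \<Rightarrow> cmat" where
  "mk a b c d = vector [vector [a, b], vector [c, d]]"

lemma mk_nth [simp]:
  "mk a b c d $ 1 $ 1 = a" "mk a b c d $ 1 $ 2 = b" "mk a b c d $ 2 $ 1 = c" "mk a b c d $ 2 $ 2 = d"
  by (simp_all add: mk_def)

lemma cmat_eq_iff: "(A :: cmat) = B \<longleftrightarrow>
    A$1$1 = B$1$1 \<and> A$1$2 = B$1$2 \<and> A$2$1 = B$2$1 \<and> A$2$2 = B$2$2"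
  by (auto simp: vec_eq_iff forall_2)

lemma mk_eta: "A = mk (A$1$1) (A$1$2) (A$2$1) (A$2$2)"
  by (simp add: cmat_eq_iff)

lemma mk_cases: obtains a b c d where "A = mk a b c d"
  using mk_eta by blast

lemma mk_eq_iff [simp]: "mk a b c d = mk a' b' c' d' \<longleftrightarrow> a = a' \<and> b = b' \<and> c = c' \<and> d = d'"
  by (simp add: cmat_eq_iff)

lemma mk_mult: "mk a b c d ** mk a' b' c' d' =
    mk (a*a' + b*c') (a*b' + b*d') (c*a' + d*c') (c*b' + d*d')"
  by (simp add: cmat_eq_iff matrix_matrix_mult_def sum_2)

lemma mk_uminus: "- mk a b c d = mk (-a) (-b) (-c) (-d)"
  by (simp add: cmat_eq_iff)

lemma mat_1_mk: "(mat 1 :: cmat) = mk 1 0 0 1"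
  by (simp add: cmat_eq_iff mat_def)

lemma det_mk: "det (mk a b c d) = a*d - b*c"
  by (simp add: det_2)

lemma mk_SL2: "mk a b c d \<in> SL2 \<longleftrightarrow> a*d - b*c = 1"
  by (simp add: SL2_def det_mk)

lemma SL2_cases:
  assumes "A \<in> SL2" obtains a b c d where "A = mk a b c d" "a*d - b*c = 1"
  using assms mk_SL2 mk_cases by metis

lemma mult_minus_left_cmat: "(- (A :: cmat)) ** B = - (A ** B :: cmat)"
  by (cases A rule: mk_cases; cases B rule: mk_cases) (simp add: mk_mult mk_uminus)

lemma mult_minus_right_cmat: "(A :: cmat) ** (- B) = - (A ** B :: cmat)"
  by (cases A rule: mk_cases; cases B rule: mk_cases) (simp add: mk_mult mk_uminus)

lemma SL2_mult: "A \<in> SL2 \<Longrightarrow> B \<in> SL2 \<Longrightarrow> A ** B \<in> SL2"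
  by (simp add: SL2_def det_mul)

lemma matrix_inv_mk:
  assumes "a*d - b*c = 1"
  shows "matrix_inv (mk a b c d) = mk d (-b) (-c) a"
proof -
  let ?A = "mk a b c d" and ?B = "mk d (-b) (-c) a"
  have AB: "?A ** ?B = mat 1" "?B ** ?A = mat 1"
    using assms by (simp_all add: mk_mult mat_1_mk algebra_simps)
  then have "invertible ?A" by (auto simp: invertible_def)
  then have "matrix_inv ?A ** ?A = mat 1" by (simp add: invertible_def matrix_inv_def someI_ex)
      (metis (mono_tags, lifting) AB someI_ex)
  then have "matrix_inv ?A ** (?A ** ?B) = ?B" by (simp add: matrix_mul_assoc)
  then show ?thesis using AB by simp
qed

lemma SL2_inv:
  assumes "A \<in> SL2"
  shows SL2_inv_mem: "matrix_inv A \<in> SL2" and SL2_inv_left: "matrix_inv A ** A = mat 1"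
    and SL2_inv_right: "A ** matrix_inv A = mat 1" 
  using assms by (auto elim!: SL2_cases simp: matrix_inv_mk mk_SL2 mk_mult mat_1_mk algebra_simps)

lemma SL2_inv_cancel:
  assumes "A \<in> SL2"
  shows SL2_inv_cancel_left: "matrix_inv A ** (A ** B) = B"
    and SL2_inv_cancel_left': "A ** (matrix_inv A ** B) = B"
    and SL2_inv_cancel_right: "B ** A ** matrix_inv A = B"
    and SL2_inv_cancel_right': "B ** matrix_inv A ** A = B"
  using SL2_inv[OF assms] by (simp_all add: matrix_mul_assoc) (simp_all flip: matrix_mul_assoc)

lemma SL2_inv_inv: "A \<in> SL2 \<Longrightarrow> matrix_inv (matrix_inv A) = A"
  by (auto elim!: SL2_cases simp: matrix_inv_mk algebra_simps)

lemma SL2_inv_mult: "A \<in> SL2 \<Longrightarrow> B \<in> SL2 \<Longrightarrow> matrix_inv (A ** B) = matrix_inv B ** matrix_inv A"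
  by (metis SL2_inv_cancel_left SL2_inv_cancel_right SL2_inv_mem SL2_mult matrix_mul_assoc SL2_inv_right matrix_mul_rid)

definition tr2 :: "cmat \<Rightarrow> complex" where "tr2 A = A$1$1 + A$2$2"

lemma tr2_mk [simp]: "tr2 (mk a b c d) = a + d" by (simp add: tr2_def)

lemma tr2_uminus [simp]: "tr2 (- A) = - tr2 A" by (simp add: tr2_def)

lemma tr2_conj:
  assumes "C \<in> SL2"
  shows "tr2 (C ** A ** matrix_inv C) = tr2 A"
proof -
  obtain a b c d where C: "C = mk a b c d" "a*d - b*c = 1" using assms by (rule SL2_cases)
  obtain x y z w where A: "A = mk x y z w" by (rule mk_cases)
  have "tr2 (C ** A ** matrix_inv C) = (a*d - b*c) * (x + w)"
    unfolding C(1) A matrix_inv_mk[OF C(2)] mk_mult by (simp add: algebra_simps)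
  then show ?thesis using C A by simp
qed

text \<open>Row inner products of the Hermitian form attached to a point \<open>(z, s)\<close> of upper half-space.\<close>

definition herm :: "complex \<times> real \<Rightarrow> complex \<Rightarrow> complex \<Rightarrow> complex \<Rightarrow> complex \<Rightarrow> complex" where
  "herm p u v u' v' = (u * fst p + v) * cnj (u' * fst p + v') + u * cnj u' * of_real ((snd p)^2)"

definition hnorm :: "complex \<times> real \<Rightarrow> complex \<Rightarrow> complex \<Rightarrow> real" where
  "hnorm p u v = (cmod (u * fst p + v))^2 + (cmod u)^2 * (snd p)^2"

lemma herm_self: "herm p u v u v = of_real (hnorm p u v)"
  by (simp add: herm_def hnorm_def norm_sq_cnj)

lemma act_mk: "act (mk a b c d) p = (herm p a b c d / of_real (hnorm p c d), snd p / hnorm p c d)"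
  by (simp add: act_def herm_def hnorm_def Let_def)

lemma hnorm_pos:
  assumes "p \<in> H3" "u \<noteq> 0 \<or> v \<noteq> 0" shows "hnorm p u v > 0"
  using assms by (cases "u = 0") (auto simp: hnorm_def H3_def intro!: add_nonneg_pos)

text \<open>This is the Gram determinant of two rows for a Hermitian form of determinant
  \<open>(snd p)^2\<close>; a change of basis of determinant one preserves it.\<close>

lemma gram:
  assumes "u * v' - v * u' = 1"
  shows "hnorm p u v * hnorm p u' v' = (cmod (herm p u v u' v'))^2 + (snd p)^2"
proof -
  obtain z s where p: "p = (z, s)" by (cases p)
  have c: "cnj u * cnj v' - cnj v * cnj u' = 1"
    using arg_cong[OF assms, of cnj] by simp
  have "herm p u v u v * herm p u' v' u' v' - herm p u v u' v' * cnj (herm p u v u' v')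
      = (u * v' - v * u') * (cnj u * cnj v' - cnj v * cnj u') * of_real (s^2)"
    unfolding herm_def p by (simp add: algebra_simps power2_eq_square)
  then have "complex_of_real (hnorm p u v * hnorm p u' v')
      = of_real ((cmod (herm p u v u' v'))^2 + (snd p)^2)"
    by (simp add: herm_self norm_sq_cnj assms c p) (simp add: algebra_simps)
  then show ?thesis by (simp only: of_real_eq_iff)
qed

lemma act_H3:
  assumes "A \<in> SL2" "p \<in> H3" shows "act A p \<in> H3"
proof -
  obtain a b c d where A: "A = mk a b c d" "a*d - b*c = 1" using assms(1) by (rule SL2_cases)
  then have "hnorm p c d > 0" using assms by (intro hnorm_pos) auto
  then show ?thesis using assms by (simp add: A act_mk H3_def)
qed

lemma act_one: "p \<in> H3 \<Longrightarrow> act (mat 1) p = p"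
  by (simp add: mat_1_mk act_mk herm_def hnorm_def)

lemma act_uminus: "act (- A) p = act A p"
proof (cases A rule: mk_cases)
  case (1 a b c d)
  have *: "herm p (-a) (-b) (-c) (-d) = herm p a b c d" by (simp add: herm_def algebra_simps)
  have **: "hnorm p (-c) (-d) = hnorm p c d"
    by (simp add: hnorm_def) (metis minus_add_distrib norm_minus_cancel uminus_add_conv_diff add.commute)
  show ?thesis unfolding 1 mk_uminus act_mk * ** ..
qed

text \<open>Moving the point by the matrix amounts to multiplying the row by the matrix, up to the
  factor \<open>hnorm p c d\<close>. Together with \<open>herm_act\<close> this gives
  \<open>act_mult\<close> without expanding coordinates.\<close>

lemma hnorm_act:
  assumes "a*d - b*c = 1" "p \<in> H3"
  shows "hnorm (act (mk a b c d) p) u v * hnorm p c d = hnorm p (u*a + v * c) (u*b + v * d)"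
proof -
  define N where "N = herm p a b c d"
  define D where "D = hnorm p c d"
  define E where "E = hnorm p a b"
  have D: "D > 0" unfolding D_def using assms by (intro hnorm_pos) auto
  have g: "E * D = (cmod N)^2 + (snd p)^2" unfolding E_def D_def N_def by (rule gram[OF assms(1)])
  have gc: "of_real E * of_real D = N * cnj N + complex_of_real ((snd p)^2)"
    using arg_cong[OF g, of complex_of_real] by (simp add: norm_sq_cnj)
  have 1: "hnorm (act (mk a b c d) p) u v * D^2 = (cmod (u * N + v * of_real D))^2 + (cmod u)^2 * (snd p)^2"
  proof -
    have "u * (N / of_real D) + v = (u * N + v * of_real D) / of_real D" using D by (simp add: field_simps)
    then have "(cmod (u * (N / of_real D) + v))^2 = (cmod (u * N + v * of_real D))^2 / D^2"
      using D by (simp add: norm_divide power_divide)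
    then show ?thesis using D
      by (simp add: act_mk hnorm_def[of "(_,_)"] N_def[symmetric] D_def[symmetric] power_divide field_simps)
  qed
  have 2: "complex_of_real (hnorm p (u*a + v * c) (u*b + v * d))
      = u * cnj u * of_real E + u * cnj v * N + cnj u * v * cnj N + v * cnj v * of_real D"
    unfolding herm_self[symmetric] N_def E_def D_def herm_def by (simp add: algebra_simps)
  have "complex_of_real (hnorm (act (mk a b c d) p) u v * D^2)
      = (u * N + v * of_real D) * cnj (u * N + v * of_real D) + u * cnj u * of_real ((snd p)^2)"
    unfolding 1 by (simp add: norm_sq_cnj)
  also have "\<dots> = u * cnj u * (N * cnj N + complex_of_real ((snd p)^2)) + of_real D * (u * cnj v * N + cnj u * v * cnj N + v * cnj v * of_real D)"
    by (simp add: algebra_simps)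
  also have "\<dots> = of_real D * of_real (hnorm p (u*a + v * c) (u*b + v * d))"
    unfolding 2 gc[symmetric] by (simp add: algebra_simps)
  finally have "hnorm (act (mk a b c d) p) u v * D^2 = D * hnorm p (u*a + v * c) (u*b + v * d)"
    unfolding of_real_mult[symmetric] by (simp only: of_real_eq_iff)
  then show ?thesis using D by (simp add: D_def[symmetric] power2_eq_square)
qed

lemma herm_act:
  assumes "a*d - b*c = 1" "p \<in> H3"
  shows "herm (act (mk a b c d) p) u v u' v' * of_real (hnorm p c d) = herm p (u*a + v * c) (u*b + v * d) (u'*a + v' * c) (u'*b + v' * d)"
proof -
  define N where "N = herm p a b c d"
  define D where "D = hnorm p c d"
  define E where "E = hnorm p a b"
  have D: "D > 0" unfolding D_def using assms by (intro hnorm_pos) auto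
  have g: "E * D = (cmod N)^2 + (snd p)^2" unfolding E_def D_def N_def by (rule gram[OF assms(1)])
  have gc: "of_real E * of_real D = N * cnj N + complex_of_real ((snd p)^2)"
    using arg_cong[OF g, of complex_of_real] by (simp add: norm_sq_cnj)
  have 1: "herm (act (mk a b c d) p) u v u' v' * (of_real D)^2 = (u * N + v * of_real D) * cnj (u' * N + v' * of_real D) + u * cnj u' * of_real ((snd p)^2)"
    using D by (simp add: act_mk herm_def[of "(_,_)"] N_def[symmetric] D_def[symmetric] field_simps power2_eq_square)
  have 2: "herm p (u*a + v * c) (u*b + v * d) (u'*a + v' * c) (u'*b + v' * d)
      = u * cnj u' * of_real E + u * cnj v' * N + cnj u' * v * cnj N + v * cnj v' * of_real D"
    unfolding E_def D_def herm_self[symmetric] N_def herm_def by (simp add: algebra_simps)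
  have "herm (act (mk a b c d) p) u v u' v' * (of_real D)^2
      = u * cnj u' * (N * cnj N + complex_of_real ((snd p)^2)) + of_real D * (u * cnj v' * N + cnj u' * v * cnj N + v * cnj v' * of_real D)"
    unfolding 1 by (simp add: algebra_simps)
  also have "\<dots> = of_real D * herm p (u*a + v * c) (u*b + v * d) (u'*a + v' * c) (u'*b + v' * d)"
    unfolding 2 gc[symmetric] by (simp add: algebra_simps)
  finally show ?thesis using D by (simp add: D_def[symmetric] power2_eq_square)
qed

lemma act_mult:
  assumes "A \<in> SL2" "B \<in> SL2" "p \<in> H3"
  shows "act (A ** B) p = act A (act B p)"
proof -
  obtain a b c d where A: "A = mk a b c d" "a*d - b*c = 1" using assms(1) by (rule SL2_cases)
  obtain x y z w where B: "B = mk x y z w" "x*w - y*z = 1" using assms(2) by (rule SL2_cases)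
  define q where "q = act (mk x y z w) p"
  have Bq: "act B p = q" by (simp add: B q_def)
  have D: "hnorm p z w > 0" using assms B by (intro hnorm_pos) auto
  have q: "q \<in> H3" using act_H3[OF assms(2,3)] by (simp add: Bq)
  have h: "hnorm q c d > 0" using q A by (intro hnorm_pos) auto
  have 1: "hnorm p (c*x + d*z) (c*y + d*w) = hnorm q c d * hnorm p z w"
    unfolding q_def by (rule hnorm_act[OF B(2) assms(3), symmetric])
  have 2: "herm p (a*x + b*z) (a*y + b*w) (c*x + d*z) (c*y + d*w) = herm q a b c d * of_real (hnorm p z w)"
    unfolding q_def by (rule herm_act[OF B(2) assms(3), symmetric])
  have 3: "snd q = snd p / hnorm p z w" by (simp add: q_def act_mk)
  show ?thesis
    unfolding Bq unfolding A B mk_mult act_mk 1 2 3 using D by simp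
qed

lemma act_inv:
  assumes "A \<in> SL2" "p \<in> H3"
  shows "act (matrix_inv A) (act A p) = p" "act A (act (matrix_inv A) p) = p"
  using assms act_mult[of "matrix_inv A" A p] act_mult[of A "matrix_inv A" p]
  by (simp_all add: SL2_inv_mem SL2_inv_left SL2_inv_right act_one)

section \<open>Change of variables for the hyperbolic volume\<close>

text \<open>Change of variables is available for absolutely integrable functions, volumes are
  nonnegative integrals. This dictionary includes the value infinity, which is what a non-integrable
  density has.\<close>

lemma nn_integral_lborel_eq_integral:
  fixes f :: "'a::euclidean_space \<Rightarrow> real"
  assumes "S \<in> sets borel" "f \<in> borel_measurable borel" "\<And>x. x \<in> S \<Longrightarrow> 0 \<le> f x"
  shows "(\<integral>\<^sup>+x. ennreal (indicator S x * f x) \<partial>lborel) =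
    (if f absolutely_integrable_on S then ennreal (integral S f) else \<infinity>)"
proof -
  let ?g = "\<lambda>x. indicator S x * f x"
  have m: "?g \<in> borel_measurable lebesgue" using assms(1,2)
    by (intro borel_measurable_times measurable_completion) auto
  have pos: "AE x in lebesgue. 0 \<le> ?g x" using assms(3) by (auto simp: indicator_def)
  have 1: "(\<integral>\<^sup>+x. ennreal (?g x) \<partial>lborel) = (\<integral>\<^sup>+x. ennreal (?g x) \<partial>lebesgue)"
    by (simp add: nn_integral_completion)
  show ?thesis
  proof (cases "f absolutely_integrable_on S")
    case True
    then have i: "integrable lebesgue ?g" by (simp add: set_integrable_def)
    show ?thesis unfolding 1 nn_integral_eq_integral[OF i pos]
      using set_lebesgue_integral_eq_integral(2)[OF True] True
      by (simp add: set_lebesgue_integral_def)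
  next
    case False
    then have "\<not> integrable lebesgue ?g" by (simp add: set_integrable_def)
    then have "\<not> (\<integral>\<^sup>+x. ennreal (?g x) \<partial>lebesgue) < \<infinity>" using integrableI_nonneg[OF m pos] by blast
    then show ?thesis unfolding 1 using False by (simp flip: top.not_eq_extremum)
  qed
qed

text \<open>The integrand is wrapped in \<open>real^1\<close> to match the vector-valued change of
  variables. That theorem transfers integrability in both directions, so the equality survives when
  both sides are infinite.\<close>

lemma nn_integral_change_of_variables_eq:
  fixes g :: "real^'m::{finite,wellorder} \<Rightarrow> real^'m::_" and f :: "real^'m::_ \<Rightarrow> real"
  assumes S: "S \<in> sets borel" and gS: "g ` S \<in> sets borel" and f: "f \<in> borel_measurable borel"
    and pos: "\<And>x. x \<in> S \<union> g ` S \<Longrightarrow> 0 \<le> f x"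
    and der: "\<And>x. x \<in> S \<Longrightarrow> (g has_derivative g' x) (at x within S)"
    and inj: "inj_on g S"
    and det: "\<And>x. x \<in> S \<Longrightarrow> \<bar>det (matrix (g' x))\<bar> * f (g x) = f x"
  shows "(\<integral>\<^sup>+x. ennreal (indicator (g ` S) x * f x) \<partial>lborel) = (\<integral>\<^sup>+x. ennreal (indicator S x * f x) \<partial>lborel)"
proof -
  have L: "S \<in> sets lebesgue" using S by auto
  have eq: "\<bar>det (matrix (g' x))\<bar> *\<^sub>R vec (f (g x)) = (vec (f x) :: real^1)" if "x \<in> S" for x
    using det[OF that] by (simp add: vec_eq_iff)
  have i1: "(\<lambda>x. \<bar>det (matrix (g' x))\<bar> *\<^sub>R (vec (f (g x)) :: real^1)) absolutely_integrable_on S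
      \<longleftrightarrow> (\<lambda>x. vec (f x) :: real^1) absolutely_integrable_on S"
    by (intro set_integrable_cong refl eq)
  have i2: "integral S (\<lambda>x. \<bar>det (matrix (g' x))\<bar> *\<^sub>R (vec (f (g x)) :: real^1)) = integral S (\<lambda>x. vec (f x) :: real^1)"
    by (intro integral_cong eq)
  have cov: "(\<lambda>x. vec (f x) :: real^1) absolutely_integrable_on S \<and> integral S (\<lambda>x. vec (f x) :: real^1) = b
     \<longleftrightarrow> (\<lambda>x. vec (f x) :: real^1) absolutely_integrable_on (g ` S) \<and> integral (g ` S) (\<lambda>x. vec (f x) :: real^1) = b" for b
    using has_absolute_integral_change_of_variables[OF L der inj, of "\<lambda>x. vec (f x) :: real^1" b]
    unfolding i1 i2 .
  have 1: "f absolutely_integrable_on S \<longleftrightarrow> f absolutely_integrable_on (g ` S)"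
    and 2: "f absolutely_integrable_on S \<Longrightarrow> integral S f = integral (g ` S) f"
    using cov[of "vec (integral S f)"] cov[of "vec (integral (g ` S) f)"]
    unfolding absolutely_integrable_on_1_iff integral_on_1_eq by (auto simp: vec_eq_iff)
  show ?thesis
    using nn_integral_lborel_eq_integral[OF S f] nn_integral_lborel_eq_integral[OF gS f] pos 1 2 by simp
qed

text \<open>Jacobian determinants live on \<open>real^3\<close>. \<open>vec3\<close> and its inverse
  \<open>pt3\<close> move upper half-space there and preserve Lebesgue measure, since boxes go to
  boxes with the same sides.\<close>

definition vec3 :: "complex \<times> real \<Rightarrow> real^3" where
  "vec3 p = vector [Re (fst p), Im (fst p), snd p]"

definition pt3 :: "real^3 \<Rightarrow> complex \<times> real" where
  "pt3 v = (Complex (v$1) (v$2), v$3)"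

lemma vec3_nth [simp]: "vec3 p $ 1 = Re (fst p)" "vec3 p $ 2 = Im (fst p)" "vec3 p $ 3 = snd p"
  by (simp_all add: vec3_def)

lemma vec3_eq_iff: "(v :: real^3) = w \<longleftrightarrow> v$1 = w$1 \<and> v$2 = w$2 \<and> v$3 = w$3"
  by (auto simp: vec_eq_iff forall_3)

lemma pt3_vec3 [simp]: "pt3 (vec3 p) = p" by (simp add: pt3_def)
lemma vec3_pt3 [simp]: "vec3 (pt3 v) = v" by (simp add: vec3_eq_iff pt3_def)

lemma vec3_image: "vec3 ` S = pt3 -` S"
  by (metis bij_betw_def bij_betw_byWitness bij_vimage_eq_inv_image image_inv_f_f inj_on_inverseI inv_equality pt3_vec3 surj_def vec3_pt3 top.extremum bij_def)

lemma pt3_measurable [measurable]: "pt3 \<in> borel_measurable borel"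
proof (rule borel_measurable_continuous_onI)
  show "continuous_on UNIV pt3" unfolding pt3_def Complex_eq by (intro continuous_intros)
qed

lemma distr_pt3: "distr lborel borel pt3 = lborel"
proof (rule sym, rule lborel_eqI)
  fix l u :: "complex \<times> real"
  assume le: "\<And>b. b \<in> Basis \<Longrightarrow> l \<bullet> b \<le> u \<bullet> b"
  have b: "(Basis :: (complex \<times> real) set) = {(1, 0), (\<i>, 0), (0, 1)}"
    by (auto simp: Basis_prod_def Basis_complex_def)
  have le': "Re (fst l) \<le> Re (fst u)" "Im (fst l) \<le> Im (fst u)" "snd l \<le> snd u"
    using le[of "(1,0)"] le[of "(\<i>,0)"] le[of "(0,1)"] by (simp_all add: b inner_Pair_0)
  have v: "pt3 -` box l u = box (vec3 l) (vec3 u)"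
    by (rule set_eqI) (simp add: mem_box_cart forall_3 mem_box b inner_Pair_0 pt3_def)
  have "emeasure (distr lborel borel pt3) (box l u) = emeasure lborel (box (vec3 l) (vec3 u))"
    by (subst emeasure_distr) (simp_all add: v)
  also have "\<dots> = (\<Prod>b\<in>Basis. (vec3 u - vec3 l) \<bullet> b)"
    using le' by (intro emeasure_lborel_box) (auto simp: Basis_vec_def inner_axis, metis exhaust_3 vec3_nth)
  also have "(\<Prod>b\<in>Basis. (vec3 u - vec3 l) \<bullet> b) = (\<Prod>i\<in>UNIV. (vec3 u - vec3 l) $ i)"
    by (simp add: Basis_vec_def cart_eq_inner_axis axis_eq_axis prod.UNION_disjoint)
  also have "\<dots> = (\<Prod>b\<in>Basis. (u - l) \<bullet> b)"
  proof -
    have "((1::complex), (0::real)) \<noteq> (\<i>, 0)" by (simp add: complex_eq_iff)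
    then have "(\<Prod>b\<in>Basis. (u - l) \<bullet> b) = ((u - l) \<bullet> (1, 0)) * (((u - l) \<bullet> (\<i>, 0)) * ((u - l) \<bullet> (0, 1)))"
      unfolding b by simp
    moreover have "(\<Prod>i\<in>UNIV. (vec3 u - vec3 l) $ i)
        = (vec3 u - vec3 l) $ 1 * ((vec3 u - vec3 l) $ 2 * (vec3 u - vec3 l) $ 3)"
      unfolding UNIV_3 by simp
    ultimately show ?thesis by (simp only: vector_minus_component vec3_nth inner_Pair_0)
        (simp add: inner_complex_def)
  qed
  finally show "emeasure (distr lborel borel pt3) (box l u) = (\<Prod>b\<in>Basis. (u - l) \<bullet> b)" .
qed simp

definition ht3 :: "real^3 \<Rightarrow> real" where "ht3 v = 1 / (v$3)^3"

lemma ht3_measurable [measurable]: "ht3 \<in> borel_measurable borel"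
  unfolding ht3_def by measurable

lemma H3_sets [measurable]: "H3 \<in> sets borel"
proof -
  have "open H3" unfolding H3_def by (intro open_Collect_less continuous_intros)
  then show ?thesis by (rule borel_open)
qed

lemma hvol_eq_nn_integral:
  assumes "E \<in> sets borel" "E \<subseteq> H3"
  shows "emeasure hvol E = (\<integral>\<^sup>+p. ennreal (1 / (snd p)^3) * indicator E p \<partial>lborel)"
proof -
  have snd: "snd \<in> borel_measurable (borel :: (complex \<times> real) measure)"
    by (intro borel_measurable_continuous_onI continuous_intros)
  have "emeasure hvol E = (\<integral>\<^sup>+p. ennreal (indicator H3 p / (snd p)^3) * indicator E p \<partial>lborel)"
    unfolding hvol_def using assms(1) H3_sets
    by (intro emeasure_density measurable_compose[OF _ measurable_ennreal] borel_measurable_divide borel_measurable_power)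
      (auto intro: measurable_compose[OF _ snd] borel_measurable_indicator snd)
  also have "\<dots> = (\<integral>\<^sup>+p. ennreal (1 / (snd p)^3) * indicator E p \<partial>lborel)"
    using assms(2) by (intro nn_integral_cong) (auto simp: indicator_def)
  finally show ?thesis .
qed

lemma emeasure_hvol:
  assumes E: "E \<in> sets borel" "E \<subseteq> H3"
  shows "emeasure hvol E = (\<integral>\<^sup>+v. ennreal (indicator (vec3 ` E) v * ht3 v) \<partial>lborel)"
proof -
  have "snd \<in> borel_measurable (borel :: (complex \<times> real) measure)"
    by (intro borel_measurable_continuous_onI continuous_intros)
  then have m: "(\<lambda>p::complex \<times> real. ennreal (1 / (snd p)^3) * indicator E p) \<in> borel_measurable borel"
    by (intro borel_measurable_times_ennreal measurable_compose[OF _ measurable_ennreal] borel_measurable_divide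
        borel_measurable_power borel_measurable_const borel_measurable_indicator E(1))
  have "emeasure hvol E = (\<integral>\<^sup>+p. ennreal (1 / (snd p)^3) * indicator E p \<partial>lborel)"
    by (rule hvol_eq_nn_integral[OF E])
  also have "\<dots> = (\<integral>\<^sup>+p. ennreal (1 / (snd p)^3) * indicator E p \<partial>(distr lborel borel pt3))"
    by (simp add: distr_pt3)
  also have "\<dots> = (\<integral>\<^sup>+v. ennreal (1 / (snd (pt3 v))^3) * indicator E (pt3 v) \<partial>lborel)"
    by (rule nn_integral_distr) (use m in auto)
  also have "\<dots> = (\<integral>\<^sup>+v. ennreal (indicator (vec3 ` E) v * ht3 v) \<partial>lborel)"
    by (intro nn_integral_cong) (auto simp: vec3_image indicator_def ht3_def pt3_def)
  finally show ?thesis .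
qed

lemma hvol_transport:
  assumes E: "E \<in> sets borel" "E \<subseteq> H3" and E': "f ` E \<in> sets borel" "f ` E \<subseteq> H3" and inj: "inj_on f E"
    and der: "\<And>v. v \<in> vec3 ` E \<Longrightarrow> ((\<lambda>v. vec3 (f (pt3 v))) has_derivative g' v) (at v)"
    and det: "\<And>v. v \<in> vec3 ` E \<Longrightarrow> \<bar>det (matrix (g' v))\<bar> * ht3 (vec3 (f (pt3 v))) = ht3 v"
  shows "emeasure hvol (f ` E) = emeasure hvol E"
proof -
  let ?g = "\<lambda>v. vec3 (f (pt3 v))"
  have im: "vec3 ` f ` E = ?g ` vec3 ` E" by (simp add: image_image)
  have m: "vec3 ` X \<in> sets borel" if "X \<in> sets borel" for X
    unfolding vec3_image using measurable_sets[OF pt3_measurable that] by simp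
  show ?thesis
    unfolding emeasure_hvol[OF E] emeasure_hvol[OF E'] im
  proof (rule nn_integral_change_of_variables_eq[where g' = g'])
    show "?g ` vec3 ` E \<in> sets borel" using m[OF E'(1)] by (simp add: im)
    show "inj_on ?g (vec3 ` E)" using inj by (auto simp: inj_on_def) (metis pt3_vec3)
    show "0 \<le> ht3 x" if "x \<in> vec3 ` E \<union> ?g ` vec3 ` E" for x
    proof -
      from that have "x \<in> vec3 ` (E \<union> f ` E)" by (simp only: image_Un im)
      then obtain p where "p \<in> E \<union> f ` E" "x = vec3 p" by (rule imageE)
      then have "p \<in> H3" "x $ 3 = snd p" using E(2) E'(2) by (blast, simp)
      then show ?thesis by (simp add: ht3_def H3_def)
    qed
    show "(?g has_derivative g' v) (at v within vec3 ` E)" if "v \<in> vec3 ` E" for v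
      using der[OF that] by (rule has_derivative_at_withinI)
  qed (use m[OF E(1)] det in simp_all)
qed

lemma herm_continuous: "continuous_on UNIV (\<lambda>p. herm p a b c d)"
  unfolding herm_def by (intro continuous_intros)

lemma hnorm_continuous: "continuous_on UNIV (\<lambda>p. hnorm p c d)"
  unfolding hnorm_def by (intro continuous_intros)

lemma act_continuous:
  assumes "A \<in> SL2" shows "continuous_on H3 (act A)"
proof -
  obtain a b c d where A: "A = mk a b c d" "a*d - b*c = 1" using assms by (rule SL2_cases)
  have "hnorm p c d \<noteq> 0" if "p \<in> H3" for p
    using hnorm_pos[OF that, of c d] A(2) by fastforce
  moreover have "act A = (\<lambda>p. (herm p a b c d / of_real (hnorm p c d), snd p / hnorm p c d))"
    by (rule ext) (simp add: A act_mk)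
  moreover have "continuous_on H3 (\<lambda>p. herm p a b c d)" "continuous_on H3 (\<lambda>p. hnorm p c d)"
    using herm_continuous hnorm_continuous continuous_on_subset by blast+
  ultimately show ?thesis by (auto intro!: continuous_intros)
qed

lemma act_image_eq:
  assumes "A \<in> SL2" "E \<subseteq> H3"
  shows "act A ` E = H3 \<inter> act (matrix_inv A) -` E"
proof
  show "act A ` E \<subseteq> H3 \<inter> act (matrix_inv A) -` E"
    using assms act_H3 act_inv(1) by auto
  show "H3 \<inter> act (matrix_inv A) -` E \<subseteq> act A ` E"
  proof
    fix x assume "x \<in> H3 \<inter> act (matrix_inv A) -` E"
    then have "x = act A (act (matrix_inv A) x)" "act (matrix_inv A) x \<in> E"
      using act_inv(2)[OF assms(1)] by auto
    then show "x \<in> act A ` E" by (rule image_eqI)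
  qed
qed

lemma act_image_sets:
  assumes "A \<in> SL2" "E \<in> sets borel" "E \<subseteq> H3"
  shows "act A ` E \<in> sets borel"
proof -
  have "act (matrix_inv A) \<in> borel_measurable (restrict_space borel H3)"
    by (intro borel_measurable_continuous_on_restrict act_continuous SL2_inv_mem assms)
  then have "act (matrix_inv A) -` E \<inter> space (restrict_space borel H3) \<in> sets (restrict_space borel H3)"
    using assms(2) by (rule measurable_sets)
  then have "act (matrix_inv A) -` E \<inter> H3 \<in> sets borel"
    by (auto simp: sets_restrict_space_iff space_restrict_space)
  then show ?thesis by (simp add: act_image_eq[OF assms(1,3)] Int_commute)
qed

lemma act_image_open:
  assumes "A \<in> SL2" "open U" "U \<subseteq> H3"
  shows "open (act A ` U)"
proof -
  have "open H3" unfolding H3_def by (intro open_Collect_less continuous_intros)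
  then have "open (H3 \<inter> act (matrix_inv A) -` U)"
    by (intro continuous_open_preimage act_continuous SL2_inv_mem assms)
  then show ?thesis by (simp add: act_image_eq[OF assms(1,3)])
qed

lemma act_inj_on: "A \<in> SL2 \<Longrightarrow> inj_on (act A) H3"
  by (rule inj_on_inverseI[where g = "act (matrix_inv A)"]) (rule act_inv)

text \<open>Here \<open>d\<close> is 1 or -1, so the action is the Euclidean translation by
  \<open>d * b\<close>. As the units of the ring are 1 and -1, this and
  \<open>hvol_inversion\<close> cover all of \<open>Gam\<close>.\<close>

lemma hvol_translation:
  assumes E: "E \<in> sets borel" "E \<subseteq> H3" and A: "A = mk a b 0 d" "A \<in> SL2" "a = d"
  shows "emeasure hvol (act A ` E) = emeasure hvol E"
proof -
  have dd: "d * d = 1" using A by (simp add: mk_SL2)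
  then have d2: "d = 1 \<or> d = -1" using square_eq_1_iff by blast
  have act: "act A p = (fst p + d * b, snd p)" for p
    using d2 unfolding A(1) act_mk herm_def hnorm_def A(3) by (auto simp: algebra_simps)
  show ?thesis
  proof (rule hvol_transport[OF E, where g' = "\<lambda>v h. h"])
    show "act A ` E \<in> sets borel" by (rule act_image_sets[OF A(2) E])
    show "act A ` E \<subseteq> H3" using act_H3[OF A(2)] E(2) by blast
    show "inj_on (act A) E" using act_inj_on[OF A(2)] E(2) by (rule inj_on_subset)
    have "(\<lambda>v. vec3 (act A (pt3 v))) = (\<lambda>v. v + vec3 (d * b, 0))"
      by (rule ext) (simp add: vec3_eq_iff act pt3_def)
    then show "((\<lambda>v. vec3 (act A (pt3 v))) has_derivative (\<lambda>h. h)) (at v)" for v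
      by (auto intro!: derivative_eq_intros)
    have "matrix (\<lambda>h::real^3. h) = mat 1" by (auto simp: matrix_def mat_def axis_def vec_eq_iff)
    then show "\<bar>det (matrix (\<lambda>h::real^3. h))\<bar> * ht3 (vec3 (act A (pt3 v))) = ht3 v" for v
      by (simp add: ht3_def act pt3_def)
  qed
qed

text \<open>The determinant of the numerators in the Jacobian matrix of an inversion followed by a
  rotation and scaling. With \<open>k = k1 + i k2\<close> and \<open>w = X + i Y\<close>,
  \<open>P\<close> and \<open>Q\<close> are the real and imaginary parts of
  \<open>k * cnj w\<close>, and \<open>l\<close> is the scaling of heights.\<close>

lemma inversion_det:
  fixes X Y T R k1 k2 l :: real
  assumes "R = X^2 + Y^2 + T^2"
  defines "P \<equiv> k1*X + k2*Y" and "Q \<equiv> k2*X - k1*Y"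
  shows "(2*P*X - k1*R) * (2*Q*Y + k1*R) * (l*R - 2*l*T*T)
       + (2*P*Y - k2*R) * (2*Q*T) * (- 2*l*T*X)
       + (2*P*T) * (2*Q*X - k2*R) * (- 2*l*T*Y)
       - (2*P*X - k1*R) * (2*Q*T) * (- 2*l*T*Y)
       - (2*P*Y - k2*R) * (2*Q*X - k2*R) * (l*R - 2*l*T*T)
       - (2*P*T) * (2*Q*Y + k1*R) * (- 2*l*T*X) = l * (k1^2 + k2^2) * R^3"
  unfolding P_def Q_def assms(1) by algebra

text \<open>Bruhat decomposition: translate by \<open>d/c\<close>, invert in the unit hemisphere,
  rotate and scale by \<open>k = 1/c^2\<close>, translate by \<open>a/c\<close>. The Jacobian
  \<open>l^3 / R^3\<close> is the cube of the factor by which heights change, which is what the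
  density \<open>1 / s^3\<close> compensates.\<close>

lemma hvol_inversion:
  assumes E: "E \<in> sets borel" "E \<subseteq> H3" and A: "A = mk a b c d" "A \<in> SL2" "c \<noteq> 0"
  shows "emeasure hvol (act A ` E) = emeasure hvol E"
proof -
  have det: "a * d - b * c = 1" using A by (simp add: mk_SL2)
  define k where "k = 1 / c^2"
  define k1 where "k1 = Re k"
  define k2 where "k2 = Im k"
  define l where "l = cmod k"
  define e1 where "e1 = Re (d/c)"
  define e2 where "e2 = Im (d/c)"
  define f1 where "f1 = Re (a/c)"
  define f2 where "f2 = Im (a/c)"
  define X where "X = (\<lambda>v::real^3. v$1 + e1)"
  define Y where "Y = (\<lambda>v::real^3. v$2 + e2)"
  define R where "R = (\<lambda>v::real^3. (X v)^2 + (Y v)^2 + (v$3)^2)"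
  define P where "P = (\<lambda>v. k1 * X v + k2 * Y v)"
  define Q where "Q = (\<lambda>v. k2 * X v - k1 * Y v)"
  have l: "l > 0" "l^2 = k1^2 + k2^2"
    using A(3) by (simp add: l_def k_def, simp add: l_def cmod_power2 k1_def k2_def)
  have act: "act A p = (a/c - k * cnj (fst p + d/c) / of_real ((cmod (fst p + d/c))^2 + (snd p)^2),
      l * snd p / ((cmod (fst p + d/c))^2 + (snd p)^2))" if "p \<in> H3" for p
  proof -
    define w where "w = fst p + d/c"
    define r where "r = (cmod w)^2 + (snd p)^2"
    have r: "r > 0" using that by (auto simp: r_def H3_def intro!: add_nonneg_pos)
    have cw: "c * fst p + d = c * w" using A(3) by (simp add: w_def field_simps)
    have hn: "hnorm p c d = (cmod c)^2 * r"
      unfolding hnorm_def cw norm_mult r_def power_mult_distrib by (simp add: algebra_simps)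
    have rc: "complex_of_real r = w * cnj w + of_real ((snd p)^2)" by (simp add: r_def norm_sq_cnj)
    have aw: "a * fst p + b = a * w - 1/c" using A(3) det by (simp add: w_def field_simps)
    have he: "herm p a b c d = a * cnj c * of_real r - cnj c / c * cnj w"
      unfolding herm_def cw aw rc by (simp add: algebra_simps)
    have hc: "complex_of_real (hnorm p c d) = c * cnj c * of_real r" by (simp add: hn norm_sq_cnj)
    have "herm p a b c d / of_real (hnorm p c d) = a/c - k * cnj w / of_real r"
      using A(3) r unfolding he hc by (simp add: k_def field_simps power2_eq_square)
    moreover have "snd p / hnorm p c d = l * snd p / r"
      using A(3) r unfolding hn by (simp add: l_def k_def norm_divide norm_power)
    ultimately show ?thesis unfolding A(1) act_mk by (simp add: r_def w_def)
  qed
  define F where "F = (\<lambda>v::real^3. (f1 - P v / R v) *\<^sub>R (axis 1 1 :: real^3) + (f2 - Q v / R v) *\<^sub>R axis 2 1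
      + (l * v$3 / R v) *\<^sub>R axis 3 1)"
  define dR where "dR = (\<lambda>v h::real^3. 2 * X v * h$1 + 2 * Y v * h$2 + 2 * v$3 * h$3)"
  define F' where "F' = (\<lambda>v h::real^3. ((P v * dR v h - (k1 * h$1 + k2 * h$2) * R v) / (R v)^2) *\<^sub>R (axis 1 1 :: real^3)
      + ((Q v * dR v h - (k2 * h$1 - k1 * h$2) * R v) / (R v)^2) *\<^sub>R axis 2 1
      + ((l * h$3 * R v - l * v$3 * dR v h) / (R v)^2) *\<^sub>R axis 3 1)"
  have Rpos: "R v > 0" if "v$3 > 0" for v using that by (auto simp: R_def intro!: add_nonneg_pos)
  have ax: "axis i (1::real) $ j = (if j = i then 1 else 0)" for i j :: 3 by (simp add: axis_def)
  have Feq: "vec3 (act A (pt3 v)) = F v" if "v$3 > 0" for v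
  proof -
    have p: "pt3 v \<in> H3" using that by (simp add: H3_def pt3_def)
    have w: "fst (pt3 v) + d/c = Complex (X v) (Y v)"
      by (simp add: pt3_def X_def Y_def e1_def e2_def complex_eq_iff)
    have r: "(cmod (Complex (X v) (Y v)))^2 + (snd (pt3 v))^2 = R v"
      by (simp add: cmod_power2 R_def pt3_def)
    show ?thesis unfolding vec3_eq_iff act[OF p] w r F_def
      by (simp add: ax f1_def f2_def P_def Q_def k1_def k2_def pt3_def algebra_simps)
  qed
  have nth: "((\<lambda>v::real^3. v $ i) has_derivative (\<lambda>h. h $ i)) (at v)" for i v
    by (rule bounded_linear_imp_has_derivative) (rule bounded_linear_vec_nth)
  have dF: "(F has_derivative F' v) (at v)" if v: "v$3 > 0" for v
  proof -
    have R0: "R v \<noteq> 0" using Rpos[OF v] by simp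
    have dX: "(X has_derivative (\<lambda>h. h$1)) (at v)" "(Y has_derivative (\<lambda>h. h$2)) (at v)"
      unfolding X_def Y_def by (auto intro!: derivative_eq_intros nth)
    have dRR: "(R has_derivative dR v) (at v)"
      unfolding R_def dR_def by (auto intro!: derivative_eq_intros dX nth)
    have dP: "(P has_derivative (\<lambda>h. k1 * h$1 + k2 * h$2)) (at v)"
      "(Q has_derivative (\<lambda>h. k2 * h$1 - k1 * h$2)) (at v)"
      unfolding P_def Q_def by (auto intro!: derivative_eq_intros dX)
    show ?thesis unfolding F_def
      by (rule derivative_eq_intros dP dRR nth refl R0 | rule ext)+
        (use R0 in \<open>simp add: F'_def vec3_eq_iff ax field_simps power2_eq_square\<close>)
  qed
  have detF: "\<bar>det (matrix (F' v))\<bar> * ht3 (F v) = ht3 v" if v: "v$3 > 0" for v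
  proof -
    have R0: "R v > 0" using Rpos[OF v] .
    define r where "r = R v"
    define p where "p = P v"
    define w where "w = Q v"
    define x where "x = X v"
    define y where "y = Y v"
    define t where "t = v$3"
    have m: "matrix (F' v) $ i $ j = F' v (axis j 1) $ i" for i j by (simp add: matrix_def)
    have frac: "(n1/s) * (n5/s) * (n9/s) + (n2/s) * (n6/s) * (n7/s) + (n3/s) * (n4/s) * (n8/s)
        - (n1/s) * (n6/s) * (n8/s) - (n2/s) * (n4/s) * (n9/s) - (n3/s) * (n5/s) * (n7/s)
      = (n1*n5*n9 + n2*n6*n7 + n3*n4*n8 - n1*n6*n8 - n2*n4*n9 - n3*n5*n7) / s^3"
      for n1 n2 n3 n4 n5 n6 n7 n8 n9 s :: real
      by (simp add: power3_eq_cube add_divide_distrib diff_divide_distrib)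
    have e:
      "F' v (axis 1 1) $ 1 = (2*p*x - k1*r) / r^2" "F' v (axis 2 1) $ 1 = (2*p*y - k2*r) / r^2"
      "F' v (axis 3 1) $ 1 = (2*p*t) / r^2" "F' v (axis 1 1) $ 2 = (2*w*x - k2*r) / r^2"
      "F' v (axis 2 1) $ 2 = (2*w*y + k1*r) / r^2" "F' v (axis 3 1) $ 2 = (2*w*t) / r^2"
      "F' v (axis 1 1) $ 3 = (- 2*l*t*x) / r^2" "F' v (axis 2 1) $ 3 = (- 2*l*t*y) / r^2"
      "F' v (axis 3 1) $ 3 = (l*r - 2*l*t*t) / r^2"
      unfolding F'_def dR_def r_def p_def w_def x_def y_def t_def
      by (simp_all add: ax algebra_simps)
    have "det (matrix (F' v)) =
       (((2*p*x - k1*r) * (2*w*y + k1*r) * (l*r - 2*l*t*t)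
       + (2*p*y - k2*r) * (2*w*t) * (- 2*l*t*x)
       + (2*p*t) * (2*w*x - k2*r) * (- 2*l*t*y)
       - (2*p*x - k1*r) * (2*w*t) * (- 2*l*t*y)
       - (2*p*y - k2*r) * (2*w*x - k2*r) * (l*r - 2*l*t*t)
       - (2*p*t) * (2*w*y + k1*r) * (- 2*l*t*x))) / (r^2)^3"
      unfolding det_3 m e by (rule frac)
    also have "\<dots> = l * (k1^2 + k2^2) * r^3 / (r^2)^3"
      using inversion_det[of r x y t k1 k2 l] by (simp add: r_def R_def x_def y_def t_def p_def P_def w_def Q_def)
    also have "\<dots> = l * l^2 * r^3 / (r^2)^3" using l(2) by simp
    also have "\<dots> = l^3 / r^3" using R0 by (simp add: r_def field_simps eval_nat_numeral)
    finally have "det (matrix (F' v)) = l^3 / r^3" .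
    moreover have "ht3 (F v) = r^3 / (l^3 * (v$3)^3)"
      using l R0 by (simp add: ht3_def F_def ax r_def power_divide power_mult_distrib)
    ultimately show ?thesis using l R0 v by (simp add: r_def ht3_def)
  qed
  have pos: "v$3 > 0" if "v \<in> vec3 ` E" for v using that E(2) by (auto simp: H3_def)
  show ?thesis
  proof (rule hvol_transport[OF E, where g' = F'])
    show "act A ` E \<in> sets borel" by (rule act_image_sets[OF A(2) E])
    show "act A ` E \<subseteq> H3" using act_H3[OF A(2)] E(2) by blast
    show "inj_on (act A) E" using act_inj_on[OF A(2)] E(2) by (rule inj_on_subset)
    fix v assume "v \<in> vec3 ` E"
    then have v: "v$3 > 0" by (rule pos)
    show "((\<lambda>v. vec3 (act A (pt3 v))) has_derivative F' v) (at v)"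
    proof (rule has_derivative_transform_within_open[OF dF[OF v]])
      show "open {v::real^3. v$3 > 0}" by (intro open_Collect_less continuous_intros)
      show "v \<in> {v::real^3. v$3 > 0}" using v by simp
      show "\<And>x. x \<in> {v::real^3. v$3 > 0} \<Longrightarrow> F x = vec3 (act A (pt3 x))" using Feq by simp
    qed
    show "\<bar>det (matrix (F' v))\<bar> * ht3 (vec3 (act A (pt3 v))) = ht3 v"
      using detF[OF v] Feq[OF v] by simp
  qed
qed

section \<open>Congruence subgroups over the ring of integers\<close>

definition om :: complex where "om = \<i> * of_real (sqrt 2)"

definition zc :: "int \<Rightarrow> int \<Rightarrow> complex" where "zc x y = of_int x + of_int y * om"

definition Zw :: "complex set" where "Zw = range (\<lambda>(x, y). zc x y)"

lemma om_sq: "om * om = -2"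
proof -
  have "of_real (sqrt 2) * of_real (sqrt 2) = complex_of_real 2" by (simp flip: of_real_mult)
  then show ?thesis by (simp add: om_def algebra_simps)
qed

lemma zc_Re [simp]: "Re (zc x y) = of_int x" and zc_Im [simp]: "Im (zc x y) = of_int y * sqrt 2"
  by (simp_all add: zc_def om_def)

lemma zc_eq_iff [simp]: "zc x y = zc x' y' \<longleftrightarrow> x = x' \<and> y = y'"
  by (auto simp: complex_eq_iff)

lemma zc_in [simp]: "zc x y \<in> Zw" by (auto simp: Zw_def)

lemma Zw_cases: assumes "z \<in> Zw" obtains x y where "z = zc x y" using assms by (auto simp: Zw_def)

lemma zc_add: "zc x y + zc x' y' = zc (x + x') (y + y')" by (simp add: zc_def algebra_simps)
lemma zc_diff: "zc x y - zc x' y' = zc (x - x') (y - y')" by (simp add: zc_def algebra_simps)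
lemma zc_uminus: "- zc x y = zc (-x) (-y)" by (simp add: zc_def)
lemma zc_mult: "zc x y * zc x' y' = zc (x*x' - 2*y*y') (x*y' + y*x')"
proof -
  have "zc x y * zc x' y' = of_int (x*x') + of_int (y*y') * (om * om) + of_int (x*y' + y*x') * om"
    by (simp add: zc_def algebra_simps)
  then show ?thesis by (simp add: om_sq zc_def)
qed
lemma zc_of_int: "of_int x = zc x 0" by (simp add: zc_def)
lemma zc_0: "0 = zc 0 0" and zc_1: "1 = zc 1 0" by (simp_all add: zc_def)

lemma Zw_add [intro]: "x \<in> Zw \<Longrightarrow> y \<in> Zw \<Longrightarrow> x + y \<in> Zw"
  and Zw_diff [intro]: "x \<in> Zw \<Longrightarrow> y \<in> Zw \<Longrightarrow> x - y \<in> Zw"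
  and Zw_mult [intro]: "x \<in> Zw \<Longrightarrow> y \<in> Zw \<Longrightarrow> x * y \<in> Zw"
  by (auto elim!: Zw_cases simp: zc_add zc_diff zc_mult)

lemma Zw_uminus [intro]: "x \<in> Zw \<Longrightarrow> - x \<in> Zw"
  by (auto elim!: Zw_cases simp: zc_uminus)

lemma Zw_uminus_iff [simp]: "- x \<in> Zw \<longleftrightarrow> x \<in> Zw" using Zw_uminus by fastforce

lemma Zw_const [simp]: "0 \<in> Zw" "1 \<in> Zw" "of_int x \<in> Zw" "of_nat n \<in> Zw"
  using zc_in zc_0 zc_1 zc_of_int by (metis, metis, metis, metis of_int_of_nat_eq)

text \<open>On \<open>Zw\<close> the squared modulus is an integer already; the floor only gives it
  the type \<open>nat\<close>, so that least values exist.\<close>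

definition nrm :: "complex \<Rightarrow> nat" where "nrm z = nat \<lfloor>(cmod z)^2\<rfloor>"

lemma cmod_zc: "(cmod (zc x y))^2 = of_int (x^2 + 2*y^2)"
  by (simp add: cmod_power2 power_mult_distrib)

lemma Zw_nrm: assumes "z \<in> Zw" shows "(cmod z)^2 = real (nrm z)"
proof -
  obtain x y where z: "z = zc x y" using assms by (rule Zw_cases)
  show ?thesis unfolding nrm_def z cmod_zc by (simp add: floor_of_int[of "x^2+2*y^2", simplified])
qed

lemma Zw_ge1: assumes "z \<in> Zw" "z \<noteq> 0" shows "1 \<le> cmod z"
proof -
  have "(cmod z)^2 > 0" using assms by simp
  then have "real (nrm z) \<ge> 1" using Zw_nrm[OF assms(1)] by simp
  then have "1^2 \<le> (cmod z)^2" using Zw_nrm[OF assms(1)] by simp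
  then show ?thesis by (rule power2_le_imp_le) simp
qed

lemma Zw_small: "z \<in> Zw \<Longrightarrow> cmod z < 1 \<Longrightarrow> z = 0"
  using Zw_ge1 by force

text \<open>Units have modulus 1, and x^2 + 2 y^2 = 1 forces y = 0.\<close>

lemma Zw_unit:
  assumes "a \<in> Zw" "d \<in> Zw" "a * d = 1" shows "a = 1 \<and> d = 1 \<or> a = -1 \<and> d = -1"
proof -
  have "cmod a * cmod d = 1" using assms(3) by (metis norm_mult norm_one)
  moreover have "a \<noteq> 0" "d \<noteq> 0" using assms(3) by auto
  then have "1 \<le> cmod a" "1 \<le> cmod d" using assms Zw_ge1 by blast+
  ultimately have "cmod a = 1" by (smt (verit) mult_le_cancel_left1)
  moreover obtain x y where a: "a = zc x y" using assms(1) by (rule Zw_cases)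
  ultimately have "real_of_int (x^2 + 2*y^2) = 1" using cmod_zc[of x y] by simp
  then have *: "x^2 + 2*y^2 = 1" by (simp only: of_int_eq_1_iff)
  have "y = 0"
  proof (rule ccontr)
    assume "y \<noteq> 0"
    then have "y^2 > 0" by simp
    then show False using * zero_le_power2[of x] by linarith
  qed
  then have "x = 1 \<or> x = -1" using * by (simp add: power2_eq_1_iff)
  then have pm1: "a = 1 \<or> a = -1" using \<open>y = 0\<close> by (auto simp: a zc_def)
  then have "a * a = 1" by auto
  then have "d = a" using assms(3) by (metis mult.assoc mult_1 mult_1_right)
  then show ?thesis using pm1 by simp
qed

text \<open>Rounding both coordinates leaves at most 1/4 + 1/2 = 3/4. That this is below 1 drives
  \<open>reduction_S0\<close> and \<open>Gam_reduction\<close>.\<close>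

lemma Zw_cover: obtains u where "u \<in> Zw" "\<bar>Re (z - u)\<bar> \<le> 1/2" "\<bar>Im (z - u)\<bar> \<le> sqrt 2 / 2" "(cmod (z - u))^2 \<le> 3/4"
proof -
  define x where "x = round (Re z)"
  define y where "y = round (Im z / sqrt 2)"
  have 1: "\<bar>Re (z - zc x y)\<bar> \<le> 1/2" using of_int_round_abs_le[of "Re z"] by (simp add: x_def abs_minus_commute)
  have "\<bar>Im z / sqrt 2 - of_int y\<bar> \<le> 1/2" using of_int_round_abs_le[of "Im z / sqrt 2"] by (simp add: y_def abs_minus_commute)
  then have "sqrt 2 * \<bar>Im z / sqrt 2 - of_int y\<bar> \<le> sqrt 2 * (1/2)" by (intro mult_left_mono) auto
  moreover have "sqrt 2 * \<bar>Im z / sqrt 2 - of_int y\<bar> = \<bar>sqrt 2 * (Im z / sqrt 2 - of_int y)\<bar>" by (simp add: abs_mult)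
  ultimately have 2: "\<bar>Im (z - zc x y)\<bar> \<le> sqrt 2 / 2" by (simp add: algebra_simps)
  have "(Re (z - zc x y))^2 \<le> (1/2)^2" using 1 by (metis abs_ge_zero power2_abs power_mono)
  moreover have "(Im (z - zc x y))^2 \<le> (sqrt 2/2)^2" using 2 by (metis abs_ge_zero power2_abs power_mono)
  ultimately have "(cmod (z - zc x y))^2 \<le> 3/4" by (simp add: cmod_power2 power_divide)
  with 1 2 that show ?thesis by (meson zc_in)
qed

lemma Zw_finite: "finite {z \<in> Zw. cmod z \<le> T}"
proof -
  have "{z \<in> Zw. cmod z \<le> T} \<subseteq> (\<lambda>(x, y). zc x y) ` ({-\<lceil>T\<rceil>..\<lceil>T\<rceil>} \<times> {-\<lceil>T\<rceil>..\<lceil>T\<rceil>})"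
  proof
    fix z assume "z \<in> {z \<in> Zw. cmod z \<le> T}"
    then obtain x y where z: "z = zc x y" "cmod z \<le> T" by (auto elim: Zw_cases)
    have 1: "\<bar>real_of_int x\<bar> \<le> T" using abs_Re_le_cmod[of z] z by simp
    have "\<bar>real_of_int y\<bar> * sqrt 2 \<le> T" using abs_Im_le_cmod[of z] z by (simp add: abs_mult)
    moreover have "\<bar>real_of_int y\<bar> * 1 \<le> \<bar>real_of_int y\<bar> * sqrt 2" by (intro mult_left_mono) auto
    ultimately have 2: "\<bar>real_of_int y\<bar> \<le> T" by linarith
    have "x \<in> {-\<lceil>T\<rceil>..\<lceil>T\<rceil>}" "y \<in> {-\<lceil>T\<rceil>..\<lceil>T\<rceil>}" using 1 2 by (auto simp: abs_le_iff) linarith+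
    then show "z \<in> (\<lambda>(x, y). zc x y) ` ({-\<lceil>T\<rceil>..\<lceil>T\<rceil>} \<times> {-\<lceil>T\<rceil>..\<lceil>T\<rceil>})" using z by auto
  qed
  then show ?thesis by (rule finite_subset) auto
qed

lemma Zw_countable: "countable Zw" unfolding Zw_def by (intro countable_image) simp

definition Gam :: "cmat set" where
  "Gam = {A \<in> SL2. A$1$1 \<in> Zw \<and> A$1$2 \<in> Zw \<and> A$2$1 \<in> Zw \<and> A$2$2 \<in> Zw}"

lemma mk_Gam: "mk a b c d \<in> Gam \<longleftrightarrow> a \<in> Zw \<and> b \<in> Zw \<and> c \<in> Zw \<and> d \<in> Zw \<and> a*d - b*c = 1"
  by (auto simp: Gam_def mk_SL2)

lemma Gam_SL2: "A \<in> Gam \<Longrightarrow> A \<in> SL2" by (simp add: Gam_def)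

lemma Gam_cases:
  assumes "A \<in> Gam"
  obtains a b c d where "A = mk a b c d" "a \<in> Zw" "b \<in> Zw" "c \<in> Zw" "d \<in> Zw" "a*d - b*c = 1"
  using assms mk_Gam mk_cases by metis

lemma Gam_mult: "A \<in> Gam \<Longrightarrow> B \<in> Gam \<Longrightarrow> A ** B \<in> Gam"
  using SL2_mult[OF Gam_SL2 Gam_SL2, of A B]
  by (cases A rule: mk_cases; cases B rule: mk_cases) (auto simp: mk_mult mk_Gam mk_SL2)

lemma Gam_uminus: "A \<in> Gam \<Longrightarrow> - A \<in> Gam"
  by (auto elim!: Gam_cases simp: mk_uminus mk_Gam)

lemma Gam_one: "mat 1 \<in> Gam" by (simp add: mat_1_mk mk_Gam)

lemma Gam_inv: "A \<in> Gam \<Longrightarrow> matrix_inv A \<in> Gam"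
  by (auto elim!: Gam_cases simp: matrix_inv_mk mk_Gam algebra_simps)

lemma Gam_countable: "countable Gam"
proof -
  have "Gam \<subseteq> (\<lambda>(a, b, c, d). mk a b c d) ` (Zw \<times> Zw \<times> Zw \<times> Zw)"
  proof
    fix A assume "A \<in> Gam"
    then show "A \<in> (\<lambda>(a, b, c, d). mk a b c d) ` (Zw \<times> Zw \<times> Zw \<times> Zw)"
      by (intro image_eqI[where x = "(A$1$1, A$1$2, A$2$1, A$2$2)"]) (auto simp: Gam_def cmat_eq_iff)
  qed
  then show ?thesis by (rule countable_subset) (intro countable_image countable_SIGMA Zw_countable)
qed

section \<open>Congruences modulo a rational integer, and the principal congruence subgroups up to
  sign\<close>

definition qdvd :: "nat \<Rightarrow> complex \<Rightarrow> bool" where "qdvd q x \<longleftrightarrow> (\<exists>y\<in>Zw. x = of_nat q * y)"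

lemma qdvd_0 [simp]: "qdvd q 0" unfolding qdvd_def by (rule bexI[of _ 0]) auto
lemma qdvd_add: "qdvd q x \<Longrightarrow> qdvd q y \<Longrightarrow> qdvd q (x + y)"
  unfolding qdvd_def by (metis Zw_add distrib_left)
lemma qdvd_uminus: "qdvd q x \<Longrightarrow> qdvd q (- x)"
  unfolding qdvd_def by (metis Zw_uminus mult_minus_right)
lemma qdvd_diff: "qdvd q x \<Longrightarrow> qdvd q y \<Longrightarrow> qdvd q (x - y)"
  using qdvd_add qdvd_uminus by (metis diff_conv_add_uminus)
lemma qdvd_mult_left: "y \<in> Zw \<Longrightarrow> qdvd q x \<Longrightarrow> qdvd q (y * x)"
  unfolding qdvd_def by (metis Zw_mult mult.left_commute)
lemma qdvd_mult_right: "y \<in> Zw \<Longrightarrow> qdvd q x \<Longrightarrow> qdvd q (x * y)"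
  using qdvd_mult_left by (metis mult.commute)
lemma qdvd_self: "y \<in> Zw \<Longrightarrow> qdvd q (of_nat q * y)" by (auto simp: qdvd_def)

definition con :: "nat \<Rightarrow> cmat \<Rightarrow> cmat \<Rightarrow> bool" where
  "con q A B \<longleftrightarrow> qdvd q (A$1$1 - B$1$1) \<and> qdvd q (A$1$2 - B$1$2) \<and> qdvd q (A$2$1 - B$2$1) \<and> qdvd q (A$2$2 - B$2$2)"

lemma con_mk: "con q (mk a b c d) (mk a' b' c' d') \<longleftrightarrow>
    qdvd q (a - a') \<and> qdvd q (b - b') \<and> qdvd q (c - c') \<and> qdvd q (d - d')"
  by (simp add: con_def)

lemma con_refl [simp]: "con q A A" by (simp add: con_def)

lemma qdvd_sym: "qdvd q (x - y) \<Longrightarrow> qdvd q (y - x)"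
  using qdvd_uminus[of q "x - y"] by simp
lemma qdvd_trans: "qdvd q (x - y) \<Longrightarrow> qdvd q (y - z) \<Longrightarrow> qdvd q (x - z)"
  using qdvd_add[of q "x - y" "y - z"] by simp

lemma con_sym: "con q A B \<Longrightarrow> con q B A"
  unfolding con_def by (blast intro: qdvd_sym)

lemma con_trans: "con q A B \<Longrightarrow> con q B C \<Longrightarrow> con q A C"
  unfolding con_def by (blast intro: qdvd_trans)

lemma con_uminus: "con q A B \<Longrightarrow> con q (- A) (- B)"
  unfolding con_def by (simp add: qdvd_sym)

lemma con_mult_left: "C \<in> Gam \<Longrightarrow> con q A B \<Longrightarrow> con q (C ** A) (C ** B)"
proof (cases A rule: mk_cases, cases B rule: mk_cases, elim Gam_cases)
  fix a b c d a' b' c' d' x y z w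
  assume *: "A = mk a b c d" "B = mk a' b' c' d'" "C = mk x y z w" "x \<in> Zw" "y \<in> Zw" "z \<in> Zw" "w \<in> Zw" "con q A B"
  then have "qdvd q (x * (a - a') + y * (c - c'))" "qdvd q (x * (b - b') + y * (d - d'))"
    "qdvd q (z * (a - a') + w * (c - c'))" "qdvd q (z * (b - b') + w * (d - d'))"
    by (auto simp: con_mk intro!: qdvd_add qdvd_mult_left)
  then show ?thesis unfolding * by (simp add: mk_mult con_mk algebra_simps)
qed

lemma con_mult_right: "C \<in> Gam \<Longrightarrow> con q A B \<Longrightarrow> con q (A ** C) (B ** C)"
proof (cases A rule: mk_cases, cases B rule: mk_cases, elim Gam_cases)
  fix a b c d a' b' c' d' x y z w
  assume *: "A = mk a b c d" "B = mk a' b' c' d'" "C = mk x y z w" "x \<in> Zw" "y \<in> Zw" "z \<in> Zw" "w \<in> Zw" "con q A B"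
  then have "qdvd q ((a - a') * x + (b - b') * z)" "qdvd q ((a - a') * y + (b - b') * w)"
    "qdvd q ((c - c') * x + (d - d') * z)" "qdvd q ((c - c') * y + (d - d') * w)"
    by (auto simp: con_mk intro!: qdvd_add qdvd_mult_right)
  then show ?thesis unfolding * by (simp add: mk_mult con_mk algebra_simps)
qed

text \<open>Sign ambiguity is built in because groups are given by preimages in \<open>SL2\<close>:
  this is equality of images in the quotient of PSL_2 at level \<open>q\<close>.\<close>

definition pm :: "nat \<Rightarrow> cmat \<Rightarrow> cmat \<Rightarrow> bool" where
  "pm q A B \<longleftrightarrow> con q A B \<or> con q A (- B)"

lemma pm_refl [simp]: "pm q A A" by (simp add: pm_def)
lemma pm_uminus_right [simp]: "pm q A (- B) \<longleftrightarrow> pm q A B" by (auto simp: pm_def)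
lemma pm_sym: "pm q A B \<Longrightarrow> pm q B A"
  unfolding pm_def using con_sym con_uminus by (metis minus_minus)
lemma pm_uminus_left [simp]: "pm q (- A) B \<longleftrightarrow> pm q A B" using pm_sym pm_uminus_right by metis
lemma pm_trans: "pm q A B \<Longrightarrow> pm q B C \<Longrightarrow> pm q A C"
  unfolding pm_def using con_trans[of q A B C] con_trans[of q A B "- C"] con_trans[of q A "- B" C]
    con_trans[of q A "- B" "- C"] con_uminus[of q B C] con_uminus[of q B "- C"] by auto
lemma pm_mult_left: "C \<in> Gam \<Longrightarrow> pm q A B \<Longrightarrow> pm q (C ** A) (C ** B)"
  unfolding pm_def using con_mult_left[of C q A B] con_mult_left[of C q A "- B"] by (auto simp: mult_minus_right_cmat)
lemma pm_mult_right: "C \<in> Gam \<Longrightarrow> pm q A B \<Longrightarrow> pm q (A ** C) (B ** C)"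
  unfolding pm_def using con_mult_right[of C q A B] con_mult_right[of C q A "- B"] by (auto simp: mult_minus_left_cmat)
lemma pm_mult: "B \<in> Gam \<Longrightarrow> A' \<in> Gam \<Longrightarrow> pm q A A' \<Longrightarrow> pm q B B' \<Longrightarrow> pm q (A ** B) (A' ** B')"
  using pm_mult_right[of B q A A'] pm_mult_left[of A' q B B'] pm_trans by blast
lemma pm_inv: 
  assumes "A \<in> Gam" "B \<in> Gam" "pm q A B" shows "pm q (matrix_inv A) (matrix_inv B)"
proof -
  have "pm q (matrix_inv A ** A ** matrix_inv B) (matrix_inv A ** B ** matrix_inv B)"
    using assms by (intro pm_mult_left pm_mult_right Gam_inv)
  then show ?thesis using assms by (metis Gam_SL2 SL2_inv_cancel_right SL2_inv_left matrix_mul_lid pm_sym)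
qed

definition Gq :: "nat \<Rightarrow> cmat set" where "Gq q = {A \<in> Gam. pm q A (mat 1)}"

lemma Gq_Gam: "A \<in> Gq q \<Longrightarrow> A \<in> Gam" by (simp add: Gq_def)
lemma Gq_SL2: "A \<in> Gq q \<Longrightarrow> A \<in> SL2" by (simp add: Gq_def Gam_def)
lemma Gq_one: "mat 1 \<in> Gq q" by (simp add: Gq_def Gam_one)
lemma Gq_uminus: "A \<in> Gq q \<Longrightarrow> - A \<in> Gq q" by (simp add: Gq_def Gam_uminus)
lemma Gq_mult: "A \<in> Gq q \<Longrightarrow> B \<in> Gq q \<Longrightarrow> A ** B \<in> Gq q"
  using pm_mult[of B "mat 1" q A "mat 1"] by (simp add: Gq_def Gam_mult Gam_one)
lemma matrix_inv_one: "matrix_inv (mat 1 :: cmat) = mat 1"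
  by (simp add: mat_1_mk matrix_inv_mk)
lemma Gq_inv: "A \<in> Gq q \<Longrightarrow> matrix_inv A \<in> Gq q"
  using pm_inv[of A "mat 1" q] by (simp add: Gq_def Gam_inv Gam_one matrix_inv_one)

lemma Gq_quot: 
  assumes "A \<in> Gam" "B \<in> Gam" shows "A ** matrix_inv B \<in> Gq q \<longleftrightarrow> pm q A B"
proof
  assume "A ** matrix_inv B \<in> Gq q"
  then have "pm q (A ** matrix_inv B ** B) (mat 1 ** B)" using assms by (intro pm_mult_right) (auto simp: Gq_def)
  then show "pm q A B" using assms by (simp add: SL2_inv_cancel_right' Gam_SL2)
next
  assume "pm q A B"
  then have "pm q (A ** matrix_inv B) (B ** matrix_inv B)" using assms by (intro pm_mult_right Gam_inv)
  then show "A ** matrix_inv B \<in> Gq q" using assms by (simp add: Gq_def Gam_mult Gam_inv SL2_inv_right Gam_SL2)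
qed

lemma PSL_preimage_subgroup_Gq: "PSL_preimage_subgroup (Gq q)"
  unfolding PSL_preimage_subgroup_def
  using Gq_SL2 Gq_one Gq_uminus[OF Gq_one] Gq_mult Gq_inv by blast

lemma discrete_group_Gam: 
  assumes "G \<subseteq> Gam" shows "discrete_group G"
  unfolding discrete_group_def
proof (intro ballI exI[of _ 1] conjI impI)
  fix A B assume *: "A \<in> G" "B \<in> G" "dist A B < 1"
  have "A$i$j - B$i$j = 0" for i j
  proof (rule Zw_small)
    have "dist (A$i$j) (B$i$j) \<le> dist A B" by (meson dist_vec_nth_le order_trans)
    then show "cmod (A$i$j - B$i$j) < 1" using *(3) by (simp add: dist_norm)
    have "A$i$j \<in> Zw" "B$i$j \<in> Zw" using * assms exhaust_2[of i] exhaust_2[of j] by (auto simp: Gam_def subset_iff)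
    then show "A$i$j - B$i$j \<in> Zw" by auto
  qed
  then show "B = A" by (simp add: vec_eq_iff)
qed simp

text \<open>For a matrix 1 + q N the determinant condition reads tr N + q det N = 0, so the trace of
  N is itself divisible by \<open>q\<close>. This second factor \<open>q\<close> makes the systole
  long.\<close>

lemma Gq_trace:
  assumes "A \<in> Gq q" "q > 0"
  obtains y where "y \<in> Zw" "tr2 A = 2 + (of_nat q)^2 * y \<or> tr2 A = - (2 + (of_nat q)^2 * y)"
proof -
  have *: "\<exists>y\<in>Zw. tr2 B = 2 + (of_nat q)^2 * y" if B: "B \<in> Gam" "con q B (mat 1)" for B
  proof -
    obtain a b c d where m: "B = mk a b c d" "a*d - b*c = 1" using B(1) by (rule Gam_cases)
    obtain x y z w where e: "x \<in> Zw" "y \<in> Zw" "z \<in> Zw" "w \<in> Zw" 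
      "a - 1 = of_nat q * x" "b = of_nat q * y" "c = of_nat q * z" "d - 1 = of_nat q * w"
      using B(2) unfolding m mat_1_mk con_mk by (auto simp: qdvd_def)
    have e': "a = 1 + of_nat q * x" "d = 1 + of_nat q * w" using e by (simp_all add: algebra_simps)
    have "of_nat q * (x + w + of_nat q * (x * w - y * z)) = 0"
      using m(2) unfolding e' e by (simp add: algebra_simps)
    then have "x + w + of_nat q * (x * w - y * z) = 0" using assms(2) by simp
    then have xw: "x + w = of_nat q * (y * z - x * w)" by (simp add: algebra_simps add_eq_0_iff)
    have "tr2 B = 2 + of_nat q * (x + w)" unfolding m(1) tr2_mk e' by (simp add: algebra_simps)
    then have "tr2 B = 2 + (of_nat q)^2 * (y * z - x * w)"
      unfolding xw by (simp add: power2_eq_square mult.assoc)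
    moreover have "y * z - x * w \<in> Zw" using e by auto
    ultimately show ?thesis by blast
  qed
  have "A \<in> Gam" using assms Gq_Gam by blast
  moreover have "con q A (mat 1) \<or> con q (- A) (mat 1)"
    using assms con_uminus unfolding Gq_def pm_def by fastforce
  ultimately consider "\<exists>y\<in>Zw. tr2 A = 2 + (of_nat q)^2 * y" | "\<exists>y\<in>Zw. tr2 (- A) = 2 + (of_nat q)^2 * y"
    using * Gam_uminus by blast
  then show ?thesis
  proof cases
    case 2
    then obtain y where "y \<in> Zw" "- tr2 A = 2 + (of_nat q)^2 * y" by auto
    then show ?thesis using that by (metis minus_minus)
  qed (use that in blast)
qed

lemma Gq_trace_big:
  assumes "A \<in> Gq q" "q > 0" "tr2 A \<noteq> 2" "tr2 A \<noteq> -2"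
  shows "cmod (tr2 A) \<ge> real q ^ 2 - 2"
proof -
  obtain y where y: "y \<in> Zw" "tr2 A = 2 + (of_nat q)^2 * y \<or> tr2 A = - (2 + (of_nat q)^2 * y)"
    using Gq_trace assms(1,2) by blast
  then have "y \<noteq> 0" using assms by auto
  then have "cmod y \<ge> 1" using Zw_ge1 y by blast
  then have "real q ^ 2 * 1 \<le> real q ^ 2 * cmod y" by (intro mult_left_mono) auto
  then have "real q ^ 2 \<le> cmod ((of_nat q)^2 * y)" by (simp add: norm_mult norm_power)
  also have "\<dots> \<le> cmod (2 + (of_nat q)^2 * y) + 2"
    using norm_triangle_ineq4[of "2 + (of_nat q)^2 * y" 2] by simp
  finally show ?thesis using y(2) by (metis diff_le_eq norm_minus_cancel)
qed

text \<open>Coefficients in \<open>A\<^sup>n = U\<^sub>n A - U\<^bsub>n-1\<^esub>\<close>; they are nonzero when the trace has modulus at least 2.\<close>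

fun chebU :: "complex \<Rightarrow> nat \<Rightarrow> complex" where
  "chebU t 0 = 0"
| "chebU t (Suc 0) = 1"
| "chebU t (Suc (Suc n)) = t * chebU t (Suc n) - chebU t n"

lemma chebU_growth:
  assumes "cmod t \<ge> 2" shows "cmod (chebU t (Suc n)) \<ge> cmod (chebU t n) + 1"
proof (induction n)
  case (Suc n)
  have "2 * cmod (chebU t (Suc n)) \<le> cmod t * cmod (chebU t (Suc n))" using assms by (intro mult_right_mono) auto
  also have "\<dots> - cmod (chebU t n) \<le> cmod (chebU t (Suc (Suc n)))"
    using norm_triangle_ineq2[of "t * chebU t (Suc n)" "chebU t n"] by (simp add: norm_mult)
  finally show ?case using Suc by linarith
qed simp

lemma mpow_chebU:
  assumes "A = mk a b c d" "a*d - b*c = 1"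
  shows "mpow A (Suc n) = mk (chebU (a+d) (Suc n) * a - chebU (a+d) n) (chebU (a+d) (Suc n) * b)
     (chebU (a+d) (Suc n) * c) (chebU (a+d) (Suc n) * d - chebU (a+d) n)"
proof (induction n)
  case 0 show ?case by (simp add: assms(1) mat_1_mk mk_mult)
next
  case (Suc n)
  have *: "b * c = a * d - 1" using assms(2) by (simp add: algebra_simps)
  have "mpow A (Suc (Suc n)) = A ** mpow A (Suc n)" by simp
  also have "\<dots> = mk (chebU (a+d) (Suc (Suc n)) * a - chebU (a+d) (Suc n)) (chebU (a+d) (Suc (Suc n)) * b)
     (chebU (a+d) (Suc (Suc n)) * c) (chebU (a+d) (Suc (Suc n)) * d - chebU (a+d) (Suc n))"
    unfolding Suc unfolding assms(1) mk_mult using * by (auto simp: algebra_simps) (algebra)+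
  finally show ?case .
qed

text \<open>If A^n = 1 or -1, then U_n kills both off-diagonal entries and the difference of the
  diagonal ones. Since U_n is nonzero, A is scalar of determinant 1.\<close>

lemma torsion_free_of_trace:
  assumes "G \<subseteq> SL2" "\<And>A. A \<in> G \<Longrightarrow> cmod (tr2 A) \<ge> 2"
  shows "torsion_free G"
  unfolding torsion_free_def
proof (intro ballI allI impI)
  fix A n assume A: "A \<in> G" and n: "1 \<le> (n::nat)" and m: "mpow A n \<in> {mat 1, - mat 1}"
  obtain a b c d where A': "A = mk a b c d" "a*d - b*c = 1" using A assms(1) SL2_cases by blast
  obtain k where k: "n = Suc k" using n by (cases n) auto
  define u where "u = chebU (a+d) (Suc k)"
  define v where "v = chebU (a+d) k"
  have t: "cmod (a + d) \<ge> 2" using assms(2)[OF A] A' by simp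
  have u: "u \<noteq> 0" using chebU_growth[OF t, of k] norm_ge_zero[of "chebU (a+d) k"] unfolding u_def
    by (metis add.commute add_le_same_cancel2 not_one_le_zero norm_zero order_trans zero_le_one add_increasing)
  have "mpow A n = mk (u * a - v) (u * b) (u * c) (u * d - v)"
    unfolding k u_def v_def by (rule mpow_chebU[OF A'])
  then have h: "u * b = 0" "u * c = 0" "u * a - v = 1 \<and> u * d - v = 1 \<or> u * a - v = -1 \<and> u * d - v = -1"
    using m by (auto simp: mat_1_mk mk_uminus)
  have "u * (a - d) = (u * a - v) - (u * d - v)" by (simp add: algebra_simps)
  also have "\<dots> = 0" using h(3) by (elim conjE disjE) (simp_all only: diff_self)
  finally have bc: "b = 0" "c = 0" "a = d" using u h by auto
  then have "a * a = 1" using A'(2) by simp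
  then have "a = 1 \<or> a = -1" using square_eq_1_iff by blast
  then show "A \<in> {mat 1, - mat 1}" using bc by (auto simp: A' mat_1_mk mk_uminus)
qed

lemma kleinian_tf_Gq:
  assumes "q \<ge> 2" shows "kleinian_tf (Gq q)"
proof -
  have "cmod (tr2 A) \<ge> 2" if "A \<in> Gq q" for A
  proof (cases "tr2 A = 2 \<or> tr2 A = -2")
    case False
    have "real q ^ 2 \<ge> 2^2" using assms by (intro power_mono) auto
    then show ?thesis using Gq_trace_big[OF that] assms False by auto
  qed auto
  moreover have "Gq q \<subseteq> Gam" "Gq q \<subseteq> SL2" using Gq_Gam Gq_SL2 by auto
  ultimately show ?thesis unfolding kleinian_tf_def
    using PSL_preimage_subgroup_Gq discrete_group_Gam torsion_free_of_trace by blast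
qed

section \<open>Fundamental domains and covolume\<close>

declare split_paired_All [simp del] split_paired_Ex [simp del]

lemma hvol_Gam:
  assumes "A \<in> Gam" "E \<in> sets borel" "E \<subseteq> H3"
  shows "emeasure hvol (act A ` E) = emeasure hvol E"
proof -
  obtain a b c d where A: "A = mk a b c d" "a \<in> Zw" "d \<in> Zw" "a*d - b*c = 1" using assms(1) by (rule Gam_cases)
  show ?thesis
  proof (cases "c = 0")
    case True
    then have "a = d" using A Zw_unit[of a d] by auto
    then show ?thesis using hvol_translation[OF assms(2,3)] A True Gam_SL2[OF assms(1)] by blast
  next
    case False
    then show ?thesis using hvol_inversion[OF assms(2,3)] A Gam_SL2[OF assms(1)] by blast
  qed
qed

lemma sets_hvol [simp]: "sets hvol = sets borel" by (simp add: hvol_def)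

lemma act_vimage_sets:
  assumes "A \<in> SL2" "X \<in> sets borel" "X \<subseteq> H3" "Y \<in> sets borel" "Y \<subseteq> H3"
  shows "{x \<in> X. act A x \<in> Y} \<in> sets borel"
proof -
  have "{x \<in> X. act A x \<in> Y} = X \<inter> act (matrix_inv A) ` Y"
    unfolding act_image_eq[OF SL2_inv_mem[OF assms(1)] assms(5)] SL2_inv_inv[OF assms(1)] using assms(3) by auto
  then show ?thesis using act_image_sets[OF SL2_inv_mem[OF assms(1)] assms(4,5)] assms(2) by simp
qed

text \<open>Cut \<open>X\<close> into countably many pieces, each moved into \<open>Y\<close> by a group element, with disjoint images.\<close>

lemma hvol_transport_le:
  assumes G: "G \<subseteq> Gam" "G \<noteq> {}" and X: "X \<in> sets borel" "X \<subseteq> H3" and Y: "Y \<in> sets borel" "Y \<subseteq> H3"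
    and cov: "\<And>x. x \<in> X \<Longrightarrow> \<exists>A\<in>G. act A x \<in> Y"
    and disj: "\<And>A B x y. A \<in> G \<Longrightarrow> B \<in> G \<Longrightarrow> x \<in> X \<Longrightarrow> y \<in> X \<Longrightarrow> act A x = act B y \<Longrightarrow> x = y"
  shows "emeasure hvol X \<le> emeasure hvol Y"
proof -
  have cG: "countable G" using G Gam_countable countable_subset by blast
  define e where "e = from_nat_into G"
  have eG: "e n \<in> G" for n using G(2) by (simp add: e_def from_nat_into)
  define P where "P = (\<lambda>n. {x \<in> X. act (e n) x \<in> Y})"
  define Q where "Q = disjointed P"
  have Gm: "e n \<in> Gam" "e n \<in> SL2" for n using eG G Gam_SL2 by blast+
  have PQ: "Q n \<subseteq> P n" for n unfolding Q_def by (rule disjointed_subset)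
  have Pm: "P n \<in> sets borel" for n unfolding P_def by (rule act_vimage_sets[OF Gm(2) X Y])
  have Qm: "Q n \<in> sets borel" for n unfolding Q_def disjointed_def using Pm by auto
  have QX: "Q n \<subseteq> X" "Q n \<subseteq> H3" for n using PQ[of n] X by (auto simp: P_def)
  have dQ: "disjoint_family Q" unfolding Q_def by (rule disjoint_family_disjointed)
  have UX: "X = (\<Union>n. Q n)"
  proof -
    have "X = (\<Union>n. P n)"
    proof
      show "X \<subseteq> (\<Union>n. P n)"
      proof
        fix x assume x: "x \<in> X"
        then obtain A where A: "A \<in> G" "act A x \<in> Y" using cov by blast
        then obtain n where "A = e n" using from_nat_into_surj[OF cG A(1)] by (auto simp: e_def)
        then show "x \<in> (\<Union>n. P n)" using x A by (auto simp: P_def)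
      qed
    qed (auto simp: P_def)
    then show ?thesis by (simp add: Q_def UN_disjointed_eq)
  qed
  define R where "R = (\<lambda>n. act (e n) ` Q n)"
  have Rm: "R n \<in> sets borel" for n unfolding R_def by (rule act_image_sets[OF Gm(2) Qm QX(2)])
  have dR: "disjoint_family R"
    unfolding disjoint_family_on_def
  proof (intro ballI impI)
    fix m n :: nat assume "m \<noteq> n"
    show "R m \<inter> R n = {}"
    proof (rule ccontr)
      assume "R m \<inter> R n \<noteq> {}"
      then obtain z where z: "z \<in> R m" "z \<in> R n" by blast
      obtain x where x: "z = act (e m) x" "x \<in> Q m" using z(1) unfolding R_def by (rule imageE)
      obtain y where y: "z = act (e n) y" "y \<in> Q n" using z(2) unfolding R_def by (rule imageE)
      have xy: "x \<in> Q m" "y \<in> Q n" "act (e m) x = act (e n) y" using x y by simp_all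
      then have "x = y" using disj[OF eG eG, of x y m n] QX(1) by blast
      then show False using xy dQ \<open>m \<noteq> n\<close> by (auto simp: disjoint_family_on_def)
    qed
  qed
  have "act (e n) x \<in> Y" if "x \<in> Q n" for n x using PQ[of n] that by (auto simp: P_def)
  then have RY: "(\<Union>n. R n) \<subseteq> Y" unfolding R_def by blast
  have "emeasure hvol X = (\<Sum>n. emeasure hvol (Q n))"
    unfolding UX using dQ Qm by (intro suminf_emeasure[symmetric]) auto
  also have "\<dots> = (\<Sum>n. emeasure hvol (R n))"
    unfolding R_def by (intro suminf_cong hvol_Gam[symmetric] Gm Qm QX(2))
  also have "\<dots> = emeasure hvol (\<Union>n. R n)"
    using dR Rm by (intro suminf_emeasure) auto
  also have "\<dots> \<le> emeasure hvol Y" using RY Y by (intro emeasure_mono) auto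
  finally show ?thesis .
qed

lemma fund_dom_props:
  assumes "fund_dom G F"
  shows "F \<in> sets borel" "F \<subseteq> H3" "p \<in> H3 \<Longrightarrow> \<exists>A\<in>G. \<exists>y\<in>F. p = act A y"
    "A \<in> G \<Longrightarrow> B \<in> G \<Longrightarrow> x \<in> F \<Longrightarrow> y \<in> F \<Longrightarrow> act A x = act B y \<Longrightarrow> B = A \<or> B = - A"
proof -
  have F: "F \<in> sets borel" "F \<subseteq> H3" "(\<Union>A\<in>G. act A ` F) = H3"
    "\<And>A B. A \<in> G \<Longrightarrow> B \<in> G \<Longrightarrow> act A ` F \<inter> act B ` F \<noteq> {} \<Longrightarrow> B = A \<or> B = - A"
    using assms unfolding fund_dom_def by (simp, blast, blast, blast)
  show "F \<in> sets borel" "F \<subseteq> H3" by (fact F)+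
  show "\<exists>A\<in>G. \<exists>y\<in>F. p = act A y" if "p \<in> H3"
  proof -
    have "p \<in> (\<Union>A\<in>G. act A ` F)" using that F(3) by (simp only:)
    then show ?thesis by (simp only: UN_iff image_iff)
  qed
  show "B = A \<or> B = - A" if *: "A \<in> G" "B \<in> G" "x \<in> F" "y \<in> F" "act A x = act B y"
  proof (rule F(4)[OF *(1,2)])
    have "act A x \<in> act A ` F" using *(3) by (rule imageI)
    moreover have "act A x \<in> act B ` F" using *(5,4) by (rule image_eqI)
    ultimately show "act A ` F \<inter> act B ` F \<noteq> {}" by blast
  qed
qed

text \<open>Each point of \<open>F\<close> is moved into \<open>S\<close>; images of different
  points cannot coincide, because only A and -A carry points of \<open>F\<close> to a common place.
  This and \<open>fund_dom_ge\<close> sandwich the volume of whichever domain \<open>covol\<close>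
  refers to.\<close>

lemma fund_dom_le:
  assumes F: "fund_dom G F" and G: "G \<subseteq> Gam" "PSL_preimage_subgroup G" and S: "S \<in> sets borel" "S \<subseteq> H3"
    and cov: "H3 \<subseteq> (\<Union>A\<in>G. act A ` S)"
  shows "emeasure hvol F \<le> emeasure hvol S"
proof (rule hvol_transport_le[OF G(1) _ fund_dom_props(1,2)[OF F] S])
  show "G \<noteq> {}" using G(2) by (auto simp: PSL_preimage_subgroup_def)
  show "\<exists>A\<in>G. act A x \<in> S" if "x \<in> F" for x
  proof -
    have "x \<in> H3" using that fund_dom_props(2)[OF F] by blast
    then obtain A y where "A \<in> G" "y \<in> S" "x = act A y" using cov by blast
    then have "act (matrix_inv A) x \<in> S" using act_inv(1)[of A y] G S Gam_SL2 by (metis subsetD)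
    then show ?thesis using G(2) \<open>A \<in> G\<close> by (auto simp: PSL_preimage_subgroup_def)
  qed
  show "x = y" if *: "A \<in> G" "B \<in> G" "x \<in> F" "y \<in> F" "act A x = act B y" for A B x y
  proof -
    have xy: "x \<in> H3" "y \<in> H3" using * fund_dom_props(2)[OF F] by auto
    have "B = A \<or> B = - A" using fund_dom_props(4)[OF F *] .
    then have "act A x = act A y" using *(5) act_uminus by metis
    then show "x = y" using act_inv(1)[of A] * G Gam_SL2 xy by (metis subsetD)
  qed
qed

lemma fund_dom_ge:
  assumes F: "fund_dom G F" and G: "G \<subseteq> Gam" "PSL_preimage_subgroup G" and E: "E \<in> sets borel" "E \<subseteq> H3"
    and inj: "\<And>A x. A \<in> G \<Longrightarrow> x \<in> E \<Longrightarrow> act A x \<in> E \<Longrightarrow> A = mat 1 \<or> A = - mat 1"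
  shows "emeasure hvol E \<le> emeasure hvol F"
proof (rule hvol_transport_le[OF G(1) _ E fund_dom_props(1,2)[OF F]])
  show "G \<noteq> {}" using G(2) by (auto simp: PSL_preimage_subgroup_def)
  show "\<exists>A\<in>G. act A x \<in> F" if "x \<in> E" for x
  proof -
    have "x \<in> H3" using that E by blast
    then obtain A y where A: "A \<in> G" "y \<in> F" "x = act A y" using fund_dom_props(3)[OF F] by meson
    then have "act (matrix_inv A) x \<in> F"
      using act_inv(1)[of A y] G fund_dom_props(2)[OF F] Gam_SL2 by (metis subsetD)
    then show ?thesis using G(2) \<open>A \<in> G\<close> by (auto simp: PSL_preimage_subgroup_def)
  qed
  show "x = y" if *: "A \<in> G" "B \<in> G" "x \<in> E" "y \<in> E" "act A x = act B y" for A B x y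
  proof -
    have xy: "x \<in> H3" "y \<in> H3" using * E by auto
    have S: "A \<in> SL2" "B \<in> SL2" using * G Gam_SL2 by auto
    have Bi: "matrix_inv B ** A \<in> G" using * G(2) by (auto simp: PSL_preimage_subgroup_def)
    have eq: "act (matrix_inv B ** A) x = y"
      using S xy by (simp add: act_mult SL2_inv_mem *(5) act_inv)
    then have "matrix_inv B ** A = mat 1 \<or> matrix_inv B ** A = - mat 1" using inj[OF Bi *(3)] *(4) by simp
    then have "act (matrix_inv B ** A) x = x" using act_one[OF xy(1)] act_uminus[of "mat 1" x] by auto
    then show "x = y" using eq by simp
  qed
qed

text \<open>By Lindelof, countably many open sets \<open>U n\<close>, each meeting every orbit at
  most once, cover \<open>H3\<close>. From \<open>U n\<close> keep the points whose orbit avoids all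
  earlier \<open>U m\<close>: every orbit is then represented once, at its first index. The result
  is exact and Borel.\<close>

lemma fund_dom_exists:
  assumes G: "G \<subseteq> Gam" "PSL_preimage_subgroup G"
    and nice: "\<And>p. p \<in> H3 \<Longrightarrow> \<exists>U. open U \<and> p \<in> U \<and> U \<subseteq> H3 \<and>
        (\<forall>A\<in>G. \<forall>x\<in>U. act A x \<in> U \<longrightarrow> A = mat 1 \<or> A = - mat 1)"
  shows "\<exists>F. fund_dom G F"
proof -
  define \<U> where "\<U> = {U. open U \<and> U \<subseteq> H3 \<and> (\<forall>A\<in>G. \<forall>x\<in>U. act A x \<in> U \<longrightarrow> A = mat 1 \<or> A = - mat 1)}"
  have cov: "\<Union>\<U> = H3"
  proof (intro equalityI subsetI)
    fix x assume "x \<in> \<Union>\<U>"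
    then obtain U where "U \<in> \<U>" "x \<in> U" by blast
    then show "x \<in> H3" unfolding \<U>_def mem_Collect_eq by (iprover dest: subsetD)
  next
    fix x assume "x \<in> H3"
    then obtain U where "open U \<and> x \<in> U \<and> U \<subseteq> H3 \<and>
        (\<forall>A\<in>G. \<forall>x\<in>U. act A x \<in> U \<longrightarrow> A = mat 1 \<or> A = - mat 1)" using nice by meson
    then have "U \<in> \<U>" "x \<in> U" unfolding \<U>_def mem_Collect_eq by (iprover)+
    then show "x \<in> \<Union>\<U>" by (rule UnionI)
  qed
  obtain \<V> where V: "\<V> \<subseteq> \<U>" "countable \<V>" "\<Union>\<V> = \<Union>\<U>"
    using Lindelof[of \<U>] by (auto simp: \<U>_def)
  have "(0, 1) \<in> H3" by (simp add: H3_def)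
  then have "H3 \<noteq> {}" by blast
  then have ne: "\<V> \<noteq> {}" using V cov by auto
  define U where "U = from_nat_into \<V>"
  have UV: "U n \<in> \<V>" for n using ne by (simp add: U_def from_nat_into)
  have Uo: "open (U n)" "U n \<subseteq> H3" for n using UV[of n] V(1) by (auto simp: \<U>_def)
  have Ui: "A = mat 1 \<or> A = - mat 1" if "A \<in> G" "x \<in> U n" "act A x \<in> U n" for n A x
    using UV[of n] V(1) that by (auto simp: \<U>_def)
  have Uc: "\<exists>n. x \<in> U n" if "x \<in> H3" for x
  proof -
    have "x \<in> \<Union>\<V>" using that V(3) cov by simp
    then obtain W where "W \<in> \<V>" "x \<in> W" by (rule UnionE)
    then show ?thesis using from_nat_into_surj[OF V(2), of W] by (auto simp: U_def)
  qed
  have S: "A \<in> SL2" if "A \<in> G" for A using that G Gam_SL2 by blast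
  have inv: "matrix_inv A \<in> G" "A ** B \<in> G" if "A \<in> G" "B \<in> G" for A B
    using that G(2) by (auto simp: PSL_preimage_subgroup_def)
  define W where "W = (\<lambda>n. \<Union>A\<in>G. act A ` U n)"
  have Wo: "open (W n)" for n unfolding W_def using act_image_open[OF S Uo] by blast
  define F where "F = (\<Union>n. U n - (\<Union>m<n. W m))"
  have 1: "F \<in> sets borel" unfolding F_def using Uo Wo by (intro sets.countable_UN' sets.Diff borel_open open_UN) auto
  have 2: "F \<subseteq> H3" unfolding F_def using Uo by blast
  have 3: "(\<Union>A\<in>G. act A ` F) = H3"
  proof
    show "(\<Union>A\<in>G. act A ` F) \<subseteq> H3" using 2 act_H3 S by blast
    show "H3 \<subseteq> (\<Union>A\<in>G. act A ` F)"
    proof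
      fix p assume p: "p \<in> H3"
      have "\<exists>n. p \<in> W n"
      proof -
        obtain n where "p \<in> U n" using Uc p by blast
        moreover have "mat 1 \<in> G" using G(2) by (simp add: PSL_preimage_subgroup_def)
        ultimately have "p \<in> W n" unfolding W_def using act_one[OF p] by (intro UN_I[of "mat 1"] image_eqI) simp_all
        then show ?thesis ..
      qed
      then obtain n where n: "p \<in> W n" "\<And>m. m < n \<Longrightarrow> p \<notin> W m" 
        using exists_least_iff[of "\<lambda>n. p \<in> W n"] by blast
      then obtain A u where A: "A \<in> G" "u \<in> U n" "p = act A u" by (auto simp: W_def)
      have "u \<notin> W m" if "m < n" for m
      proof
        assume "u \<in> W m"
        then obtain B v where B: "B \<in> G" "v \<in> U m" "u = act B v" by (auto simp: W_def)
        then have "p = act (A ** B) v" using A S Uo by (metis act_mult subsetD)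
        then have "p \<in> W m" using inv(2)[OF A(1) B(1)] B(2) by (auto simp: W_def)
        then show False using n(2)[OF that] by simp
      qed
      then have "u \<in> F" using A(2) by (auto simp: F_def)
      then show "p \<in> (\<Union>A\<in>G. act A ` F)" using A by blast
    qed
  qed
  have 4: "B = A \<or> B = - A" if *: "A \<in> G" "B \<in> G" "act A ` F \<inter> act B ` F \<noteq> {}" for A B
  proof -
    obtain z where z: "z \<in> act A ` F" "z \<in> act B ` F" using *(3) by blast
    obtain x where x: "z = act A x" "x \<in> F" using z(1) by (rule imageE)
    obtain y where y: "z = act B y" "y \<in> F" using z(2) by (rule imageE)
    have xy: "x \<in> F" "y \<in> F" "act A x = act B y" using x y by simp_all
    obtain n where n: "x \<in> U n" "\<And>m. m < n \<Longrightarrow> x \<notin> W m" using xy(1) by (auto simp: F_def)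
    obtain k where k: "y \<in> U k" "\<And>m. m < k \<Longrightarrow> y \<notin> W m" using xy(2) by (auto simp: F_def)
    have xH: "x \<in> H3" "y \<in> H3" using xy 2 by auto
    define C where "C = matrix_inv A ** B"
    define D where "D = matrix_inv B ** A"
    have CD: "C \<in> G" "D \<in> G" unfolding C_def D_def using inv *(1,2) by blast+
    have xC: "x = act C y" unfolding C_def
      using S[OF *(1)] S[OF *(2)] xH by (simp add: act_mult SL2_inv_mem xy(3)[symmetric] act_inv)
    have yD: "y = act D x" unfolding D_def
      using S[OF *(1)] S[OF *(2)] xH by (simp add: act_mult SL2_inv_mem xy(3) act_inv)
    have "\<not> k < n" using n(2)[of k] xC CD k(1) by (auto simp: W_def)
    moreover have "\<not> n < k" using k(2)[of n] yD CD n(1) by (auto simp: W_def)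
    ultimately have "n = k" by simp
    then have "C = mat 1 \<or> C = - mat 1" using Ui[OF CD(1) k(1)] xC n(1) by simp
    moreover have "A ** C = B" unfolding C_def using S[OF *(1)] by (rule SL2_inv_cancel_left')
    ultimately show ?thesis by (auto simp: mult_minus_right_cmat)
  qed
  have "fund_dom G F" unfolding fund_dom_def using 1 2 3 4 by auto
  then show ?thesis ..
qed

text \<open>Existence of a fundamental domain is what gives the choice in \<open>covol\<close> a
  meaning. Finiteness of the upper bound ensures that \<open>enn2real\<close> in \<open>vol\<close>
  loses nothing.\<close>

lemma covol_bounds:
  assumes G: "G \<subseteq> Gam" "PSL_preimage_subgroup G" and ex: "\<exists>F. fund_dom G F"
    and S: "S \<in> sets borel" "S \<subseteq> H3" "H3 \<subseteq> (\<Union>A\<in>G. act A ` S)" "emeasure hvol S \<le> ennreal v" "v \<ge> 0"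
    and E: "E \<in> sets borel" "E \<subseteq> H3" "\<And>A x. A \<in> G \<Longrightarrow> x \<in> E \<Longrightarrow> act A x \<in> E \<Longrightarrow> A = mat 1 \<or> A = - mat 1"
      "ennreal u \<le> emeasure hvol E" "u \<ge> 0"
  shows "covol G < \<infinity>" "vol G \<le> v" "u \<le> vol G"
proof -
  have "\<exists>v F. fund_dom G F \<and> emeasure hvol F = v" using ex by blast
  then have "\<exists>F. fund_dom G F \<and> emeasure hvol F = covol G" unfolding covol_def by (rule someI_ex)
  then obtain F where F: "fund_dom G F" "covol G = emeasure hvol F" by metis
  have up: "covol G \<le> ennreal v" unfolding F(2) using fund_dom_le[OF F(1) G S(1-3)] S(4) by (rule order_trans)
  have lo: "ennreal u \<le> covol G" unfolding F(2) using E(4) fund_dom_ge[OF F(1) G E(1-3)] by (rule order_trans)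
  show fin: "covol G < \<infinity>" using up by (simp add: le_less_trans)
  show "vol G \<le> v" unfolding vol_def using up S(5) by (rule enn2real_leI[rotated])
  have "ennreal (vol G) = covol G" unfolding vol_def using fin by simp
  then show "u \<le> vol G" using lo by (metis E(5) ennreal_le_iff2 enn2real_nonneg ennreal_le_iff vol_def)
qed

section \<open>Translation lengths and the systole\<close>

text \<open>The hyperbolic cosine of the distance from \<open>p\<close> to its image.\<close>

definition disp :: "complex \<times> real \<Rightarrow> complex \<Rightarrow> complex \<Rightarrow> complex \<Rightarrow> complex \<Rightarrow> real" where
  "disp p a b c d = ((cmod (a - c * fst p))^2 + (cmod (c * fst p + d))^2 + (cmod c)^2 * (snd p)^2
     + (cmod (b + (a - d) * fst p - c * (fst p)^2))^2 / (snd p)^2) / 2"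

text \<open>Translating \<open>p\<close> above the origin subtracts \<open>fst p\<close> times the
  lower row from the upper row, giving (u, v). Then \<open>gram\<close> for the rows (u, v) and (c,
  d) turns the horizontal displacement into \<open>hnorm p u v\<close>.\<close>

lemma hdist_act_cosh:
  assumes det: "a*d - b*c = 1" and p: "p \<in> H3"
  shows "1 + ((cmod (fst p - fst (act (mk a b c d) p)))^2 + (snd p - snd (act (mk a b c d) p))^2)
      / (2 * snd p * snd (act (mk a b c d) p)) = disp p a b c d"
proof -
  obtain z s where zs: "p = (z, s)" by (cases p)
  have s: "s > 0" using p zs by (simp add: H3_def)
  define N where "N = herm p a b c d"
  define D where "D = hnorm p c d"
  have D: "D > 0" unfolding D_def using p det by (intro hnorm_pos) auto
  define u where "u = a - z * c"
  define v where "v = b - z * d"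
  define H where "H = herm p u v c d"
  have uv: "u * d - v * c = 1" using det by (simp add: u_def v_def algebra_simps)
  have H: "H = N - z * of_real D"
    unfolding H_def N_def D_def herm_self[symmetric] herm_def u_def v_def by (simp add: algebra_simps)
  have g: "hnorm p u v * D = (cmod H)^2 + s^2" unfolding D_def H_def gram[OF uv] zs by simp
  have "z - N / of_real D = - H / of_real D" using D by (simp add: H field_simps)
  then have zN: "(cmod (z - N / of_real D))^2 = (cmod H)^2 / D^2" using D by (simp add: norm_divide power_divide)
  have "1 + ((cmod (z - N / of_real D))^2 + (s - s / D)^2) / (2 * s * (s / D))
      = (((cmod H)^2 + s^2) / D + s^2 * D) / (2 * s^2)"
    unfolding zN using D s by (simp add: field_simps power2_eq_square)
  also have "((cmod H)^2 + s^2) / D = hnorm p u v" using g D by (simp add: field_simps)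
  also have "(hnorm p u v + s^2 * D) / (2 * s^2) = disp p a b c d"
  proof -
    have e: "u * z + v = b + (a - d) * z - c * z^2" by (simp add: u_def v_def algebra_simps power2_eq_square)
    have e': "u = a - c * z" by (simp add: u_def)
    show ?thesis unfolding disp_def hnorm_def D_def zs fst_conv snd_conv e unfolding e'
      using s by (simp add: field_simps)
  qed
  finally show ?thesis unfolding act_mk zs N_def D_def by simp
qed

lemma hdist_act:
  assumes "a*d - b*c = 1" "p \<in> H3"
  shows "hdist p (act (mk a b c d) p) = arcosh (disp p a b c d)"
  unfolding hdist_def hdist_act_cosh[OF assms] ..

text \<open>The hyperbolic cosine of the translation length of a loxodromic element of trace \<open>t\<close>.\<close>

definition Kt :: "complex \<Rightarrow> real" where "Kt t = ((cmod t)^2 + cmod (t^2 - 4)) / 4"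

lemma Kt_ge1: "Kt t \<ge> 1"
proof -
  have "4 \<le> cmod (t^2 - 4) + (cmod t)^2"
    using norm_triangle_ineq4[of "t^2" "t^2 - 4"] by (simp add: norm_power)
  then show ?thesis by (simp add: Kt_def)
qed

text \<open>Conjugating \<open>p\<close> above the origin gives entries \<open>a1\<close>,
  \<open>b1\<close>, \<open>c\<close>, \<open>d1\<close> with t^2 - 4 = (a1 - d1)^2 + 4 b1 c. The
  bound is the parallelogram law for \<open>a1\<close> and \<open>d1\<close> with the inequality of
  means for |c| s and |b1| / s.\<close>

lemma disp_ge_Kt:
  assumes det: "a*d - b*c = 1" and p: "p \<in> H3"
  shows "Kt (a + d) \<le> disp p a b c d"
proof -
  obtain z s where zs: "p = (z, s)" by (cases p)
  have s: "s > 0" using p zs by (simp add: H3_def)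
  define a1 where "a1 = a - c * z"
  define d1 where "d1 = c * z + d"
  define b1 where "b1 = b + (a - d) * z - c * z^2"
  have t: "a + d = a1 + d1" by (simp add: a1_def d1_def)
  have det1: "a1 * d1 - b1 * c = 1" using det by (simp add: a1_def d1_def b1_def algebra_simps power2_eq_square)
  have t4: "(a + d)^2 - 4 = (a1 - d1)^2 + 4 * (b1 * c)" 
  proof -
    have "4 = 4 * (a1 * d1 - b1 * c)" using det1 by simp
    then show ?thesis unfolding t by (simp add: algebra_simps power2_eq_square)
  qed
  have 1: "cmod ((a + d)^2 - 4) \<le> (cmod (a1 - d1))^2 + 4 * (cmod b1 * cmod c)"
    unfolding t4 using norm_triangle_ineq[of "(a1 - d1)^2" "4 * (b1 * c)"] by (simp add: norm_power norm_mult)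
  have 2: "2 * (cmod b1 * cmod c) \<le> (cmod c)^2 * s^2 + (cmod b1)^2 / s^2"
  proof -
    have "0 \<le> (cmod c * s - cmod b1 / s)^2" by simp
    also have "\<dots> = (cmod c)^2 * s^2 + (cmod b1)^2 / s^2 - 2 * (cmod b1 * cmod c)"
      using s by (simp add: power2_eq_square field_simps)
    finally show ?thesis by simp
  qed
  have 3: "(cmod (a1 + d1))^2 + (cmod (a1 - d1))^2 = 2 * (cmod a1)^2 + 2 * (cmod d1)^2"
    unfolding cmod_power2 by (simp add: power2_eq_square algebra_simps)
  have "4 * Kt (a + d) \<le> 4 * disp p a b c d"
    unfolding disp_def Kt_def zs fst_conv snd_conv a1_def[symmetric] d1_def[symmetric] b1_def[symmetric]
    using 1 2 3 unfolding t by (simp add: field_simps)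
  then show ?thesis by simp
qed

lemma disp_ge1: "a*d - b*c = 1 \<Longrightarrow> p \<in> H3 \<Longrightarrow> 1 \<le> disp p a b c d"
  using disp_ge_Kt Kt_ge1 order_trans by blast

lemma arcosh_mono_real: "1 \<le> x \<Longrightarrow> x \<le> y \<Longrightarrow> arcosh x \<le> arcosh (y::real)"
  using arcosh_real_strict_mono[of x y] by (cases "x = y") (simp_all add: less_imp_le)

lemma H3_nonempty: "(0, 1) \<in> H3" by (simp add: H3_def)

lemma tlen_ge:
  assumes "A \<in> SL2" shows "arcosh (Kt (tr2 A)) \<le> tlen A"
proof -
  obtain a b c d where A: "A = mk a b c d" "a*d - b*c = 1" using assms by (rule SL2_cases)
  show ?thesis unfolding tlen_def
  proof (rule cInf_greatest)
    show "{hdist p (act A p) |p. p \<in> H3} \<noteq> {}" using H3_nonempty by blast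
    fix x assume "x \<in> {hdist p (act A p) |p. p \<in> H3}"
    then obtain p where "p \<in> H3" "x = hdist p (act A p)" by blast
    then show "arcosh (Kt (tr2 A)) \<le> x"
      unfolding A(1) tr2_mk hdist_act[OF A(2) \<open>p \<in> H3\<close>]
      using arcosh_mono_real[OF Kt_ge1 disp_ge_Kt[OF A(2) \<open>p \<in> H3\<close>]] by (simp add: hdist_act[OF A(2)])
  qed
qed

lemma tlen_le:
  assumes A: "a*d - b*c = 1" and p: "p \<in> H3" shows "tlen (mk a b c d) \<le> arcosh (disp p a b c d)"
  unfolding tlen_def
proof (rule cInf_lower)
  show "arcosh (disp p a b c d) \<in> {hdist p (act (mk a b c d) p) |p. p \<in> H3}"
    using hdist_act[OF A p] p by (metis (mono_tags, lifting) mem_Collect_eq)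
  show "bdd_below {hdist p (act (mk a b c d) p) |p. p \<in> H3}"
  proof (rule bdd_belowI[of _ 0])
    fix x assume "x \<in> {hdist p (act (mk a b c d) p) |p. p \<in> H3}"
    then obtain p where p: "p \<in> H3" "x = hdist p (act (mk a b c d) p)" by blast
    then show "0 \<le> x" using hdist_act[OF A p(1)] disp_ge1[OF A p(1)] by simp
  qed
qed

lemma tlen_eq:
  assumes A: "A \<in> SL2" "A$2$1 \<noteq> 0" "(tr2 A)^2 \<noteq> 4" shows "tlen A = arcosh (Kt (tr2 A))"
proof (rule antisym)
  obtain a b c d where m: "A = mk a b c d" "a*d - b*c = 1" using assms(1) by (rule SL2_cases)
  have c: "c \<noteq> 0" using A(2) m by simp
  define t where "t = a + d"
  \<comment> \<open>The point (z, s) is the top of the axis: z is the midpoint of the two fixed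
    points and s half their distance. There a1 = d1 and |c| s = |b1| / s, so both inequalities
    behind \<open>disp_ge_Kt\<close> are equalities.\<close>
  define z where "z = (a - d) / (2 * c)"
  define s where "s = sqrt (cmod (t^2 - 4)) / (2 * cmod c)"
  have t: "cmod (t^2 - 4) > 0" using A(3) m by (simp add: t_def)
  then have s: "s > 0" using c by (simp add: s_def)
  then have p: "(z, s) \<in> H3" by (simp add: H3_def)
  have 1: "a - c * z = t / 2" "c * z + d = t / 2" using c by (simp_all add: z_def t_def field_simps)
  have 2: "b + (a - d) * z - c * z^2 = (t^2 - 4) / (4 * c)"
  proof -
    have "4 = 4 * (a*d - b*c)" using m(2) by simp
    then have "t^2 - 4 = (a - d)^2 + 4*b*c" by (simp add: t_def power2_eq_square algebra_simps)
    moreover have "b + (a - d) * z - c * z^2 = ((a - d)^2 + 4*b*c) / (4 * c)"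
      using c by (simp add: z_def field_simps power2_eq_square)
    ultimately show ?thesis by simp
  qed
  have s2: "s^2 = cmod (t^2 - 4) / (4 * (cmod c)^2)" by (simp add: s_def power_divide power_mult_distrib)
  have "disp (z, s) a b c d = Kt t"
    unfolding disp_def fst_conv snd_conv 1 2 s2 Kt_def using c t
    by (simp add: norm_divide norm_mult power_divide power_mult_distrib field_simps power2_eq_square)
  then show "tlen A \<le> arcosh (Kt (tr2 A))" using tlen_le[OF m(2) p] by (simp add: m t_def)
qed (rule tlen_ge[OF A(1)])

lemma tlen_le_0:
  assumes A: "a*d - b*c = 1" and ex: "\<And>e. e > 0 \<Longrightarrow> \<exists>p\<in>H3. disp p a b c d \<le> 1 + e"
  shows "tlen (mk a b c d) \<le> 0"
proof (rule field_le_epsilon)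
  fix e :: real assume e: "e > 0"
  then have "cosh e > cosh 0" by (subst cosh_real_strict_mono) auto
  then have "cosh e - 1 > 0" by simp
  then obtain p where p: "p \<in> H3" "disp p a b c d \<le> cosh e" using ex[of "cosh e - 1"] by auto
  have "tlen (mk a b c d) \<le> arcosh (disp p a b c d)" by (rule tlen_le[OF A p(1)])
  also have "\<dots> \<le> arcosh (cosh e)" by (rule arcosh_mono_real[OF disp_ge1[OF A p(1)] p(2)])
  also have "\<dots> = e" using e by (simp add: arcosh_cosh_real)
  finally show "tlen (mk a b c d) \<le> 0 + e" by simp
qed

text \<open>The displacement tends to 0 towards the fixed point, which is infinity if c = 0 and (a -
  d) / (2 c) otherwise. The heights \<open>s\<close> below are those at which \<open>disp\<close> is
  at most 1 + e.\<close>

lemma tlen_parabolic: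
  assumes A: "A \<in> Gam" and t: "tr2 A = 2 \<or> tr2 A = -2" shows "tlen A \<le> 0"
proof -
  obtain a b c d where m: "A = mk a b c d" "a \<in> Zw" "d \<in> Zw" "a*d - b*c = 1" using A by (rule Gam_cases)
  have t4: "(a + d)^2 = 4" using t m by auto
  show ?thesis unfolding m(1)
  proof (rule tlen_le_0[OF m(4)])
    fix e :: real assume e: "e > 0"
    show "\<exists>p\<in>H3. disp p a b c d \<le> 1 + e"
    proof (cases "c = 0")
      case True
      then have ad: "a = d" "cmod a = 1" using Zw_unit[of a d] m by auto
      define s where "s = (cmod b + 1) / sqrt (2*e)"
      have s: "s > 0" using e norm_ge_zero[of b] unfolding s_def by (intro divide_pos_pos) (linarith, simp)
      have "(cmod b)^2 \<le> (cmod b + 1)^2" by (intro power_mono) auto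
      moreover have "s^2 = (cmod b + 1)^2 / (2*e)" using e by (simp add: s_def power_divide)
      ultimately have "(cmod b)^2 \<le> 2 * e * s^2" using e by (simp add: field_simps)
      then have "(cmod b)^2 / s^2 \<le> 2 * e" using s by (simp add: field_simps)
      then have "disp (0, s) a b c d \<le> 1 + e" using True ad by (simp add: disp_def)
      then show ?thesis using s by (intro bexI[of _ "(0, s)"]) (auto simp: H3_def)
    next
      case False
      define z where "z = (a - d) / (2 * c)"
      define s where "s = sqrt (2*e) / cmod c"
      have s: "s > 0" using e False by (simp add: s_def)
      have 1: "a - c * z = (a + d) / 2" "c * z + d = (a + d) / 2" using False by (simp_all add: z_def field_simps)
      have 2: "b + (a - d) * z - c * z^2 = 0"
      proof -
        have "4 = 4 * (a*d - b*c)" using m by simp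
        then have "(a + d)^2 - 4 = (a - d)^2 + 4*b*c" by (simp add: power2_eq_square algebra_simps)
        moreover have "b + (a - d) * z - c * z^2 = ((a - d)^2 + 4*b*c) / (4 * c)"
          using False by (simp add: z_def field_simps power2_eq_square)
        ultimately show ?thesis using t4 by simp
      qed
      have "(cmod ((a + d)/2))^2 = 1" using t4 by (simp flip: norm_power add: power_divide)
      moreover have "(cmod c)^2 * s^2 = 2 * e" using False e by (simp add: s_def power_divide)
      ultimately have "disp (z, s) a b c d = 1 + e" unfolding disp_def fst_conv snd_conv 1 2 by simp
      then show ?thesis using s by (intro bexI[of _ "(z, s)"]) (auto simp: H3_def)
    qed
  qed
qed

lemma Gam_lower_left_0:
  assumes "A \<in> Gam" "A$2$1 = 0" shows "tr2 A = 2 \<or> tr2 A = -2"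
proof -
  obtain a b c d where m: "A = mk a b c d" "a \<in> Zw" "d \<in> Zw" "a*d - b*c = 1" using assms(1) by (rule Gam_cases)
  then show ?thesis using Zw_unit[of a d] assms(2) by auto
qed

definition ell :: "nat \<Rightarrow> real" where "ell q = arcosh (Kt (of_nat q ^ 2 - 2))"

lemma Kt_sys: 
  assumes "q \<ge> 2" shows "Kt (of_nat q ^ 2 - 2) = ((real q ^ 2 - 2)^2 - 2) / 2"
proof -
  have "real q ^ 2 \<ge> 2^2" using assms by (intro power_mono) auto
  then have g: "real q ^ 2 - 2 \<ge> 2" by simp
  define x where "x = real q ^ 2 - 2"
  have e: "complex_of_nat q ^ 2 - 2 = of_real x" by (simp add: x_def)
  have "x^2 \<ge> 2^2" using g unfolding x_def by (intro power_mono) auto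
  then have "\<bar>x^2 - 4\<bar> = x^2 - 4" by simp
  moreover have "complex_of_real x ^ 2 - 4 = of_real (x^2 - 4)" by simp
  ultimately have "cmod (complex_of_real x ^ 2 - 4) = x^2 - 4" by (simp only: norm_of_real)
  moreover have "(cmod (complex_of_real x))^2 = x^2" by simp
  ultimately have "Kt (of_real x) = (x^2 - 2) / 2" unfolding Kt_def by (simp only:) simp
  then show ?thesis by (simp only: e x_def)
qed

lemma ell_pos: assumes "q \<ge> 3" shows "ell q > 0"
proof -
  have "real q ^ 2 \<ge> 3^2" using assms by (intro power_mono) auto
  then have "(real q ^ 2 - 2)^2 \<ge> 7^2" by (intro power_mono) auto
  then have "Kt (of_nat q ^ 2 - 2) > 1" using assms by (simp add: Kt_sys)
  then show ?thesis by (simp add: ell_def)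
qed

text \<open>Since |t^2 - 4| >= |t|^2 - 4 with equality for real t of modulus at least 2, a real
  trace minimises \<open>Kt\<close> among traces of the same modulus.\<close>

lemma Kt_ge_sys:
  assumes "q \<ge> 2" "cmod t \<ge> real q ^ 2 - 2" shows "Kt t \<ge> Kt (of_nat q ^ 2 - 2)"
proof -
  have "real q ^ 2 \<ge> 2^2" using assms by (intro power_mono) auto
  then have "(real q ^ 2 - 2)^2 \<le> (cmod t)^2" using assms by (intro power_mono) auto
  moreover have "(cmod t)^2 \<le> cmod (t^2 - 4) + 4"
    using norm_triangle_ineq[of "t^2 - 4" 4] by (simp add: norm_power)
  ultimately show ?thesis using Kt_sys[OF assms(1)] by (simp add: Kt_def)
qed

lemma tlen_Gq_ge:
  assumes "q \<ge> 3" "A \<in> Gq q" "loxodromic A" shows "ell q \<le> tlen A" "tr2 A \<noteq> 2" "tr2 A \<noteq> -2"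
proof -
  show n: "tr2 A \<noteq> 2" "tr2 A \<noteq> -2"
    using tlen_parabolic[OF Gq_Gam[OF assms(2)]] assms(3) by (auto simp: loxodromic_def)
  have "cmod (tr2 A) \<ge> real q ^ 2 - 2" using Gq_trace_big[OF assms(2) _ n] assms(1) by auto
  then have "Kt (tr2 A) \<ge> Kt (of_nat q ^ 2 - 2)" using Kt_ge_sys assms(1) by auto
  then have "ell q \<le> arcosh (Kt (tr2 A))" unfolding ell_def by (rule arcosh_mono_real[OF Kt_ge1])
  then show "ell q \<le> tlen A" using tlen_ge[OF Gq_SL2[OF assms(2)]] by simp
qed

lemma tlen_Gq_eq:
  assumes "q \<ge> 3" "A \<in> Gq q" "tr2 A = of_nat q ^ 2 - 2" shows "tlen A = ell q" "loxodromic A"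
proof -
  have "real q ^ 2 \<ge> 3^2" using assms by (intro power_mono) auto
  then have r: "real q ^ 2 - 2 \<ge> 7" by simp
  have e: "tr2 A = of_real (real q ^ 2 - 2)" using assms(3) by simp
  have "Re (tr2 A) \<ge> 7" unfolding e using r by (simp only: Re_complex_of_real)
  then have n: "tr2 A \<noteq> 2" "tr2 A \<noteq> -2" by auto
  then have "(tr2 A)^2 \<noteq> 2^2" by (simp only: power2_eq_iff simp_thms)
  then have n4: "(tr2 A)^2 \<noteq> 4" by simp
  have "A$2$1 \<noteq> 0" using Gam_lower_left_0[OF Gq_Gam[OF assms(2)]] n by blast
  then show l: "tlen A = ell q" using tlen_eq[OF Gq_SL2[OF assms(2)] _ n4] by (simp add: ell_def assms(3))
  then show "loxodromic A" using ell_pos[OF assms(1)] by (simp add: loxodromic_def)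
qed

lemma sys_Gq:
  assumes "q \<ge> 3" shows "sys (Gq q) = ell q"
proof -
  \<comment> \<open>The square of the matrix with rows (0, -1) and (1, q), which has trace
    q.\<close>
  define A where "A = mk (-1) (- of_nat q) (of_nat q) (of_nat q ^ 2 - 1)"
  have "A \<in> Gam" unfolding A_def mk_Gam by (auto simp: power2_eq_square intro!: Zw_diff Zw_mult)
  moreover have "con q A (- mat 1)" unfolding A_def mat_1_mk mk_uminus con_mk
    using qdvd_self[of "of_nat q" q] qdvd_self[of 1 q] qdvd_uminus by (auto simp: power2_eq_square)
  ultimately have A: "A \<in> Gq q" by (simp add: Gq_def pm_def)
  have t: "tr2 A = of_nat q ^ 2 - 2" by (simp add: A_def)
  show ?thesis unfolding sys_def
  proof (rule cInf_eq_minimum)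
    show "ell q \<in> {tlen A |A. A \<in> Gq q \<and> loxodromic A}" using tlen_Gq_eq[OF assms A t] A by force
    show "\<And>x. x \<in> {tlen A |A. A \<in> Gq q \<and> loxodromic A} \<Longrightarrow> ell q \<le> x" using tlen_Gq_ge(1)[OF assms] by blast
  qed
qed

section \<open>Non-compactness of the quotients\<close>

lemma height_le:
  assumes A: "A \<in> Gam" and p: "p \<in> H3" shows "snd (act A p) \<le> max (snd p) (1 / snd p)"
proof -
  obtain a b c d where m: "A = mk a b c d" "a \<in> Zw" "c \<in> Zw" "d \<in> Zw" "a*d - b*c = 1" using A by (rule Gam_cases)
  have s: "snd p > 0" using p by (simp add: H3_def)
  show ?thesis
  proof (cases "c = 0")
    case True
    then have "d = 1 \<or> d = -1" using Zw_unit[of a d] m by auto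
    then show ?thesis using True by (auto simp: m(1) act_mk hnorm_def)
  next
    case False
    then have "1 \<le> (cmod c)^2" using Zw_ge1[OF m(3)] by simp
    then have "(snd p)^2 \<le> (cmod c)^2 * (snd p)^2" by (simp add: mult_le_cancel_right1)
    then have h: "(snd p)^2 \<le> hnorm p c d" by (simp add: hnorm_def add_increasing)
    have "hnorm p c d > 0" using hnorm_pos[OF p, of c d] False by simp
    then have "snd p / hnorm p c d \<le> snd p / (snd p)^2" using h s by (intro divide_left_mono) auto
    also have "\<dots> = 1 / snd p" using s by (simp add: power2_eq_square)
    finally show ?thesis by (simp add: m(1) act_mk)
  qed
qed

text \<open>Heights on a compact \<open>K\<close> lie between two positive bounds, so by
  \<open>height_le\<close> heights on its orbit are bounded, whereas \<open>H3\<close> has points of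
  every height.\<close>

lemma not_cocompact_Gam:
  assumes "G \<subseteq> Gam" shows "\<not> cocompact G"
proof
  assume "cocompact G"
  then obtain K where K: "compact K" "K \<subseteq> H3" "(\<Union>A\<in>G. act A ` K) = H3" by (auto simp: cocompact_def)
  have "K \<noteq> {}" using K(3) H3_nonempty by auto
  have c: "continuous_on K snd" by (intro continuous_intros)
  obtain x where x: "x \<in> K" "\<And>y. y \<in> K \<Longrightarrow> snd y \<le> snd x" using continuous_attains_sup[OF K(1) \<open>K \<noteq> {}\<close> c] by blast
  obtain w where w: "w \<in> K" "\<And>y. y \<in> K \<Longrightarrow> snd w \<le> snd y" using continuous_attains_inf[OF K(1) \<open>K \<noteq> {}\<close> c] by blast
  have w0: "snd w > 0" using w K by (auto simp: H3_def)
  define M where "M = max (snd x) (1 / snd w)"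
  have "M > 0" using w0 by (simp add: M_def less_max_iff_disj)
  then have "(0, M + 1) \<in> H3" by (simp add: H3_def)
  then have "(0, M + 1) \<in> (\<Union>A\<in>G. act A ` K)" using K(3) by simp
  then obtain A y where A: "A \<in> G" "y \<in> K" "(0, M + 1) = act A y" by (elim UN_E imageE)
  have y: "y \<in> H3" using A K by blast
  have "M + 1 \<le> max (snd y) (1 / snd y)" using height_le[of A y] A(1,3) y assms by (metis snd_conv subsetD)
  also have "\<dots> \<le> M" unfolding M_def using x(2)[OF A(2)] w(2)[OF A(2)] w0 by (intro max.mono) (auto intro: divide_left_mono frac_le)
  finally show False by simp
qed

section \<open>Reduction theory and volume bounds\<close>

text \<open>An element moving a point of a small ball within the ball has displacement close to 1,
  so its trace is 2 or -2 by the gap in the traces. The diagonal terms of \<open>disp\<close> then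
  account for 1 already, and what remains forces \<open>c\<close> and then \<open>b\<close> to be
  smaller than 1.\<close>

lemma Gq_nice_nbhd:
  assumes q: "q \<ge> 3" and p: "p \<in> H3"
  shows "\<exists>U. open U \<and> p \<in> U \<and> U \<subseteq> H3 \<and> (\<forall>A\<in>Gq q. \<forall>x\<in>U. act A x \<in> U \<longrightarrow> A = mat 1 \<or> A = - mat 1)"
proof -
  obtain z0 s0 where p0: "p = (z0, s0)" by (cases p)
  have s0: "s0 > 0" using p p0 by (simp add: H3_def)
  \<comment> \<open>For heights s between s0/2 and 2 s0, the bound s0^2/8 makes 2\<eta> < s^2, which
    excludes |c| >= 1, and 1/(8 s0^2) makes 2\<eta> s^2 < 1, which excludes |b| >= 1. Halving
    \<open>\<mu>\<close> makes the inequalities strict.\<close>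
  define \<mu> where "\<mu> = min 1 (min (s0^2 / 8) (1 / (8 * s0^2)))"
  have "\<mu> > 0" "\<mu> \<le> 1" "\<mu> \<le> s0^2 / 8" "\<mu> \<le> 1 / (8 * s0^2)"
    using s0 by (simp_all add: \<mu>_def min.coboundedI2)
  moreover define \<eta> where "\<eta> = \<mu> / 2"
  ultimately have eta: "\<eta> > 0" "\<eta> < 1" "\<eta> < s0^2 / 8" "\<eta> < 1 / (8 * s0^2)" by linarith+
  \<comment> \<open>Two points of the ball are less than 2r apart at heights above s0/2, so
    \<open>disp\<close> exceeds 1 by at most 4r^2 / (s0^2/2), which is at most
    \<open>\<eta>\<close>.\<close>
  define r where "r = min (s0 / 2) (s0 * sqrt (\<eta> / 8))"
  have r: "r > 0" "r \<le> s0 / 2" "r \<le> s0 * sqrt (\<eta> / 8)" using s0 eta by (auto simp: r_def)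
  have "r^2 \<le> (s0 * sqrt (\<eta> / 8))^2" using r by (intro power_mono) auto
  then have r2: "8 * r^2 \<le> s0^2 * \<eta>" using eta by (simp add: power_mult_distrib)
  define U where "U = ball p r"
  have bnd: "s0 / 2 < snd x \<and> snd x < 2 * s0" if "x \<in> U" for x
  proof -
    have "dist (snd p) (snd x) < r" using that unfolding U_def by (meson dist_snd_le le_less_trans mem_ball)
    then show ?thesis using r(2) p0 by (auto simp: dist_real_def)
  qed
  have UH: "U \<subseteq> H3"
  proof
    fix x assume "x \<in> U"
    then show "x \<in> H3" using bnd[of x] s0 by (simp add: H3_def)
  qed
  have "A = mat 1 \<or> A = - mat 1" if A: "A \<in> Gq q" and x: "x \<in> U" and Ax: "act A x \<in> U" for A x
  proof -
    obtain a b c d where m: "A = mk a b c d" "a \<in> Zw" "b \<in> Zw" "c \<in> Zw" "d \<in> Zw" "a*d - b*c = 1"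
      using Gq_Gam[OF A] by (rule Gam_cases)
    define y where "y = act A x"
    define s where "s = snd x"
    have s: "s0 / 2 < s" "s < 2 * s0" "s0 / 2 < snd y" using bnd[OF x] bnd[OF Ax] by (simp_all add: s_def y_def)
    have xH: "x \<in> H3" using x UH by blast
    have dxy: "dist x y < 2 * r"
      using x Ax dist_triangle_half_r[of p x "2*r" y] by (simp add: U_def y_def dist_commute)
    have "(cmod (fst x - fst y))^2 + (snd x - snd y)^2 = (dist x y)^2"
      by (simp add: dist_prod_def dist_norm)
    also have "\<dots> \<le> (2*r)^2" using dxy by (intro power_mono) auto
    finally have 1: "(cmod (fst x - fst y))^2 + (snd x - snd y)^2 \<le> 4 * r^2" by simp
    have "(s0/2) * (s0/2) \<le> snd x * snd y" using s s0 by (intro mult_mono) (auto simp: s_def)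
    then have 2: "s0^2 / 2 \<le> 2 * snd x * snd y" by (simp add: power2_eq_square)
    have "((cmod (fst x - fst y))^2 + (snd x - snd y)^2) / (2 * snd x * snd y) \<le> 4 * r^2 / (s0^2/2)"
      using 1 2 s0 r by (intro frac_le) auto
    also have "\<dots> \<le> \<eta>" using r2 s0 by (simp add: field_simps)
    finally have disp: "disp x a b c d \<le> 1 + \<eta>"
      using hdist_act_cosh[OF m(6) xH] by (simp add: y_def m(1))
    have t: "tr2 A = 2 \<or> tr2 A = -2"
    proof (rule ccontr)
      assume *: "\<not> (tr2 A = 2 \<or> tr2 A = -2)"
      then have "cmod (tr2 A) \<ge> real q ^ 2 - 2" using Gq_trace_big[OF A] q by auto
      moreover have "real q ^ 2 \<ge> 3 ^ 2" using q by (intro power_mono) auto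
      ultimately have "cmod (tr2 A) \<ge> 7" by simp
      then have "(cmod (tr2 A))^2 \<ge> 7^2" by (intro power_mono) auto
      then have "Kt (tr2 A) \<ge> 49/4" by (simp add: Kt_def add_increasing2)
      then show False using disp_ge_Kt[OF m(6) xH] disp eta by (simp add: m(1))
    qed
    then have "cmod (a + d) = 2" by (auto simp: m(1))
    have "(cmod (a + d))^2 \<le> 2 * ((cmod (a - c * fst x))^2 + (cmod (c * fst x + d))^2)"
    proof -
      have "cmod (a + d) \<le> cmod (a - c * fst x) + cmod (c * fst x + d)"
        using norm_triangle_ineq[of "a - c * fst x" "c * fst x + d"] by simp
      then have "(cmod (a + d))^2 \<le> (cmod (a - c * fst x) + cmod (c * fst x + d))^2" by (intro power_mono) auto
      also have "\<dots> \<le> 2 * ((cmod (a - c * fst x))^2 + (cmod (c * fst x + d))^2)"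
        using zero_le_power2[of "cmod (a - c * fst x) - cmod (c * fst x + d)"]
        by (simp add: power2_eq_square algebra_simps)
      finally show ?thesis .
    qed
    then have small: "(cmod c)^2 * s^2 + (cmod (b + (a - d) * fst x - c * (fst x)^2))^2 / s^2 \<le> 2 * \<eta>"
      using disp \<open>cmod (a + d) = 2\<close> by (simp add: disp_def s_def)
    have s2: "s0^2 / 4 < s^2" "s^2 < 4 * s0^2"
    proof -
      have "(s0/2)^2 < s^2" using s s0 by (intro power_strict_mono) auto
      then show "s0^2 / 4 < s^2" by (simp add: power_divide)
      have "s^2 < (2 * s0)^2" using s s0 by (intro power_strict_mono) auto
      then show "s^2 < 4 * s0^2" by simp
    qed
    have sp: "s > 0" using s s0 by simp
    have c0: "c = 0"
    proof (rule Zw_small[OF m(4)], rule ccontr)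
      assume "\<not> cmod c < 1"
      then have "1 \<le> (cmod c)^2" by simp
      then have "1 * s^2 \<le> (cmod c)^2 * s^2" by (intro mult_right_mono) auto
      also have "\<dots> \<le> 2 * \<eta>" using small by (smt (verit) divide_nonneg_nonneg zero_le_power2)
      finally show False using s2 eta by simp
    qed
    then have ad: "a = 1 \<and> d = 1 \<or> a = -1 \<and> d = -1" using Zw_unit[of a d] m by auto
    have b0: "b = 0"
    proof (rule Zw_small[OF m(3)], rule ccontr)
      assume "\<not> cmod b < 1"
      then have "1 \<le> (cmod b)^2" by simp
      moreover have "(cmod b)^2 / s^2 \<le> 2 * \<eta>" using small c0 ad by auto
      then have "(cmod b)^2 \<le> 2 * \<eta> * s^2" using sp by (simp add: field_simps)
      moreover have "2 * \<eta> * s^2 \<le> 2 * \<eta> * (4 * s0^2)" using s2 eta by (intro mult_left_mono) auto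
      moreover have "2 * \<eta> * (4 * s0^2) < 1" using eta s0 by (simp add: field_simps)
      ultimately show False by simp
    qed
    show ?thesis using ad b0 c0 by (auto simp: m(1) mat_1_mk mk_uminus)
  qed
  moreover have "open U" "p \<in> U" using r by (auto simp: U_def)
  ultimately show ?thesis using UH by blast
qed

text \<open>A generous Siegel set: it only has to meet every orbit of \<open>Gam\<close> and have
  finite volume, so the box exceeds the rectangle of \<open>Zw_cover\<close> and no hemisphere is
  cut out.\<close>

definition S0 :: "(complex \<times> real) set" where
  "S0 = cbox (Complex (-1) (-1)) (Complex 1 1) \<times> {1/3..}"

lemma S0_sets: "S0 \<in> sets borel" and S0_H3: "S0 \<subseteq> H3"
proof -
  show "S0 \<in> sets borel" unfolding S0_def by (intro borel_closed closed_Times closed_cbox closed_atLeast)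
  show "S0 \<subseteq> H3" by (auto simp: S0_def H3_def)
qed

text \<open>A nearly maximal height in the orbit suffices, so attainment of the supremum need not be shown.\<close>

lemma reduction_S0:
  assumes p: "p \<in> H3" shows "\<exists>A\<in>Gam. act A p \<in> S0"
proof -
  define Hs where "Hs = (\<lambda>A. snd (act A p)) ` Gam"
  have sp: "snd p > 0" using p by (simp add: H3_def)
  have bdd: "bdd_above Hs" unfolding Hs_def using height_le[OF _ p] by (intro bdd_aboveI2) blast
  define M where "M = Sup Hs"
  have up: "snd (act A p) \<le> M" if "A \<in> Gam" for A unfolding M_def using that bdd by (intro cSup_upper) (auto simp: Hs_def)
  have "snd p \<le> M" using up[OF Gam_one] act_one[OF p] by simp
  then have M: "M > 0" using sp by simp
  have "Hs \<noteq> {}" unfolding Hs_def using Gam_one by blast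
  \<comment> \<open>Comparing with the image under \<open>W\<close> will give 9/10 < |z|^2 + s^2.
    Since |z|^2 <= 3/4, this leaves s^2 > 3/20, which exceeds 1/9 and matches the height 1/3 in
    \<open>S0\<close>.\<close>
  moreover have "9/10 * M < M" using M by simp
  ultimately obtain h where "h \<in> Hs" "9/10 * M < h" unfolding M_def by (meson less_cSupD)
  then obtain A where A: "A \<in> Gam" "9/10 * M < snd (act A p)" by (auto simp: Hs_def)
  define x where "x = act A p"
  have AS: "A \<in> SL2" using A Gam_SL2 by blast
  have xH: "x \<in> H3" unfolding x_def using act_H3[OF AS p] .
  obtain u where u: "u \<in> Zw" "\<bar>Re (fst x - u)\<bar> \<le> 1/2" "\<bar>Im (fst x - u)\<bar> \<le> sqrt 2 / 2" "(cmod (fst x - u))^2 \<le> 3/4"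
    using Zw_cover by blast
  define T where "T = mk 1 (-u) 0 1"
  have T: "T \<in> Gam" using u by (simp add: T_def mk_Gam)
  have Tx: "act T x = (fst x - u, snd x)" by (simp add: T_def act_mk herm_def hnorm_def)
  define W where "W = mk 0 (-1) 1 0"
  have W: "W \<in> Gam" by (simp add: W_def mk_Gam)
  define y where "y = act T x"
  have y: "y = act (T ** A) p" unfolding y_def x_def using act_mult[OF Gam_SL2[OF T] AS p] by simp
  have yH: "y \<in> H3" unfolding y_def using act_H3[OF Gam_SL2[OF T] xH] .
  have ys: "snd y = snd x" "fst y = fst x - u" by (simp_all add: y_def Tx)
  have s: "snd y > 0" using yH by (simp add: H3_def)
  have "snd (act W y) \<le> M"
  proof -
    have "act W y = act (W ** (T ** A)) p"
      unfolding y using act_mult[OF Gam_SL2[OF W] Gam_SL2[OF Gam_mult[OF T A(1)]] p] by simp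
    then show ?thesis using up Gam_mult W T A(1) by metis
  qed
  moreover have "snd (act W y) = snd y / ((cmod (fst y))^2 + (snd y)^2)" by (simp add: W_def act_mk hnorm_def)
  moreover have pos: "(cmod (fst y))^2 + (snd y)^2 > 0" using s by (auto intro: add_nonneg_pos)
  ultimately have "snd y \<le> M * ((cmod (fst y))^2 + (snd y)^2)" by (simp add: field_simps)
  moreover have "9/10 * M < snd y" using A(2) by (simp add: ys x_def)
  ultimately have "M * (9/10) < M * ((cmod (fst y))^2 + (snd y)^2)" by simp
  then have "9/10 < (cmod (fst y))^2 + (snd y)^2" using M by (simp only: mult_less_cancel_left_pos)
  then have "(snd y)^2 > 3/20" using u(4) by (simp add: ys)
  have "snd y \<ge> 1/3"
  proof (rule ccontr)
    assume "\<not> snd y \<ge> 1/3"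
    then have "(snd y)^2 \<le> (1/3)^2" using s by (intro power_mono) auto
    then show False using \<open>(snd y)^2 > 3/20\<close> by (simp add: power_divide)
  qed
  moreover have "sqrt 2 / 2 \<le> (1::real)" using sqrt2_less_2 by simp
  then have "\<bar>Re (fst y)\<bar> \<le> 1" "\<bar>Im (fst y)\<bar> \<le> 1" using u(2,3) unfolding ys by linarith+
  then have "fst y \<in> cbox (Complex (-1) (-1)) (Complex 1 1)"
    by (auto simp: cbox_def Basis_complex_def abs_le_iff)
  ultimately have "y \<in> S0" by (simp add: S0_def mem_Times_iff)
  then show ?thesis using y Gam_mult[OF T A(1)] by metis
qed

lemma hvol_S0_finite: "emeasure hvol S0 < \<infinity>"
proof -
  define B where "B = cbox (Complex (-1) (-1)) (Complex 1 1)"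
  define g where "g = (\<lambda>s::real. ennreal (1 / s^3) * indicator {1/3..} s)"
  have [measurable]: "B \<in> sets borel" by (simp add: B_def)
  have I: "(\<integral>\<^sup>+s. g s \<partial>lborel) < \<infinity>"
  proof -
    have "(\<integral>\<^sup>+s. g s \<partial>lborel) = ennreal (0 - (- 1 / (2 * (1/3)^2)))"
      unfolding g_def
    proof (rule nn_integral_FTC_atLeast)
      show "((\<lambda>s::real. - 1 / (2 * s^2)) has_real_derivative 1 / x^3) (at x)" if "1/3 \<le> x" for x
        using that by (auto intro!: derivative_eq_intros simp: field_simps power2_eq_square power3_eq_cube)
      show "((\<lambda>s::real. - 1 / (2 * s^2)) \<longlongrightarrow> 0) at_top" by real_asymp
    qed auto
    then show ?thesis by simp
  qed
  have "emeasure hvol S0 = (\<integral>\<^sup>+p. ennreal (1 / (snd p)^3) * indicator S0 p \<partial>lborel)"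
    by (rule hvol_eq_nn_integral[OF S0_sets S0_H3])
  also have "\<dots> = (\<integral>\<^sup>+p. indicator B (fst p) * g (snd p) \<partial>(lborel \<Otimes>\<^sub>M lborel))"
    unfolding lborel_prod
    by (intro nn_integral_cong) (auto simp: S0_def B_def g_def indicator_def mem_Times_iff)
  also have "\<dots> = (\<integral>\<^sup>+z. (\<integral>\<^sup>+s. indicator B z * g s \<partial>lborel) \<partial>lborel)"
    by (subst lborel.nn_integral_fst[symmetric]) (simp_all add: g_def)
  also have "\<dots> = emeasure lborel B * (\<integral>\<^sup>+s. g s \<partial>lborel)"
    by (simp add: nn_integral_cmult nn_integral_multc g_def)
  also have "\<dots> < \<infinity>" using I emeasure_lborel_cbox_finite[of "Complex (-1) (-1)" "Complex 1 1"] unfolding B_def by (simp add: ennreal_mult_less_top)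
  finally show ?thesis .
qed

text \<open>A slab of the cusp, used only to make volumes tend to infinity. Its Lebesgue measure is
  4 r^2, and the density is at least 1/8 below height 2.\<close>

lemma hvol_cusp_box:
  assumes r: "r > 0"
  defines "E \<equiv> box (Complex (-r) (-r)) (Complex r r) \<times> {1<..<2::real}"
  shows "E \<in> sets borel" "E \<subseteq> H3" "ennreal (r^2 / 2) \<le> emeasure hvol E"
proof -
  show E: "E \<in> sets borel" unfolding E_def by (intro borel_open open_Times open_box open_greaterThanLessThan)
  show EH: "E \<subseteq> H3" by (auto simp: E_def H3_def)
  have "ennreal (r^2 / 2) = ennreal (1/8) * ennreal (4 * r^2)" using r by (simp flip: ennreal_mult)
  also have "ennreal (4 * r^2) = emeasure lborel (box (Complex (-r) (-r)) (Complex r r)) * emeasure lborel {1<..<2::real}"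
    using r by (simp add: emeasure_lborel_box_eq Basis_complex_def complex_eq_iff power2_eq_square)
  also have "\<dots> = emeasure (lborel \<Otimes>\<^sub>M lborel) E" unfolding E_def by (rule lborel.emeasure_pair_measure_Times[symmetric]) auto
  also have "ennreal (1/8) * emeasure (lborel \<Otimes>\<^sub>M lborel) E = (\<integral>\<^sup>+p. ennreal (1/8) * indicator E p \<partial>lborel)"
    unfolding lborel_prod using E by (simp add: nn_integral_cmult_indicator)
  also have "\<dots> \<le> (\<integral>\<^sup>+p. ennreal (1 / (snd p)^3) * indicator E p \<partial>lborel)"
  proof (intro nn_integral_mono)
    fix p :: "complex \<times> real"
    have "1/8 \<le> 1 / (snd p)^3" if "p \<in> E"
    proof -
      have "1 < snd p" "snd p < 2" using that by (auto simp: E_def mem_Times_iff)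
      then have "(snd p)^3 \<le> 2^3" by (intro power_mono) auto
      then show ?thesis using \<open>1 < snd p\<close> by (simp add: field_simps)
    qed
    then show "ennreal (1/8) * indicator E p \<le> ennreal (1 / (snd p)^3) * indicator E p"
      by (auto simp: indicator_def intro: ennreal_leI)
  qed
  also have "\<dots> = emeasure hvol E" by (rule hvol_eq_nn_integral[OF E EH, symmetric])
  finally show "ennreal (r^2 / 2) \<le> emeasure hvol E" .
qed

text \<open>Above height 1 an element with c nonzero lowers the point to height at most 1. An
  element with c = 0 translates by a multiple of \<open>q\<close>, while two points of the box are
  closer than \<open>q\<close>.\<close>

lemma cusp_box_inj:
  assumes q: "q \<ge> 3" and A: "A \<in> Gq q"
    and x: "x \<in> box (Complex (-(q/4)) (-(q/4))) (Complex (q/4) (q/4)) \<times> {1<..<2::real}"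
    and Ax: "act A x \<in> box (Complex (-(q/4)) (-(q/4))) (Complex (q/4) (q/4)) \<times> {1<..<2::real}"
  shows "A = mat 1 \<or> A = - mat 1"
proof -
  obtain a b c d where m: "A = mk a b c d" "a \<in> Zw" "b \<in> Zw" "c \<in> Zw" "d \<in> Zw" "a*d - b*c = 1"
    using Gq_Gam[OF A] by (rule Gam_cases)
  have s: "1 < snd x" "1 < snd (act A x)" using x Ax by (auto simp: mem_Times_iff)
  have xH: "x \<in> H3" using s by (simp add: H3_def)
  have c0: "c = 0"
  proof (rule ccontr)
    assume "c \<noteq> 0"
    then have "1 \<le> (cmod c)^2" using Zw_ge1[OF m(4)] by simp
    then have "1 * (snd x)^2 \<le> (cmod c)^2 * (snd x)^2" by (intro mult_right_mono) auto
    then have "(snd x)^2 \<le> hnorm x c d" by (simp add: hnorm_def add_increasing)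
    moreover have "snd x \<le> (snd x)^2" using s by (simp add: power2_eq_square)
    ultimately have "snd x \<le> hnorm x c d" by linarith
    then have "snd x / hnorm x c d \<le> 1" using s by (simp add: divide_le_eq)
    then show False using s by (simp add: m(1) act_mk)
  qed
  have ad: "a = 1 \<and> d = 1 \<or> a = -1 \<and> d = -1" using Zw_unit[of a d] m c0 by auto
  have "qdvd q b"
    using A unfolding Gq_def pm_def m(1) mat_1_mk mk_uminus by (auto simp: con_mk)
  then obtain y where y: "y \<in> Zw" "b = of_nat q * y" by (auto simp: qdvd_def)
  have f: "fst (act A x) = fst x + d * b"
    using ad c0 unfolding m(1) act_mk herm_def hnorm_def by (auto simp: algebra_simps)
  have "cmod b = cmod (fst (act A x) - fst x)" unfolding f using ad by auto
  also have "\<dots> \<le> cmod (fst (act A x)) + cmod (fst x)" by (rule norm_triangle_ineq4)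
  also have "\<dots> < q/2 + q/2"
  proof -
    have "cmod z < q/2" if z: "z \<in> box (Complex (-(q/4)) (-(q/4))) (Complex (q/4) (q/4))" for z
    proof -
      have "\<bar>Re z\<bar> < q/4" "\<bar>Im z\<bar> < q/4" using z by (auto simp: box_def Basis_complex_def)
      then show ?thesis using cmod_le[of z] by linarith
    qed
    then show ?thesis using x Ax by (intro add_strict_mono) (auto simp: mem_Times_iff)
  qed
  finally have "real q * cmod y < real q * 1" by (simp add: y norm_mult)
  then have "cmod y < 1" using q by (simp only: mult_less_cancel_left)
  then have "b = 0" using Zw_small[OF y(1)] y by simp
  then show ?thesis using ad c0 by (auto simp: m(1) mat_1_mk mk_uminus)
qed

section \<open>Coset representatives and the index of the congruence subgroup\<close>

lemma card_fibers_le: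
  assumes "finite Y" "f ` X \<subseteq> Y" "\<And>y. y \<in> Y \<Longrightarrow> finite {x \<in> X. f x = y} \<and> card {x \<in> X. f x = y} \<le> k"
  shows "finite X" "card X \<le> card Y * k"
proof -
  have X: "X = (\<Union>y\<in>Y. {x \<in> X. f x = y})" using assms(2) by auto
  show "finite X" by (subst X) (use assms in blast)
  have "card X \<le> (\<Sum>y\<in>Y. card {x \<in> X. f x = y})" by (subst X) (rule card_UN_le[OF assms(1)])
  also have "\<dots> \<le> card Y * k" using assms(3) sum_bounded_above[of Y "\<lambda>y. card {x \<in> X. f x = y}" k] by simp
  finally show "card X \<le> card Y * k" .
qed

definition res :: "nat \<Rightarrow> complex \<Rightarrow> int \<times> int" where
  "res q z = (\<lfloor>Re z\<rfloor> mod int q, \<lfloor>Im z / sqrt 2\<rfloor> mod int q)"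

lemma res_zc: "res q (zc x y) = (x mod int q, y mod int q)" by (simp add: res_def)

lemma res_eq:
  assumes "z \<in> Zw" "w \<in> Zw" "res q z = res q w" shows "qdvd q (z - w)"
proof -
  obtain x y x' y' where zw: "z = zc x y" "w = zc x' y'" using assms(1,2) Zw_cases by metis
  have "int q dvd x - x'" "int q dvd y - y'" using assms(3) by (auto simp: zw res_zc mod_eq_dvd_iff)
  then obtain k l where kl: "x - x' = int q * k" "y - y' = int q * l" by (auto simp: dvd_def)
  have "z - w = zc (int q * k) (int q * l)" by (simp add: zw zc_diff kl)
  also have "\<dots> = of_nat q * zc k l" by (simp add: zc_def algebra_simps)
  finally show ?thesis using qdvd_self[OF zc_in] by metis
qed

lemma res_range:
  assumes "q > 0" shows "res q z \<in> {0..<int q} \<times> {0..<int q}"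
  using assms by (simp add: res_def)

text \<open>The predicate under \<open>SOME\<close> depends only on the class of \<open>A\<close>,
  so congruent matrices get the same representative. Thus \<open>Reps q\<close> is a transversal of
  the cosets of \<open>Gq q\<close> in \<open>Gam\<close>, and \<open>card (Reps q)\<close> is the
  index.\<close>

definition rep :: "nat \<Rightarrow> cmat \<Rightarrow> cmat" where "rep q A = (SOME B. B \<in> Gam \<and> pm q A B)"

definition Reps :: "nat \<Rightarrow> cmat set" where "Reps q = rep q ` Gam"

lemma rep_props:
  assumes "A \<in> Gam" shows "rep q A \<in> Gam" "pm q A (rep q A)"
  using someI[of "\<lambda>B. B \<in> Gam \<and> pm q A B" A] assms by (auto simp: rep_def)

lemma rep_eq: "pm q A B \<Longrightarrow> rep q A = rep q B"
proof -
  assume "pm q A B"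
  then have "(\<lambda>C. C \<in> Gam \<and> pm q A C) = (\<lambda>C. C \<in> Gam \<and> pm q B C)"
    using pm_trans pm_sym by (intro ext) blast
  then show ?thesis by (simp add: rep_def)
qed

lemma Reps_Gam: "A \<in> Reps q \<Longrightarrow> A \<in> Gam" using rep_props by (auto simp: Reps_def)

lemma Reps_rep: "A \<in> Reps q \<Longrightarrow> rep q A = A"
  unfolding Reps_def using rep_eq[OF pm_sym[OF rep_props(2)]] by auto

lemma Reps_decomp:
  assumes "A \<in> Gam" obtains g D where "g \<in> Gq q" "D \<in> Reps q" "A = g ** D"
proof
  show "A ** matrix_inv (rep q A) \<in> Gq q" using Gq_quot[of A "rep q A"] rep_props[OF assms] assms by blast
  show "rep q A \<in> Reps q" using assms by (simp add: Reps_def)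
  show "A = A ** matrix_inv (rep q A) ** rep q A"
    using rep_props[OF assms] by (simp add: SL2_inv_cancel_right' Gam_SL2)
qed

lemma Reps_nonempty: "Reps q \<noteq> {}" using Gam_one by (auto simp: Reps_def)

text \<open>Equal first rows modulo \<open>q\<close> leave only a lower unipotent factor, hence a
  single residue as freedom.\<close>

lemma con_first_row:
  assumes G: "D \<in> Gam" "E \<in> Gam" and r: "qdvd q (D$1$1 - E$1$1)" "qdvd q (D$1$2 - E$1$2)"
  shows "con q (D ** matrix_inv E) (mk 1 0 ((D ** matrix_inv E)$2$1) 1)"
proof -
  obtain a b c d where D: "D = mk a b c d" "a \<in> Zw" "b \<in> Zw" "c \<in> Zw" "d \<in> Zw" "a*d - b*c = 1" using G(1) by (rule Gam_cases)
  obtain a' b' c' d' where E: "E = mk a' b' c' d'" "a' \<in> Zw" "b' \<in> Zw" "c' \<in> Zw" "d' \<in> Zw" "a'*d' - b'*c' = 1"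
    using G(2) by (rule Gam_cases)
  define x where "x = a * d' + b * (- c')"
  define y where "y = a * (- b') + b * a'"
  define z where "z = c * d' + d * (- c')"
  define w where "w = c * (- b') + d * a'"
  have M: "D ** matrix_inv E = mk x y z w" unfolding D(1) E(1) matrix_inv_mk[OF E(6)] mk_mult x_def y_def z_def w_def ..
  have Zs: "x \<in> Zw" "y \<in> Zw" "z \<in> Zw" "w \<in> Zw" unfolding x_def y_def z_def w_def using D E by auto
  have "mk x y z w \<in> Gam" unfolding M[symmetric] using G by (intro Gam_mult Gam_inv)
  then have det: "x * w - y * z = 1" by (simp add: mk_Gam)
  have 1: "qdvd q (x - 1)"
  proof -
    have "x - 1 = (a - a') * d' - (b - b') * c'" using E(6) by (simp add: x_def algebra_simps)
    then show ?thesis using r D(1) E by (simp add: qdvd_diff qdvd_mult_right)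
  qed
  have 2: "qdvd q y"
  proof -
    have "y = (b - b') * a' - (a - a') * b'" by (simp add: y_def algebra_simps)
    then show ?thesis using r D(1) E by (simp add: qdvd_diff qdvd_mult_right)
  qed
  have 3: "qdvd q (w - 1)"
  proof -
    have "w - 1 = y * z - (x - 1) * w" using det by (simp add: algebra_simps)
    then show ?thesis using 1 2 Zs by (simp add: qdvd_diff qdvd_mult_right)
  qed
  show ?thesis unfolding M by (simp add: con_mk 1 2 3)
qed

text \<open>There are q^4 possible first rows and, by \<open>con_first_row\<close>, at most q^2
  classes for each. Counting the four entries separately would give q^8 and spoil the final
  exponent.\<close>

lemma Reps_finite:
  assumes q: "q > 0" shows "finite (Reps q)" "card (Reps q) \<le> q^6"
proof -
  define I where "I = {0..<int q} \<times> {0..<int q}"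
  have cI: "card I = q^2" by (simp add: I_def power2_eq_square)
  define f where "f = (\<lambda>D::cmat. (res q (D$1$1), res q (D$1$2)))"
  have fY: "finite (I \<times> I)" by (simp add: I_def)
  have rI: "res q z \<in> I" for z unfolding I_def by (rule res_range[OF q])
  have im: "f ` Reps q \<subseteq> I \<times> I" unfolding f_def by (intro image_subsetI SigmaI rI)
  have fib: "finite {x \<in> Reps q. f x = y} \<and> card {x \<in> Reps q. f x = y} \<le> q^2" for y
  proof (cases "{x \<in> Reps q. f x = y} = {}")
    case False
    then obtain E where E: "E \<in> Reps q" "f E = y" by auto
    let ?X = "{x \<in> Reps q. f x = y}"
    define h where "h = (\<lambda>D::cmat. res q ((D ** matrix_inv E)$2$1))"
    have con: "con q (D ** matrix_inv E) (mk 1 0 ((D ** matrix_inv E)$2$1) 1)" if D: "D \<in> ?X" for D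
    proof (rule con_first_row)
      show DG: "D \<in> Gam" "E \<in> Gam" using D E Reps_Gam by auto
      have "f D = f E" using D E by simp
      then show "qdvd q (D$1$1 - E$1$1)" "qdvd q (D$1$2 - E$1$2)"
        using DG by (auto simp: f_def Gam_def intro!: res_eq)
    qed
    have inj: "inj_on h ?X"
    proof (rule inj_onI)
      fix D D' assume D: "D \<in> ?X" "D' \<in> ?X" "h D = h D'"
      have G: "D \<in> Gam" "D' \<in> Gam" "E \<in> Gam" using D E Reps_Gam by auto
      have G': "D ** matrix_inv E \<in> Gam" "D' ** matrix_inv E \<in> Gam" using G by (auto intro: Gam_mult Gam_inv)
      have "qdvd q ((D ** matrix_inv E)$2$1 - (D' ** matrix_inv E)$2$1)"
        using D(3) G' by (intro res_eq) (auto simp: h_def Gam_def)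
      then have "con q (mk 1 0 ((D ** matrix_inv E)$2$1) 1) (mk 1 0 ((D' ** matrix_inv E)$2$1) 1)"
        by (simp add: con_mk)
      then have "con q (D ** matrix_inv E) (D' ** matrix_inv E)"
        using con[OF D(1)] con[OF D(2)] con_trans con_sym by blast
      then have "con q (D ** matrix_inv E ** E) (D' ** matrix_inv E ** E)" by (rule con_mult_right[OF G(3)])
      then have "pm q D D'" using G by (simp add: pm_def SL2_inv_cancel_right' Gam_SL2)
      then have "rep q D = rep q D'" by (rule rep_eq)
      then show "D = D'" using D Reps_rep by auto
    qed
    have "h ` ?X \<subseteq> I" unfolding h_def by (intro image_subsetI rI)
    moreover have "finite I" by (simp add: I_def)
    ultimately show ?thesis using card_inj_on_le[OF inj, of I] inj_on_finite[OF inj, of I] cI by simp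
  qed (simp only: finite.emptyI card.empty, simp)
  show "finite (Reps q)" using card_fibers_le(1)[OF fY im] fib by blast
  have "card (Reps q) \<le> card (I \<times> I) * q^2" using card_fibers_le(2)[OF fY im] fib by blast
  also have "\<dots> = q^6" by (simp add: card_cartesian_product cI flip: power_add)
  finally show "card (Reps q) \<le> q^6" .
qed

text \<open>The summand 1 makes the constant visibly positive.\<close>

definition V0 :: real where "V0 = enn2real (emeasure hvol S0) + 1"

text \<open>The translates of \<open>S0\<close> by representatives cover \<open>H3\<close> under
  \<open>Gq q\<close>, which bounds the volume by the index times \<open>V0\<close>; the box of
  half-width q/4 in the cusp embeds and bounds it below.\<close>

lemma vol_Gq:
  assumes q: "q \<ge> 3"
  shows "covol (Gq q) < \<infinity>" "vol (Gq q) \<le> V0 * card (Reps q)" "(real q)^2 / 32 \<le> vol (Gq q)"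
proof -
  have GG: "Gq q \<subseteq> Gam" using Gq_Gam by blast
  have ex: "\<exists>F. fund_dom (Gq q) F"
    by (rule fund_dom_exists[OF GG PSL_preimage_subgroup_Gq Gq_nice_nbhd[OF q]])
  have fR: "finite (Reps q)" using Reps_finite q by simp
  have V0: "V0 > 0" "emeasure hvol S0 \<le> ennreal V0"
  proof -
    show "V0 > 0" unfolding V0_def by (simp add: add_nonneg_pos)
    have "emeasure hvol S0 = ennreal (enn2real (emeasure hvol S0))" using hvol_S0_finite by simp
    also have "\<dots> \<le> ennreal V0" unfolding V0_def by (intro ennreal_leI) simp
    finally show "emeasure hvol S0 \<le> ennreal V0" .
  qed
  define S where "S = (\<Union>D\<in>Reps q. act D ` S0)"
  have Dm: "act D ` S0 \<in> sets borel" if "D \<in> Reps q" for D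
    using act_image_sets[OF Gam_SL2[OF Reps_Gam[OF that]] S0_sets S0_H3] .
  have S: "S \<in> sets borel" unfolding S_def using fR Dm by (intro sets.finite_UN) auto
  have SH: "S \<subseteq> H3" unfolding S_def using act_H3 Gam_SL2 Reps_Gam S0_H3 by blast
  have cov: "H3 \<subseteq> (\<Union>A\<in>Gq q. act A ` S)"
  proof
    fix p assume p: "p \<in> H3"
    then obtain A where A: "A \<in> Gam" "act A p \<in> S0" using reduction_S0 by blast
    define x where "x = act A p"
    have px: "p = act (matrix_inv A) x" unfolding x_def using act_inv(1)[OF Gam_SL2[OF A(1)] p] by simp
    have xH: "x \<in> H3" using A S0_H3 by (auto simp: x_def)
    obtain g D where g: "g \<in> Gq q" "D \<in> Reps q" "matrix_inv A = g ** D"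
      using Reps_decomp[OF Gam_inv[OF A(1)]] by blast
    have "p = act g (act D x)" unfolding px g(3) using act_mult[OF Gq_SL2[OF g(1)] Gam_SL2[OF Reps_Gam[OF g(2)]] xH] .
    moreover have "act D x \<in> S" unfolding S_def using g(2) A(2) by (auto simp: x_def)
    ultimately show "p \<in> (\<Union>A\<in>Gq q. act A ` S)" using g(1) by blast
  qed
  have "emeasure hvol S \<le> (\<Sum>D\<in>Reps q. emeasure hvol (act D ` S0))"
    unfolding S_def using fR Dm by (intro emeasure_subadditive_finite) auto
  also have "\<dots> = (\<Sum>D\<in>Reps q. emeasure hvol S0)"
    by (intro sum.cong refl hvol_Gam Reps_Gam S0_sets S0_H3)
  also have "\<dots> \<le> (\<Sum>D\<in>Reps q. ennreal V0)" using V0 by (intro sum_mono) simp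
  also have "\<dots> = ennreal (V0 * card (Reps q))" using V0 by (subst sum_ennreal) (auto simp: mult.commute)
  finally have Sv: "emeasure hvol S \<le> ennreal (V0 * card (Reps q))" .
  have r: "real q / 4 > 0" using q by simp
  note E = hvol_cusp_box[OF r]
  note b = covol_bounds[OF GG PSL_preimage_subgroup_Gq ex S SH cov Sv _ E(1,2) _ E(3)]
  have nn: "0 \<le> V0 * real (card (Reps q))" "0 \<le> (real q / 4)^2 / 2" using V0 by simp_all
  show "covol (Gq q) < \<infinity>" by (rule b(1)[OF nn(1) cusp_box_inj[OF q] nn(2)])
  show "vol (Gq q) \<le> V0 * card (Reps q)" by (rule b(2)[OF nn(1) cusp_box_inj[OF q] nn(2)])
  have "(real q / 4)^2 / 2 \<le> vol (Gq q)" by (rule b(3)[OF nn(1) cusp_box_inj[OF q] nn(2)])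
  then show "(real q)^2 / 32 \<le> vol (Gq q)" by (simp add: power_divide)
qed

section \<open>Rigidity of matrices with small lower left entry\<close>

text \<open>Each step divides the ratio x/y by e^2. At the first \<open>k\<close> where the ratio is
  at most e, it was above e one step earlier, so it is still above 1/e.\<close>

lemma geometric_balance:
  fixes x y e :: real
  assumes "x > 0" "y > 0" "e > 1" "y \<le> x"
  shows "\<exists>k. x / e^k \<le> e * (y * e^k) \<and> y * e^k \<le> e * (x / e^k)"
proof -
  define P where "P = (\<lambda>k. x / e^k \<le> e * (y * e^k))"
  obtain n where "x / y < e^n" using real_arch_pow[OF assms(3)] by blast
  then have "x < y * e^n" using assms by (simp add: field_simps)
  moreover have "x / e^n \<le> x / 1" using assms by (intro divide_left_mono) auto
  moreover have "1 * (y * e^n) \<le> e * (y * e^n)" using assms by (intro mult_right_mono) auto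
  ultimately have "P n" unfolding P_def by simp
  define k where "k = (LEAST k. P k)"
  have k: "P k" unfolding k_def using \<open>P n\<close> by (rule LeastI)
  have "y * e^k \<le> e * (x / e^k)"
  proof (cases k)
    case 0
    have "1 * x \<le> e * x" using assms by (intro mult_right_mono) auto
    then have "y \<le> e * x" using assms(4) by linarith
    then show ?thesis using 0 by simp
  next
    case (Suc j)
    then have "\<not> P j" unfolding k_def using not_less_Least[of j P] by simp
    then have "e * (y * e^j) < x / e^j" by (simp add: P_def)
    then show ?thesis using Suc assms by (simp add: field_simps)
  qed
  then show ?thesis using k unfolding P_def by blast
qed

text \<open>The lower row of \<open>A\<close> paired with the eigenvector \<open>(e - d, c)\<close> of a matrix with lower row \<open>(c, d)\<close> and eigenvalue \<open>e\<close>.\<close>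

definition eigL :: "complex \<Rightarrow> complex \<Rightarrow> complex \<Rightarrow> cmat \<Rightarrow> complex" where
  "eigL c d e A = A$2$1 * (e - d) + A$2$2 * c"

lemma eigL_mult:
  assumes "a*d - b*c = 1" "e^2 = (a + d) * e - 1"
  shows "eigL c d e (A ** mk a b c d) = e * eigL c d e A"
proof -
  obtain x y z w where A: "A = mk x y z w" by (rule mk_cases)
  have "eigL c d e (A ** mk a b c d) = z * ((a + d) * e - 1 - d*e) + e * w * c - z * (a*d - b*c - 1) + z*e*d - z*d*e"
    unfolding A mk_mult eigL_def mk_nth by (simp add: algebra_simps)
  also have "\<dots> = z * (e^2 - d*e) + e * w * c" by (simp only: assms) (simp add: algebra_simps)
  also have "\<dots> = e * eigL c d e A" unfolding A eigL_def mk_nth by (simp add: algebra_simps power2_eq_square)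
  finally show ?thesis .
qed

text \<open>The matrices congruent to \<open>\<plusminus>1\<close> or \<open>\<plusminus>B\<close> that commute with \<open>B\<close>: they contain all powers of \<open>B\<close>, because \<open>B\<^sup>2 \<equiv> -1\<close> modulo the trace of \<open>B\<close>.\<close>

definition powlike :: "nat \<Rightarrow> cmat \<Rightarrow> cmat \<Rightarrow> bool" where
  "powlike q B M \<longleftrightarrow> M \<in> Gam \<and> M ** B = B ** M \<and> (pm q M (mat 1) \<or> pm q M B)"

lemma trace_square:
  assumes "B \<in> Gam" "tr2 B = of_nat q"
  shows "pm q (B ** B) (mat 1)"
proof -
  obtain a b c d where B: "B = mk a b c d" "a \<in> Zw" "b \<in> Zw" "c \<in> Zw" "d \<in> Zw" "a*d - b*c = 1"
    using assms(1) by (rule Gam_cases)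
  have t: "a + d = of_nat q" using assms(2) by (simp add: B(1))
  have e: "a*a + b*c - -1 = of_nat q * a" "a*b + b*d - 0 = of_nat q * b" "c*a + d*c - 0 = of_nat q * c" "c*b + d*d - -1 = of_nat q * d"
    using B(6) unfolding t[symmetric] by (simp_all add: algebra_simps)
  have "con q (B ** B) (- mat 1)"
    unfolding B(1) mk_mult mat_1_mk mk_uminus con_mk minus_zero e using B by (simp add: qdvd_self)
  then show ?thesis by (simp add: pm_def)
qed

lemma powlike_one: "powlike q B (mat 1)"
  by (simp add: powlike_def Gam_one)

lemma powlike_mult:
  assumes B: "B \<in> Gam" "tr2 B = of_nat q" and M: "powlike q B M"
  shows "powlike q B (M ** B)"
proof -
  have M': "M \<in> Gam" "M ** B = B ** M" "pm q M (mat 1) \<or> pm q M B" using M by (auto simp: powlike_def)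
  have "M ** B ** B = B ** (M ** B)" by (simp only: M'(2)[symmetric] matrix_mul_assoc)
  moreover have "pm q (M ** B) (mat 1) \<or> pm q (M ** B) B"
    using M'(3) pm_mult_right[OF B(1), of q M "mat 1"] pm_mult_right[OF B(1), of q M B]
      pm_trans[OF _ trace_square[OF B]] by auto
  ultimately show ?thesis using M' B by (simp add: powlike_def Gam_mult)
qed

lemma powlike_mult_inv:
  assumes B: "B \<in> Gam" "tr2 B = of_nat q" and M: "powlike q B M"
  shows "powlike q B (M ** matrix_inv B)"
proof -
  let ?I = "matrix_inv B"
  have M': "M \<in> Gam" "M ** B = B ** M" "pm q M (mat 1) \<or> pm q M B" using M by (auto simp: powlike_def)
  have BS: "B \<in> SL2" and IG: "?I \<in> Gam" using B Gam_SL2 Gam_inv by auto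
  have "M ** ?I ** B = M" using BS by (rule SL2_inv_cancel_right')
  also have "M = B ** (M ** ?I)" using M'(2) SL2_inv_cancel_right[OF BS, of M] by (simp add: matrix_mul_assoc)
  finally have c: "M ** ?I ** B = B ** (M ** ?I)" .
  have "pm q (B ** B ** ?I) (mat 1 ** ?I)" by (rule pm_mult_right[OF IG trace_square[OF B]])
  then have "pm q B ?I" using SL2_inv_cancel_right[OF BS, of B] by simp
  then have IB: "pm q ?I B" by (rule pm_sym)
  have "pm q (M ** ?I) B \<or> pm q (M ** ?I) (mat 1)"
    using M'(3) pm_mult_right[OF IG, of q M "mat 1"] pm_mult_right[OF IG, of q M B] pm_trans[OF _ IB] SL2_inv_right[OF BS] by auto
  then show ?thesis using M' IG c by (auto simp: powlike_def Gam_mult)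
qed

text \<open>The two eigenvalue forms of the lower row of \<open>\<eta> B\<^sup>k\<close> have constant product \<open>c c'\<close>; choosing \<open>k\<close> to balance
  their sizes makes the lower left entry, their difference divided by \<open>\<surd>(q\<^sup>2 - 4)\<close>, smaller than 1.\<close>

lemma balanced_power:
  assumes q: "q \<ge> 3"
    and B: "B = mk a b c d" "B \<in> Gam" "a + d = of_nat q" "c \<noteq> 0" "16 * (cmod c)^2 \<le> real q"
    and B': "B' = mk a' b' c' d'" "c' \<noteq> 0" "16 * (cmod c')^2 \<le> real q"
    and H: "H \<in> Gam" "H ** B = B' ** H"
  shows "\<exists>M. powlike q B M \<and> (H ** M)$2$1 = 0"
proof -
  have det: "a*d - b*c = 1" using B(1,2) by (simp add: mk_Gam)
  have BS: "B \<in> SL2" using B(2) Gam_SL2 by blast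
  have tB: "tr2 B = of_nat q" using B(1,3) by simp
  define w where "w = sqrt (real q ^ 2 - 4)"
  have q9: "real q ^ 2 \<ge> 3^2" using q by (intro power_mono) auto
  have w2: "w^2 = real q ^ 2 - 4" using q9 by (simp add: w_def)
  have w0: "w > 0" using q9 by (simp add: w_def)
  have wq: "w < real q"
  proof -
    have "w^2 < real q ^ 2" using w2 by simp
    then show ?thesis by (rule power2_less_imp_less) simp
  qed
  have w1: "w > 1" 
  proof -
    have "1^2 < w^2" using w2 q9 by simp
    then show ?thesis using w0 by (intro power2_less_imp_less[of 1 w]) auto
  qed
  \<comment> \<open>\<open>e\<close> and \<open>f\<close> are the eigenvalues of \<open>B\<close>,
    real because the trace q exceeds 2.\<close>
  define e where "e = (real q + w) / 2"
  define f where "f = (real q - w) / 2"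
  have ef: "e * f = 1" using w2 by (simp add: e_def f_def algebra_simps power2_eq_square)
  have e1: "e > 1" using w1 q by (simp add: e_def)
  have f: "f = 1 / e" using ef e1 by (simp add: field_simps)
  have eq: "e \<le> real q" using wq by (simp add: e_def)
  have ewf: "e - f = w" by (simp add: e_def f_def field_simps)
  have e2: "e^2 = real q * e - 1" "f^2 = real q * f - 1"
    using w2 by (simp_all add: e_def f_def power2_eq_square field_simps)
  let ?e = "complex_of_real e" and ?f = "complex_of_real f"
  have "e + f = real q" by (simp add: e_def f_def field_simps)
  then have "?e + ?f = complex_of_real (real q)" by (simp only: of_real_add[symmetric])
  then have efs: "?e + ?f = a + d" unfolding B(3) by simp
  have e2c: "?e^2 = (a + d) * ?e - 1" "?f^2 = (a + d) * ?f - 1"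
    unfolding B(3) using e2[THEN arg_cong, of complex_of_real] by simp_all
  define E where "E = (\<lambda>M. eigL c d ?e (H ** M))"
  define F where "F = (\<lambda>M. eigL c d ?f (H ** M))"
  have EB: "E (M ** B) = ?e * E M" "F (M ** B) = ?f * F M" for M
    unfolding E_def F_def matrix_mul_assoc B(1) by (intro eigL_mult det e2c)+
  have EI: "E (M ** matrix_inv B) = ?f * E M" "F (M ** matrix_inv B) = ?e * F M" for M
  proof -
    have fe: "?f * ?e = 1" using ef by (simp flip: of_real_mult add: mult.commute)
    have "?f * E M = ?f * (?e * E (M ** matrix_inv B))"
      using EB(1)[of "M ** matrix_inv B"] SL2_inv_cancel_right'[OF BS, of M] by simp
    also have "\<dots> = E (M ** matrix_inv B)" using fe by (simp flip: mult.assoc)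
    finally show "E (M ** matrix_inv B) = ?f * E M" by simp
    have "?e * F M = ?e * (?f * F (M ** matrix_inv B))"
      using EB(2)[of "M ** matrix_inv B"] SL2_inv_cancel_right'[OF BS, of M] by simp
    also have "\<dots> = F (M ** matrix_inv B)" using fe by (simp flip: mult.assoc add: mult.commute)
    finally show "F (M ** matrix_inv B) = ?e * F M" by simp
  qed
  \<comment> \<open>The product is \<open>c\<close> times the quadratic form of \<open>B\<close>
    evaluated at the lower row of \<open>H\<close>. That value is the lower left entry of H B H^-1 =
    B', namely \<open>c'\<close>.\<close>
  have prod: "E (mat 1) * F (mat 1) = c * c'"
  proof -
    obtain x y z v where Hm: "H = mk x y z v" "x * v - y*z = 1" using H(1) by (rule Gam_cases)
    have h: "z*a + v * c = c'*x + d'*z" "z*b + v * d = c'*y + d' * v"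
      using H(2) unfolding Hm(1) B(1) B'(1) mk_mult by simp_all
    have c': "c' = v * (z*a + v * c) - z * (z*b + v * d)"
    proof -
      have "v * (z*a + v * c) - z * (z*b + v * d) = c' * (x * v - y*z)" unfolding h by (simp add: algebra_simps)
      then show ?thesis using Hm(2) by simp
    qed
    have p: "(?e - d) * (?f - d) = - (b * c)"
    proof -
      have fe: "?e * ?f = 1" using ef by (simp flip: of_real_mult)
      have "(?e - d) * (?f - d) = ?e * ?f - d * (?e + ?f) + d*d" by (simp add: algebra_simps)
      also have "\<dots> = 1 - d * (a + d) + d * d" unfolding fe efs ..
      finally show ?thesis using det by (simp add: algebra_simps)
    qed
    have s: "(?e - d) + (?f - d) = a - d"
    proof -
      show ?thesis using efs by (simp add: algebra_simps)
    qed
    have "E (mat 1) * F (mat 1) = z*z * ((?e - d) * (?f - d)) + z * v * c*((?e - d) + (?f - d)) + v * v * c*c"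
      by (simp add: E_def F_def eigL_def Hm(1) algebra_simps)
    also have "\<dots> = c * c'" unfolding p s c' by (simp add: algebra_simps)
    finally show ?thesis .
  qed
  then have nz: "E (mat 1) \<noteq> 0" "F (mat 1) \<noteq> 0" using B(4) B'(2) by auto
  have pw: "\<exists>M. powlike q B M \<and> E M = ?e^k * E (mat 1) \<and> F M = ?f^k * F (mat 1)" for k
  proof (induction k)
    case 0 then show ?case using powlike_one by auto
  next
    case (Suc k)
    then obtain M where "powlike q B M" "E M = ?e^k * E (mat 1)" "F M = ?f^k * F (mat 1)" by blast
    then show ?case using powlike_mult[OF B(2) tB] EB by (intro exI[of _ "M ** B"]) simp
  qed
  have pwi: "\<exists>M. powlike q B M \<and> E M = ?f^k * E (mat 1) \<and> F M = ?e^k * F (mat 1)" for k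
  proof (induction k)
    case 0 then show ?case using powlike_one by auto
  next
    case (Suc k)
    then obtain M where "powlike q B M" "E M = ?f^k * E (mat 1)" "F M = ?e^k * F (mat 1)" by blast
    then show ?case using powlike_mult_inv[OF B(2) tB] EI by (intro exI[of _ "M ** matrix_inv B"]) simp
  qed
  have n: "cmod (?f^k * z) = cmod z / e^k" "cmod (?e^k * z) = cmod z * e^k" for k z
    using e1 by (simp_all add: norm_mult norm_power norm_divide f power_divide)
  obtain M where M: "powlike q B M" "cmod (E M) \<le> e * cmod (F M)" "cmod (F M) \<le> e * cmod (E M)"
    "cmod (E M) * cmod (F M) = cmod (E (mat 1)) * cmod (F (mat 1))"
  proof (cases "cmod (F (mat 1)) \<le> cmod (E (mat 1))")
    case True
    then obtain k where k: "cmod (E (mat 1)) / e^k \<le> e * (cmod (F (mat 1)) * e^k)"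
      "cmod (F (mat 1)) * e^k \<le> e * (cmod (E (mat 1)) / e^k)"
      using geometric_balance[of "cmod (E (mat 1))" "cmod (F (mat 1))" e] nz e1 by auto
    obtain M where "powlike q B M" "E M = ?f^k * E (mat 1)" "F M = ?e^k * F (mat 1)" using pwi by blast
    then show ?thesis using that[of M] k e1 by (simp add: n)
  next
    case False
    then obtain k where k: "cmod (F (mat 1)) / e^k \<le> e * (cmod (E (mat 1)) * e^k)"
      "cmod (E (mat 1)) * e^k \<le> e * (cmod (F (mat 1)) / e^k)"
      using geometric_balance[of "cmod (F (mat 1))" "cmod (E (mat 1))" e] nz e1 by auto
    obtain M where "powlike q B M" "E M = ?e^k * E (mat 1)" "F M = ?f^k * F (mat 1)" using pw by blast
    then show ?thesis using that[of M] k e1 by (simp add: n)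
  qed
  define X where "X = cmod (E M)"
  define Y where "Y = cmod (F M)"
  have XY: "X * Y = cmod c * cmod c'" using M(4) prod by (simp add: X_def Y_def flip: norm_mult)
  have "16 * (cmod c * cmod c') \<le> real q"
  proof -
    have "2 * (cmod c * cmod c') \<le> (cmod c)^2 + (cmod c')^2" using sum_squares_bound[of "cmod c" "cmod c'"] by simp
    then show ?thesis using B(5) B'(3) by simp
  qed
  then have XYq: "16 * (X * Y) \<le> real q" by (simp add: XY)
  \<comment> \<open>Balance gives (X + Y)^2 <= 4 e X Y with e <= q, and 16 X Y <= q comes from the
    bounds on \<open>c\<close> and \<open>c'\<close>. The constant 16 is what brings X + Y down to
    q/2, below \<open>w\<close>.\<close>
  have "X * X \<le> X * (e * Y)" "Y * Y \<le> Y * (e * X)"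
    using M(2,3) by (auto simp: X_def Y_def intro: mult_left_mono)
  then have "X * X + Y * Y + 2 * (X * Y) \<le> 2 * (e * (X * Y)) + 2 * (X * Y)" by (simp add: algebra_simps)
  also have "\<dots> \<le> 2 * (e * (X * Y)) + 2 * (e * (X * Y))"
  proof -
    have "1 * (X * Y) \<le> e * (X * Y)" using e1 by (intro mult_right_mono) (auto simp: X_def Y_def)
    then show ?thesis by linarith
  qed
  also have "\<dots> = 4 * (e * (X * Y))" by simp
  also have "\<dots> \<le> 4 * (real q * (real q / 16))"
  proof -
    have "e * (X * Y) \<le> real q * (real q / 16)" using eq XYq e1 by (intro mult_mono) (auto simp: X_def Y_def)
    then show ?thesis by simp
  qed
  finally have "(X + Y)^2 \<le> (real q / 2)^2" by (simp add: power2_eq_square algebra_simps)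
  then have XYs: "X + Y \<le> real q / 2" by (rule power2_le_imp_le) simp
  define z where "z = (H ** M)$2$1"
  have "E M - F M = z * (?e - ?f)" by (simp add: E_def F_def eigL_def z_def algebra_simps)
  also have "?e - ?f = of_real w" using ewf by (simp flip: of_real_diff)
  finally have "cmod z * w = cmod (E M - F M)" using w0 by (simp add: norm_mult)
  also have "\<dots> \<le> X + Y" unfolding X_def Y_def by (rule norm_triangle_ineq4)
  finally have zw: "cmod z * w \<le> real q / 2" using XYs by simp
  have "real q / 2 < w"
  proof -
    have "(real q / 2)^2 < w^2" using w2 q9 by (simp add: power_divide)
    then show ?thesis using w0 by (intro power2_less_imp_less[of "real q / 2"]) auto
  qed
  then have "cmod z * w < 1 * w" using zw by linarith
  then have "cmod z < 1" by (rule mult_less_cancel_right_pos[OF w0, THEN iffD1])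
  moreover have "H ** M \<in> Gam" using M(1) H(1) by (simp add: powlike_def Gam_mult)
  then have "z \<in> Zw" by (simp add: z_def Gam_def)
  ultimately have "z = 0" using Zw_small by blast
  then have "(H ** M)$2$1 = 0" by (simp add: z_def)
  then show ?thesis using M(1) by (intro exI conjI)
qed

section \<open>Conjugacy classes of systolic elements\<close>

definition nf :: "int \<Rightarrow> int \<Rightarrow> int" where "nf u v = u^2 + 2 * v^2"

text \<open>\<open>(u, v, r)\<close> encodes the lower left entry \<open>c = u + v \<omega>\<close> of norm \<open>nf u v\<close> and a root \<open>r\<close> of \<open>r\<^sup>2 - q r + 1\<close> modulo \<open>c\<close>;
  coprimality of \<open>u\<close> and \<open>v\<close> makes the rational integers modulo \<open>nf u v\<close> exhaust the residues modulo \<open>c\<close>.\<close>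

definition Hset :: "nat \<Rightarrow> (int \<times> int \<times> int) set" where
  "Hset q = {(u, v, r). u > 0 \<and> v > 0 \<and> coprime u v \<and> 16 * nf u v \<le> int q \<and> 0 \<le> r \<and> r < nf u v \<and>
     nf u v dvd r * (int q - r) - 1}"

text \<open>The diagonal r, q - r gives trace q. The upper right entry is (r (q - r) - 1) / c,
  written as an integer times the conjugate \<open>zc u (-v)\<close> of c because the norm of c
  divides the numerator.\<close>

fun Bm :: "nat \<Rightarrow> int \<times> int \<times> int \<Rightarrow> cmat" where
  "Bm q (u, v, r) = mk (of_int r) (of_int ((r * (int q - r) - 1) div nf u v) * zc u (-v)) (zc u v) (of_int (int q - r))"

lemma zc_nf: "zc u (-v) * zc u v = of_int (nf u v)"
  by (simp add: zc_mult nf_def power2_eq_square zc_of_int)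

lemma Bm_props:
  assumes "(u, v, r) \<in> Hset q"
  shows "Bm q (u, v, r) \<in> Gam" "tr2 (Bm q (u, v, r)) = of_nat q" "zc u v \<noteq> 0" "16 * (cmod (zc u v))^2 \<le> real q"
proof -
  have h: "u > 0" "v > 0" "16 * nf u v \<le> int q" "nf u v dvd r * (int q - r) - 1" using assms by (auto simp: Hset_def)
  define m where "m = (r * (int q - r) - 1) div nf u v"
  have m: "m * nf u v = r * (int q - r) - 1" using h(4) by (simp add: m_def)
  have "of_int m * zc u (-v) * zc u v = of_int (m * nf u v)" by (simp add: zc_nf mult.assoc)
  also have "\<dots> = complex_of_int r * of_int (int q - r) - 1" unfolding m by simp
  finally have d: "of_int r * of_int (int q - r) - of_int m * zc u (-v) * zc u v = 1" by simp
  show "Bm q (u, v, r) \<in> Gam" unfolding Bm.simps mk_Gam m_def[symmetric] using d by (simp add: Zw_mult del: of_int_diff)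
  show "tr2 (Bm q (u, v, r)) = of_nat q" by simp
  show "zc u v \<noteq> 0" using h by (simp add: zc_0)
  have "16 * (cmod (zc u v))^2 = of_int (16 * nf u v)" by (simp add: cmod_zc nf_def)
  also have "\<dots> \<le> of_int (int q)" using h(3) by (simp only: of_int_le_iff)
  finally show "16 * (cmod (zc u v))^2 \<le> real q" by simp
qed

text \<open>A vanishing imaginary part together with coprimality forces the cofactor of
  \<open>zc u v\<close> to be an integer multiple of its conjugate, so the product is a multiple of
  the norm.\<close>

lemma zc_dvd_int:
  assumes "coprime u v" "u \<noteq> 0" "zc x y * zc u v = of_int k" shows "nf u v dvd k"
proof -
  have e: "x * u - 2 * y * v = k" "x * v + y * u = 0" using assms(3) by (simp_all add: zc_mult zc_of_int)
  then have "x * v = u * (- y)" by (simp add: algebra_simps)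
  then have "u dvd x * v" by (rule dvdI)
  then have "u dvd x" using assms(1) by (simp add: coprime_dvd_mult_left_iff)
  then obtain l where l: "x = u * l" by blast
  have "u * (l * v + y) = 0" using e(2) by (simp add: l algebra_simps)
  then have "y = - (l * v)" using assms(2) by simp
  then have "k = nf u v * l" using e(1) by (simp add: l nf_def power2_eq_square algebra_simps)
  then show ?thesis by simp
qed

text \<open>By \<open>balanced_power\<close>, \<open>T = H ** M\<close> is upper triangular with
  diagonal 1, 1 or -1, -1. It therefore preserves c and changes r by a multiple of c, hence of the
  norm; the range of r excludes any change, so T is 1 or -1 and H is inverse to \<open>M\<close> up
  to sign. The case t = t' bounds the centraliser modulo \<open>q\<close>.\<close>

lemma Bm_rigid:
  assumes q: "q \<ge> 3" and t: "t \<in> Hset q" "t' \<in> Hset q" and H: "H \<in> Gam" "H ** Bm q t = Bm q t' ** H"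
  shows "t = t' \<and> (pm q H (mat 1) \<or> pm q H (Bm q t))"
proof -
  obtain u v r where t1: "t = (u, v, r)" by (cases t)
  obtain u' v' r' where t2: "t' = (u', v', r')" by (cases t')
  note p = Bm_props[OF t(1)[unfolded t1]] and p' = Bm_props[OF t(2)[unfolded t2]]
  have h: "coprime u v" "0 \<le> r" "r < nf u v" "u \<noteq> 0" using t(1) by (auto simp: t1 Hset_def)
  have h': "0 \<le> r'" "r' < nf u' v'" using t(2) by (auto simp: t2 Hset_def)
  define B where "B = Bm q t"
  define B' where "B' = Bm q t'"
  have tB: "of_int r + of_int (int q - r) = complex_of_nat q" by simp
  obtain M where M: "powlike q B M" "(H ** M)$2$1 = 0"
    using balanced_power[OF q _ _ tB p(3,4) _ p'(3,4) H(1), of B _ B'] p(1) H(2)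
    unfolding B_def B'_def t1 t2 Bm.simps by blast
  have MG: "M \<in> Gam" "M ** B = B ** M" "pm q M (mat 1) \<or> pm q M B" using M(1) by (auto simp: powlike_def)
  define T where "T = H ** M"
  have TG: "T \<in> Gam" unfolding T_def using H(1) MG(1) by (rule Gam_mult)
  obtain a x c d where T: "T = mk a x c d" "a \<in> Zw" "x \<in> Zw" "d \<in> Zw" "a*d - x*c = 1" using TG by (rule Gam_cases)
  have c0: "c = 0" using M(2) T(1) by (simp add: T_def)
  then have ad: "a = 1 \<and> d = 1 \<or> a = -1 \<and> d = -1" using Zw_unit[of a d] T by auto
  have TB: "T ** B = B' ** T"
  proof -
    have "T ** B = H ** (M ** B)" by (simp add: T_def matrix_mul_assoc)
    also have "\<dots> = (H ** B) ** M" by (simp only: MG(2) matrix_mul_assoc)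
    also have "\<dots> = B' ** T" using H(2) by (simp add: T_def B_def B'_def matrix_mul_assoc)
    finally show ?thesis .
  qed
  then have e: "a * of_int r + x * zc u v = of_int r' * a" "d * zc u v = zc u' v' * a"
    unfolding T(1) B_def B'_def t1 t2 Bm.simps mk_mult c0 by simp_all
  have "zc u v = zc u' v'" using e(2) ad by auto
  then have uv: "u' = u" "v' = v" by simp_all
  obtain x1 x2 where x: "x = zc x1 x2" using T(3) by (rule Zw_cases)
  have "zc x1 x2 * zc u v = of_int (r' - r) \<or> zc x1 x2 * zc u v = of_int (r - r')"
    using e(1) ad by (auto simp: x algebra_simps)
  then have "nf u v dvd r' - r \<or> nf u v dvd r - r'" using zc_dvd_int[OF h(1,4)] by blast
  then have "nf u v dvd r' - r" by (metis dvd_minus_iff minus_diff_eq)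
  then have "\<bar>nf u v\<bar> \<le> \<bar>r' - r\<bar>" if "r' - r \<noteq> 0" by (rule dvd_imp_le_int[OF that])
  moreover have "\<bar>r' - r\<bar> < nf u v" using h h' uv by auto
  ultimately have r: "r' = r" by linarith
  have "x * zc u v = 0" using e(1) r by (simp add: algebra_simps)
  then have x0: "x = 0" using p(3) by simp
  have "T = mat 1 \<or> T = - mat 1" using ad by (auto simp: T(1) c0 x0 mat_1_mk mk_uminus)
  then have T1: "pm q T (mat 1)" by auto
  have HM: "H = T ** matrix_inv M" unfolding T_def using SL2_inv_cancel_right[OF Gam_SL2[OF MG(1)]] by simp
  have 1: "pm q H (matrix_inv M)" unfolding HM using pm_mult_right[OF Gam_inv[OF MG(1)] T1] by simp
  have BG: "B \<in> Gam" and tB': "tr2 B = of_nat q" using p by (simp_all add: B_def t1)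
  have "pm q (matrix_inv M) (mat 1) \<or> pm q (matrix_inv M) B"
    using MG(3)
  proof
    assume "pm q M (mat 1)"
    then show ?thesis using pm_inv[OF MG(1) Gam_one] by (simp add: matrix_inv_one)
  next
    assume "pm q M B"
    then have "pm q (matrix_inv M) (matrix_inv B)" by (rule pm_inv[OF MG(1) BG])
    moreover have "powlike q B (mat 1 ** matrix_inv B)" by (rule powlike_mult_inv[OF BG tB' powlike_one])
    then have "pm q (matrix_inv B) (mat 1) \<or> pm q (matrix_inv B) B" by (simp add: powlike_def)
    ultimately show ?thesis using pm_trans by blast
  qed
  then show ?thesis using 1 pm_trans uv r by (auto simp: t1 t2 B_def)
qed

text \<open>Both squares are q times the matrix minus 1, so the relation for squares is q times the
  wanted one.\<close>

lemma Cayley_Hamilton_conj: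
  assumes B: "tr2 B = of_nat q" "B \<in> Gam" "tr2 B' = of_nat q" "B' \<in> Gam" and q: "q > 0"
    and H: "H ** (B ** B) = (B' ** B') ** H"
  shows "H ** B = B' ** H"
proof -
  obtain a b c d where B1: "B = mk a b c d" "a*d - b*c = 1" using B(2) by (rule Gam_cases)
  obtain a' b' c' d' where B2: "B' = mk a' b' c' d'" "a'*d' - b'*c' = 1" using B(4) by (rule Gam_cases)
  obtain x y z w where Hm: "H = mk x y z w" by (rule mk_cases)
  define Q where "Q = complex_of_nat q"
  have t: "d = Q - a" "d' = Q - a'" using B(1,3) by (simp_all add: B1 B2 Q_def algebra_simps)
  have b: "b*c = a * (Q - a) - 1" "b'*c' = a' * (Q - a') - 1" using B1(2) B2(2) unfolding t by (simp_all add: algebra_simps)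
  have BB: "B ** B = mk (Q * a - 1) (Q * b) (Q * c) (Q * d - 1)"
    unfolding B1(1) mk_mult t using b by (simp add: algebra_simps)
  have BB': "B' ** B' = mk (Q * a' - 1) (Q * b') (Q * c') (Q * d' - 1)"
    unfolding B2(1) mk_mult t using b by (simp add: algebra_simps)
  have "Q * (x * a + y * c) = Q * (a' * x + b' * z)" "Q * (x * b + y * d) = Q * (a' * y + b' * w)"
    "Q * (z * a + w * c) = Q * (c' * x + d' * z)" "Q * (z * b + w * d) = Q * (c' * y + d' * w)"
    using H unfolding BB BB' Hm mk_mult by (auto simp: algebra_simps)
  moreover have "Q \<noteq> 0" using q by (simp add: Q_def)
  ultimately show ?thesis unfolding Hm B1(1) B2(1) mk_mult by simp
qed

lemma conj_class_conj:
  assumes G: "PSL_preimage_subgroup G" and g: "g \<in> G"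
  shows "conj_class G (g ** X ** matrix_inv g) = conj_class G X"
proof -
  have S: "A \<in> SL2" if "A \<in> G" for A using that G by (auto simp: PSL_preimage_subgroup_def)
  have cl: "A ** B \<in> G" "matrix_inv A \<in> G" if "A \<in> G" "B \<in> G" for A B using that G by (auto simp: PSL_preimage_subgroup_def)
  have sub: "conj_class G (g ** X ** matrix_inv g) \<subseteq> conj_class G X" if g: "g \<in> G" for g X
  proof
    fix B assume "B \<in> conj_class G (g ** X ** matrix_inv g)"
    then obtain C where C: "C \<in> G" "B = C ** (g ** X ** matrix_inv g) ** matrix_inv C \<or> B = - (C ** (g ** X ** matrix_inv g) ** matrix_inv C)"
      by (auto simp: conj_class_def)
    have "C ** (g ** X ** matrix_inv g) ** matrix_inv C = (C ** g) ** X ** matrix_inv (C ** g)"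
      using S[OF g] S[OF C(1)] by (simp add: SL2_inv_mult matrix_mul_assoc)
    then show "B \<in> conj_class G X" using C cl(1)[OF C(1) g] by (auto simp: conj_class_def)
  qed
  have "matrix_inv g ** (g ** X ** matrix_inv g) ** matrix_inv (matrix_inv g) = X"
    using S[OF g] by (simp add: SL2_inv_inv SL2_inv_cancel_right' matrix_mul_assoc SL2_inv_left)
  then have "conj_class G X \<subseteq> conj_class G (g ** X ** matrix_inv g)"
    using sub[OF cl(2)[OF g g], of "g ** X ** matrix_inv g"] by simp
  then show ?thesis using sub[OF g] by blast
qed

text \<open>The set counted by \<open>Kiss\<close>. As \<open>card\<close> of an infinite set is 0,
  a lower bound for \<open>Kiss\<close> needs its finiteness, shown in
  \<open>Cls_finite\<close>.\<close>

definition Cls :: "nat \<Rightarrow> cmat set set" where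
  "Cls q = {conj_class (Gq q) A | A. A \<in> Gq q \<and> loxodromic A \<and> tlen A = sys (Gq q)}"

text \<open>The pair (t, D) is sent to the class of the conjugate of the square of
  \<open>Bm q t\<close> by D. This map is at most two to one: a coincidence yields an intertwiner,
  which by \<open>Bm_rigid\<close> is 1 or \<open>Bm q t\<close> modulo \<open>q\<close> up to
  sign.\<close>

lemma Kiss_Gq_ge:
  assumes q: "q \<ge> 3" and fin: "finite (Cls q)"
  shows "card (Hset q) * card (Reps q) \<le> 2 * Kiss (Gq q)" "finite (Hset q)"
proof -
  define f where "f = (\<lambda>(t, D::cmat). conj_class (Gq q) (D ** (Bm q t ** Bm q t) ** matrix_inv D))"
  define A where "A = (\<lambda>t (D::cmat). D ** (Bm q t ** Bm q t) ** matrix_inv D)"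
  have fA: "f (t, D) = conj_class (Gq q) (A t D)" for t D by (simp add: f_def A_def)
  have q0: "q > 0" using q by simp
  have BG: "Bm q t \<in> Gam" "tr2 (Bm q t) = of_nat q" if "t \<in> Hset q" for t
    using that Bm_props by (cases t; blast)+
  have sq: "tr2 (Bm q t ** Bm q t) = of_nat q ^ 2 - 2" if "t \<in> Hset q" for t
  proof -
    have "Bm q t \<in> Gam" using that by (rule BG(1))
    then obtain a b c d where m: "Bm q t = mk a b c d" "a*d - b*c = 1" by (rule Gam_cases)
    have "a + d = of_nat q" using BG(2)[OF that] m by simp
    then have "of_nat q ^ 2 - 2 = (a + d)^2 - 2 * (a*d - b*c)" using m by simp
    then show ?thesis unfolding m(1) mk_mult tr2_mk by (simp add: power2_eq_square algebra_simps)
  qed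
  have AG: "A t D \<in> Gq q" "tr2 (A t D) = of_nat q ^ 2 - 2" if "t \<in> Hset q" "D \<in> Gam" for t D
  proof -
    have B: "Bm q t ** Bm q t \<in> Gam" using BG[OF that(1)] Gam_mult by blast
    have "pm q (D ** (Bm q t ** Bm q t) ** matrix_inv D) (D ** mat 1 ** matrix_inv D)"
      by (intro pm_mult_right pm_mult_left Gam_inv that trace_square BG)
    then show "A t D \<in> Gq q" unfolding A_def Gq_def
      using that B SL2_inv_right[OF Gam_SL2[OF that(2)]] by (auto intro: Gam_mult Gam_inv)
    show "tr2 (A t D) = of_nat q ^ 2 - 2" unfolding A_def using tr2_conj[OF Gam_SL2[OF that(2)]] sq[OF that(1)] by simp
  qed
  have im: "f ` (Hset q \<times> Reps q) \<subseteq> Cls q"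
  proof
    fix y assume "y \<in> f ` (Hset q \<times> Reps q)"
    then obtain t D where tD: "t \<in> Hset q" "D \<in> Reps q" "y = f (t, D)" by auto
    have "D \<in> Gam" using tD Reps_Gam by blast
    note a = AG[OF tD(1) this]
    show "y \<in> Cls q" unfolding Cls_def tD(3) fA using a tlen_Gq_eq[OF q a] sys_Gq[OF q] by auto
  qed
  \<comment> \<open>\<open>conj_class\<close> identifies A with -A. The trace q^2 - 2 is nonzero,
    which rules out the negative sign between two of the elements considered.\<close>
  have nz: "complex_of_nat q ^ 2 - 2 \<noteq> - (of_nat q ^ 2 - 2)"
  proof
    assume "complex_of_nat q ^ 2 - 2 = - (of_nat q ^ 2 - 2)"
    then have "complex_of_nat (q ^ 2) = of_nat 2" by (simp add: algebra_simps)
    then have "q^2 = 2" by (simp only: of_nat_eq_iff)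
    moreover have "3^2 \<le> q^2" using q by (intro power_mono) auto
    ultimately show False by simp
  qed
  have key: "t = t' \<and> (D = D' \<or> D = rep q (D' ** Bm q t'))"
    if x: "t \<in> Hset q" "D \<in> Reps q" "t' \<in> Hset q" "D' \<in> Reps q" "f (t, D) = f (t', D')" for t D t' D'
  proof -
    have DG: "D \<in> Gam" "D' \<in> Gam" using x Reps_Gam by auto
    note S = Gam_SL2[OF DG(1)] Gam_SL2[OF DG(2)]
    have "A t D = mat 1 ** A t D ** matrix_inv (mat 1)" by (simp add: matrix_inv_one)
    then have "A t D \<in> conj_class (Gq q) (A t D)" unfolding conj_class_def using Gq_one by blast
    then have "A t D \<in> conj_class (Gq q) (A t' D')" using x(5) by (simp add: fA)
    then obtain C where C: "C \<in> Gq q" "A t D = C ** A t' D' ** matrix_inv C \<or> A t D = - (C ** A t' D' ** matrix_inv C)"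
      by (auto simp: conj_class_def)
    have trC: "tr2 (C ** A t' D' ** matrix_inv C) = of_nat q ^ 2 - 2"
      using tr2_conj[OF Gq_SL2[OF C(1)]] AG(2)[OF x(3) DG(2)] by simp
    have eq: "A t D = C ** A t' D' ** matrix_inv C"
      using C(2)
    proof
      assume "A t D = - (C ** A t' D' ** matrix_inv C)"
      then have "tr2 (A t D) = - tr2 (C ** A t' D' ** matrix_inv C)" by simp
      then show ?thesis using nz trC AG(2)[OF x(1) DG(1)] by simp
    qed
    define E where "E = C ** D'"
    have CG: "C \<in> Gam" and EG: "E \<in> Gam" using C Gq_Gam DG Gam_mult by (auto simp: E_def)
    have ES: "E \<in> SL2" using EG Gam_SL2 by blast
    define H where "H = matrix_inv E ** D"
    have HG: "H \<in> Gam" unfolding H_def by (intro Gam_mult Gam_inv EG DG)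
    have "D ** (Bm q t ** Bm q t) ** matrix_inv D = E ** (Bm q t' ** Bm q t') ** matrix_inv E"
      using eq unfolding A_def E_def SL2_inv_mult[OF Gam_SL2[OF CG] S(2)] by (simp add: matrix_mul_assoc)
    then have "D ** (Bm q t ** Bm q t) ** matrix_inv D ** D = E ** (Bm q t' ** Bm q t') ** matrix_inv E ** D" by simp
    then have "D ** (Bm q t ** Bm q t) = E ** (Bm q t' ** Bm q t') ** matrix_inv E ** D"
      by (simp only: SL2_inv_cancel_right'[OF S(1)])
    then have "matrix_inv E ** (D ** (Bm q t ** Bm q t)) = matrix_inv E ** (E ** ((Bm q t' ** Bm q t') ** matrix_inv E ** D))"
      by (simp only: matrix_mul_assoc)
    then have "H ** (Bm q t ** Bm q t) = (Bm q t' ** Bm q t') ** H"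
      unfolding H_def SL2_inv_cancel_left[OF ES] by (simp only: matrix_mul_assoc)
    then have "H ** Bm q t = Bm q t' ** H"
      by (rule Cayley_Hamilton_conj[OF BG(2)[OF x(1)] BG(1)[OF x(1)] BG(2)[OF x(3)] BG(1)[OF x(3)] q0])
    from Bm_rigid[OF q x(1,3) HG this]
    have tt: "t = t'" and Hp: "pm q H (mat 1) \<or> pm q H (Bm q t')" by auto
    have DE: "D = E ** H" unfolding H_def using SL2_inv_cancel_left'[OF ES] by simp
    have "pm q (C ** D') (mat 1 ** D')" using C(1) DG by (intro pm_mult_right) (auto simp: Gq_def)
    then have ED: "pm q E D'" by (simp add: E_def)
    have "pm q D D' \<or> pm q D (D' ** Bm q t')"
      using Hp
    proof
      assume "pm q H (mat 1)"
      then have "pm q D (E ** mat 1)" unfolding DE by (intro pm_mult_left EG)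
      then show ?thesis using ED pm_trans by auto
    next
      assume "pm q H (Bm q t')"
      then have "pm q D (E ** Bm q t')" unfolding DE by (intro pm_mult_left EG)
      moreover have "pm q (E ** Bm q t') (D' ** Bm q t')" using ED BG[OF x(3)] by (intro pm_mult_right)
      ultimately show ?thesis using pm_trans by blast
    qed
    then have "rep q D = rep q D' \<or> rep q D = rep q (D' ** Bm q t')" using rep_eq by blast
    then show ?thesis using tt x Reps_rep by auto
  qed
  have fib: "finite {x \<in> Hset q \<times> Reps q. f x = y} \<and> card {x \<in> Hset q \<times> Reps q. f x = y} \<le> 2" for y
  proof (cases "{x \<in> Hset q \<times> Reps q. f x = y} = {}")
    case True then show ?thesis by (simp only: finite.emptyI card.empty, simp)
  next
    case False
    then obtain t' D' where x': "t' \<in> Hset q" "D' \<in> Reps q" "f (t', D') = y" by auto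
    have sub: "{x \<in> Hset q \<times> Reps q. f x = y} \<subseteq> {(t', D'), (t', rep q (D' ** Bm q t'))}"
    proof
      fix x assume "x \<in> {x \<in> Hset q \<times> Reps q. f x = y}"
      then obtain t D where "x = (t, D)" "t \<in> Hset q" "D \<in> Reps q" "f (t, D) = y" by auto
      then show "x \<in> {(t', D'), (t', rep q (D' ** Bm q t'))}" using key[of t D t' D'] x' by auto
    qed
    have "card {x \<in> Hset q \<times> Reps q. f x = y} \<le> card {(t', D'), (t', rep q (D' ** Bm q t'))}"
      using sub by (intro card_mono) auto
    also have "\<dots> \<le> 2" by (simp add: card_insert_if)
    finally show ?thesis using sub finite_subset by blast
  qed
  \<comment> \<open>Finiteness of \<open>Hset q\<close> comes for free, from finite fibres over the
    finite set \<open>Cls q\<close>.\<close>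
  have f1: "finite (Hset q \<times> Reps q)" using card_fibers_le(1)[OF fin im] fib by blast
  then show "finite (Hset q)" using Reps_nonempty by (metis finite_cartesian_productD1)
  have "card (Hset q \<times> Reps q) \<le> card (Cls q) * 2" using card_fibers_le(2)[OF fin im] fib by blast
  then show "card (Hset q) * card (Reps q) \<le> 2 * Kiss (Gq q)"
    unfolding Kiss_def Cls_def[symmetric] by (simp add: card_cartesian_product mult.commute)
qed

text \<open>Reduction of binary quadratic forms: minimise the lower left entry over the conjugacy class.\<close>

lemma Gam_reduction:
  assumes A: "A \<in> Gam" "tr2 A \<noteq> 2" "tr2 A \<noteq> -2" and T: "cmod (tr2 A) \<le> T"
  shows "\<exists>g A0. g \<in> Gam \<and> A0 \<in> Gam \<and> A = g ** A0 ** matrix_inv g \<and>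
     (\<forall>i j. cmod (A0$i$j) \<le> 4 * (T^2 + 4) + T)"
proof -
  define K where "K = T^2 + 4"
  have T0: "T \<ge> 0" using T norm_ge_zero order_trans by blast
  have K4: "K \<ge> 4" by (simp add: K_def)
  define n where "n = (\<lambda>g::cmat. nrm ((g ** A ** matrix_inv g)$2$1))"
  obtain g where g: "g \<in> Gam" "\<And>h. h \<in> Gam \<Longrightarrow> n g \<le> n h"
    using ex_has_least_nat[of "\<lambda>g. g \<in> Gam" "mat 1" n] Gam_one by blast
  have conjG: "h ** A ** matrix_inv h \<in> Gam" if "h \<in> Gam" for h using that A by (intro Gam_mult Gam_inv)
  have trh: "tr2 (h ** A ** matrix_inv h) = tr2 A" if "h \<in> Gam" for h using tr2_conj[OF Gam_SL2[OF that]] .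
  have nz: "(h ** A ** matrix_inv h)$2$1 \<noteq> 0" if "h \<in> Gam" for h
    using Gam_lower_left_0[OF conjG[OF that]] trh[OF that] A by auto
  obtain a b c d where m: "g ** A ** matrix_inv g = mk a b c d" "a \<in> Zw" "b \<in> Zw" "c \<in> Zw" "d \<in> Zw" "a*d - b*c = 1"
    using conjG[OF g(1)] by (rule Gam_cases)
  have c0: "c \<noteq> 0" using nz[OF g(1)] m by simp
  \<comment> \<open>Conjugation by a translation keeps c and changes a - d by multiples of 2c, so |a
    - d|^2 can be made at most 3 |c|^2.\<close>
  obtain u0 where u0: "u0 \<in> Zw" "(cmod ((a - d) / (2 * c) - u0))^2 \<le> 3/4" using Zw_cover by blast
  define u where "u = - u0"
  have u: "u \<in> Zw" using u0 by (auto simp: u_def)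
  define U where "U = mk 1 u 0 1"
  have U: "U \<in> Gam" using u by (simp add: U_def mk_Gam)
  have UI: "matrix_inv U = mk 1 (-u) 0 1" unfolding U_def by (subst matrix_inv_mk) simp_all
  define h where "h = U ** g"
  have hG: "h \<in> Gam" unfolding h_def by (intro Gam_mult U g)
  define a1 where "a1 = a + u * c"
  define d1 where "d1 = d - u * c"
  define b1 where "b1 = b + u * d - u * a1"
  have hA: "h ** A ** matrix_inv h = mk a1 b1 c d1"
  proof -
    have "h ** A ** matrix_inv h = U ** (g ** A ** matrix_inv g) ** matrix_inv U"
      unfolding h_def SL2_inv_mult[OF Gam_SL2[OF U] Gam_SL2[OF g(1)]] by (simp add: matrix_mul_assoc)
    also have "\<dots> = mk a1 b1 c d1"
      unfolding m(1) UI unfolding U_def mk_mult a1_def b1_def d1_def by (simp add: algebra_simps)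
    finally show ?thesis .
  qed
  have G1: "mk a1 b1 c d1 \<in> Gam" using conjG[OF hG] hA by simp
  then have det1: "a1 * d1 - b1 * c = 1" and b1: "b1 \<in> Zw" by (simp_all add: mk_Gam)
  \<comment> \<open>Conjugation by \<open>W\<close> moves -b1 to the lower left corner, so
    minimality gives |c| <= |b1|.\<close>
  define W where "W = mk 0 (-1) 1 0"
  have W: "W \<in> Gam" by (simp add: W_def mk_Gam)
  have WI: "matrix_inv W = mk 0 1 (-1) 0" unfolding W_def by (subst matrix_inv_mk) simp_all
  define k where "k = W ** h"
  have kG: "k \<in> Gam" unfolding k_def by (intro Gam_mult W hG)
  have kA: "(k ** A ** matrix_inv k)$2$1 = - b1"
  proof -
    have "k ** A ** matrix_inv k = W ** (h ** A ** matrix_inv h) ** matrix_inv W"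
      unfolding k_def SL2_inv_mult[OF Gam_SL2[OF W] Gam_SL2[OF hG]] by (simp add: matrix_mul_assoc)
    then show ?thesis unfolding hA WI unfolding W_def mk_mult by simp
  qed
  have "nrm c \<le> nrm (- b1)" using g(2)[OF kG] unfolding n_def kA m(1) by simp
  then have "(cmod c)^2 \<le> (cmod (- b1))^2" unfolding Zw_nrm[OF m(4)] Zw_nrm[OF Zw_uminus[OF b1]] by simp
  then have cb: "cmod c \<le> cmod b1" by (simp add: power2_le_iff_abs_le)
  have c1: "1 \<le> cmod c" using Zw_ge1[OF m(4) c0] .
  have "a1 - d1 = 2 * c * ((a - d) / (2 * c) - u0)" using c0 by (simp add: a1_def d1_def u_def field_simps)
  then have "(cmod (a1 - d1))^2 = 4 * (cmod c)^2 * (cmod ((a - d) / (2 * c) - u0))^2"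
    by (simp add: norm_mult power_mult_distrib)
  also have "\<dots> \<le> 4 * (cmod c)^2 * (3/4)" using u0(2) by (intro mult_left_mono) auto
  finally have ad: "(cmod (a1 - d1))^2 \<le> 3 * (cmod c)^2" by simp
  have t: "a1 + d1 = tr2 A" using trh[OF hG] hA by simp
  have t4: "4 * (b1 * c) = (tr2 A)^2 - 4 - (a1 - d1)^2"
  proof -
    have "4 = 4 * (a1 * d1 - b1 * c)" using det1 by simp
    then show ?thesis unfolding t[symmetric] by (simp add: power2_eq_square algebra_simps)
  qed
  have tK: "cmod ((tr2 A)^2 - 4) \<le> K"
  proof -
    have "cmod ((tr2 A)^2 - 4) \<le> (cmod (tr2 A))^2 + 4" using norm_triangle_ineq4[of "(tr2 A)^2" 4] by (simp add: norm_power)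
    moreover have "(cmod (tr2 A))^2 \<le> T^2" using T by (intro power_mono) auto
    ultimately show ?thesis by (simp add: K_def)
  qed
  have "4 * (cmod b1 * cmod c) = cmod ((tr2 A)^2 - 4 - (a1 - d1)^2)" unfolding t4[symmetric] by (simp add: norm_mult)
  also have "\<dots> \<le> K + 3 * (cmod c)^2"
    using norm_triangle_ineq4[of "(tr2 A)^2 - 4" "(a1 - d1)^2"] tK ad by (simp add: norm_power)
  finally have bc: "4 * (cmod b1 * cmod c) \<le> K + 3 * (cmod c)^2" .
  \<comment> \<open>Now 4 |c|^2 <= 4 |b1| |c| <= K + 3 |c|^2. The covering constant 3/4 < 1 is what
    leaves a bound on c.\<close>
  have "cmod c * cmod c \<le> cmod b1 * cmod c" using cb by (intro mult_right_mono) auto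
  then have cK: "(cmod c)^2 \<le> K" using bc by (simp add: power2_eq_square)
  have "cmod b1 * 1 \<le> cmod b1 * cmod c" using c1 by (intro mult_left_mono) auto
  then have bK: "cmod b1 \<le> K" using bc cK by simp
  have c2: "cmod c \<le> K" using cb bK by simp
  have "(cmod (a1 - d1))^2 \<le> (2 * K)^2"
  proof -
    have "3 * (cmod c)^2 \<le> 3 * K" using cK by simp
    also have "\<dots> \<le> (2 * K) * (2 * K)" using K4 by (intro mult_mono) auto
    finally show ?thesis using ad by (simp add: power2_eq_square)
  qed
  then have adK: "cmod (a1 - d1) \<le> 2 * K" by (rule power2_le_imp_le) (use K4 in simp)
  have "cmod (2 * a1) \<le> T + 2 * K" "cmod (2 * d1) \<le> T + 2 * K"
    using norm_triangle_ineq[of "a1 + d1" "a1 - d1"] norm_triangle_ineq4[of "a1 + d1" "a1 - d1"] T adK unfolding t[symmetric]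
    by simp_all
  then have adT: "cmod a1 \<le> T + 2 * K" "cmod d1 \<le> T + 2 * K" using T0 K4 norm_ge_zero[of a1] norm_ge_zero[of d1] by (simp_all add: norm_mult)
  have "A = matrix_inv h ** mk a1 b1 c d1 ** matrix_inv (matrix_inv h)"
    unfolding hA[symmetric] using Gam_SL2[OF hG] by (simp add: SL2_inv_inv matrix_mul_assoc SL2_inv_left SL2_inv_cancel_right')
  moreover have "cmod (mk a1 b1 c d1 $ i $ j) \<le> 4 * K + T" for i j
    using exhaust_2[of i] exhaust_2[of j] adT bK c2 K4 T0 by auto
  ultimately show ?thesis using Gam_inv[OF hG] G1 unfolding K_def by blast
qed

text \<open>The length bounds \<open>Kt\<close>, hence the trace, so the element is conjugate in
  \<open>Gam\<close> to one of finitely many matrices \<open>A0\<close>. Conjugation by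
  \<open>Gq q\<close> does not change the class, so only a representative D of the conjugator
  matters.\<close>

lemma Cls_finite:
  assumes q: "q \<ge> 3" shows "finite (Cls q)"
proof -
  define K where "K = Kt (of_nat q ^ 2 - 2)"
  define T where "T = 4 * K"
  define F where "F = {A0 \<in> Gam. \<forall>i j. cmod (A0$i$j) \<le> 4 * (T^2 + 4) + T}"
  have K1: "K \<ge> 1" unfolding K_def by (rule Kt_ge1)
  have fF: "finite F"
  proof (rule finite_subset)
    let ?Z = "{z \<in> Zw. cmod z \<le> 4 * (T^2 + 4) + T}"
    show "F \<subseteq> (\<lambda>(a, b, c, d). mk a b c d) ` (?Z \<times> ?Z \<times> ?Z \<times> ?Z)"
    proof
      fix A assume "A \<in> F"
      then show "A \<in> (\<lambda>(a, b, c, d). mk a b c d) ` (?Z \<times> ?Z \<times> ?Z \<times> ?Z)"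
        by (intro image_eqI[where x = "(A$1$1, A$1$2, A$2$1, A$2$2)"]) (auto simp: F_def Gam_def cmat_eq_iff)
    qed
    show "finite ((\<lambda>(a, b, c, d). mk a b c d) ` (?Z \<times> ?Z \<times> ?Z \<times> ?Z))"
      by (intro finite_imageI finite_cartesian_product Zw_finite)
  qed
  have "Cls q \<subseteq> (\<lambda>(A0, D). conj_class (Gq q) (D ** A0 ** matrix_inv D)) ` (F \<times> Reps q)"
  proof
    fix y assume "y \<in> Cls q"
    then obtain A where A: "A \<in> Gq q" "loxodromic A" "tlen A = sys (Gq q)" "y = conj_class (Gq q) A" by (auto simp: Cls_def)
    have AG: "A \<in> Gam" using A Gq_Gam by blast
    have "arcosh (Kt (tr2 A)) \<le> arcosh K"
      using tlen_ge[OF Gq_SL2[OF A(1)]] A(3) sys_Gq[OF q] by (simp add: ell_def K_def)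
    then have "Kt (tr2 A) \<le> K" using arcosh_less_iff_real[OF K1 Kt_ge1] by (meson not_le)
    moreover have "(cmod (tr2 A))^2 \<le> 4 * Kt (tr2 A)" by (simp add: Kt_def)
    ultimately have "(cmod (tr2 A))^2 \<le> T" unfolding T_def by linarith
    also have "T \<le> T^2" using K1 by (simp add: T_def power2_eq_square)
    finally have "cmod (tr2 A) \<le> T" by (rule power2_le_imp_le) (use K1 in \<open>simp add: T_def\<close>)
    then obtain g A0 where g: "g \<in> Gam" "A0 \<in> F" "A = g ** A0 ** matrix_inv g"
      using Gam_reduction[OF AG tlen_Gq_ge(2,3)[OF q A(1,2)]] unfolding F_def by blast
    obtain k D where k: "k \<in> Gq q" "D \<in> Reps q" "g = k ** D" using Reps_decomp[OF g(1)] by blast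
    have DG: "D \<in> Gam" using k Reps_Gam by blast
    have "A = k ** (D ** A0 ** matrix_inv D) ** matrix_inv k"
      unfolding g(3) k(3) SL2_inv_mult[OF Gq_SL2[OF k(1)] Gam_SL2[OF DG]] by (simp add: matrix_mul_assoc)
    then have "y = conj_class (Gq q) (D ** A0 ** matrix_inv D)"
      unfolding A(4) using conj_class_conj[OF PSL_preimage_subgroup_Gq k(1)] by simp
    then show "y \<in> (\<lambda>(A0, D). conj_class (Gq q) (D ** A0 ** matrix_inv D)) ` (F \<times> Reps q)"
      using g(2) k(2) by force
  qed
  moreover have "finite (Reps q)" using Reps_finite q by simp
  ultimately show ?thesis using fF finite_subset by blast
qed

section \<open>Counting residues\<close>

text \<open>The i-th smallest element is at least i + 1, so the product is at least the telescoping
  product of i / (i + 1).\<close>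

lemma prod_one_minus_inverse_ge:
  fixes S :: "nat set"
  assumes "finite S" "\<And>p. p \<in> S \<Longrightarrow> 2 \<le> p"
  shows "1 / (real (card S) + 1) \<le> (\<Prod>p\<in>S. 1 - 1 / real p)"
  using assms
proof (induction S rule: finite_linorder_max_induct)
  case empty then show ?case by simp
next
  case (insert b A)
  define k where "k = real (card A)"
  have "A \<subseteq> {2..<b}" using insert by auto
  then have "card A \<le> b - 2" using card_mono[of "{2..<b}" A] by simp
  moreover have "2 \<le> b" using insert by auto
  ultimately have b: "k + 2 \<le> real b" unfolding k_def by linarith
  have k: "k \<ge> 0" by (simp add: k_def)
  have "1 / real b \<le> 1 / (k + 2)" using b k by (intro divide_left_mono) auto
  then have 1: "(k + 1) / (k + 2) \<le> 1 - 1 / real b" using k by (simp add: field_simps)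
  have "b \<notin> A" using insert by auto
  have "1 / (real (card (insert b A)) + 1) = (k + 1) / (k + 2) * (1 / (k + 1))"
    using \<open>b \<notin> A\<close> insert(1) k by (simp add: k_def)
  also have "\<dots> \<le> (1 - 1 / real b) * (\<Prod>p\<in>A. 1 - 1 / real p)"
  proof (rule mult_mono)
    show "1 / (k + 1) \<le> (\<Prod>p\<in>A. 1 - 1 / real p)" using insert.IH insert.prems by (simp add: k_def)
    show "0 \<le> 1 - 1 / real b" using \<open>2 \<le> b\<close> by (simp add: field_simps)
  qed (use 1 k in auto)
  finally show ?case using \<open>b \<notin> A\<close> insert(1) by simp
qed

text \<open>A number n has at most log_2 n distinct prime factors; the product formula and the
  preceding bound then cost only a logarithm.\<close>

lemma totient_ge:
  assumes "n \<ge> 1" shows "real n \<le> real (totient n) * (1 + log 2 n)"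
proof -
  let ?P = "prime_factors n"
  have n0: "n \<noteq> 0" using assms by simp
  have p2: "2 \<le> p" if "p \<in> ?P" for p using that prime_ge_2_nat by auto
  have "(2::nat) ^ card ?P = (\<Prod>p\<in>?P. 2)" by simp
  also have "\<dots> \<le> (\<Prod>p\<in>?P. p ^ multiplicity p n)"
  proof (rule prod_mono)
    fix p assume p: "p \<in> ?P"
    then have "multiplicity p n \<noteq> 0" using n0 by (auto simp: prime_factors_multiplicity)
    then have "p ^ 1 \<le> p ^ multiplicity p n" using p2[OF p] by (intro power_increasing) auto
    then show "0 \<le> (2::nat) \<and> 2 \<le> p ^ multiplicity p n" using p2[OF p] by simp
  qed
  also have "\<dots> = n" using prod_prime_factors[OF n0] by simp
  finally have "(2::real) ^ card ?P \<le> real n" by (metis of_nat_le_iff of_nat_numeral of_nat_power)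
  then have "log 2 (2 ^ card ?P) \<le> log 2 (real n)" by (intro log_mono) auto
  then have c: "real (card ?P) \<le> log 2 n" by (simp add: log_nat_power)
  have "real n * 1 \<le> real n * ((\<Prod>p\<in>?P. 1 - 1 / real p) * (real (card ?P) + 1))"
    using prod_one_minus_inverse_ge[of ?P] p2 by (intro mult_left_mono) (auto simp: field_simps)
  also have "\<dots> = real (totient n) * (real (card ?P) + 1)" by (simp add: totient_formula2)
  also have "\<dots> \<le> real (totient n) * (1 + log 2 n)" using c by (intro mult_left_mono) auto
  finally show ?thesis by simp
qed

text \<open>With s inverse to r modulo n, every q congruent to r + s satisfies the condition, and
  this residue class has at least \<open>Q div n\<close> members in the interval. The offset
  \<open>a\<close> leads to the first of them from Q on.\<close>

lemma card_residue_ge: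
  fixes n r :: nat
  assumes n: "n \<ge> 1" and r: "coprime r n"
  shows "Q div n \<le> card {q \<in> {Q..<2 * Q}. int n dvd int r * (int q - int r) - 1}"
proof -
  obtain s where s: "[int r * s = 1] (mod int n)" using cong_solve_coprime_int[of "int r" "int n"] r by auto
  define a where "a = nat ((int r + s - int Q) mod int n)"
  have a: "int a = (int r + s - int Q) mod int n" "a < n" using n by (simp_all add: a_def nat_less_iff)
  let ?f = "\<lambda>k. Q + a + k * n"
  have "?f ` {..<Q div n} \<subseteq> {q \<in> {Q..<2 * Q}. int n dvd int r * (int q - int r) - 1}"
  proof
    fix q assume "q \<in> ?f ` {..<Q div n}"
    then obtain k where k: "k < Q div n" "q = ?f k" by auto
    have "a + k * n < Suc k * n" using a(2) by simp
    also have "\<dots> \<le> Q div n * n" using k by (intro mult_right_mono) auto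
    also have "\<dots> \<le> Q" by simp
    finally have 1: "q \<in> {Q..<2 * Q}" using k by simp
    have "int q - (int r + s) = int k * int n - ((int r + s - int Q) - (int r + s - int Q) mod int n)"
      unfolding k(2) a(1)[symmetric] by simp
    moreover have "int n dvd \<dots>" by (intro dvd_diff dvd_triv_right dvd_minus_mod)
    ultimately have "[int q = int r + s] (mod int n)" by (simp only: cong_iff_dvd_diff)
    then have "[int r * (int q - int r) = int r * (int r + s - int r)] (mod int n)"
      by (intro cong_mult cong_diff cong_refl)
    then have "[int r * (int q - int r) = 1] (mod int n)" using s cong_trans by fastforce
    then show "q \<in> {q \<in> {Q..<2 * Q}. int n dvd int r * (int q - int r) - 1}"
      using 1 by (simp add: cong_iff_dvd_diff)
  qed
  moreover have "inj_on ?f {..<Q div n}" using n by (auto simp: inj_on_def)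
  ultimately have "card {..<Q div n} \<le> card {q \<in> {Q..<2 * Q}. int n dvd int r * (int q - int r) - 1}"
    by (intro card_inj_on_le) auto
  then show ?thesis by simp
qed

text \<open>Double counting of triples (c, r, q). There are at least X^2 / (2L) values of c, each
  with at least Q / (2L) pairs (r, q), so some of the Q levels carries at least X^2 / (4 L^2). The
  constant 48 is 16 times 3: u, v <= X give norm at most 3 X^2.\<close>

lemma exists_large_Hset:
  assumes X: "X \<ge> 1"
  defines "Q \<equiv> 48 * X^2"
  shows "\<exists>q\<in>{Q..<2 * Q}. real X ^ 2 / (4 * (1 + log 2 Q)^2) \<le> real (card (Hset q))"
proof (rule ccontr)
  assume "\<not> ?thesis"
  then have neg: "real (card (Hset q)) < real X ^ 2 / (4 * (1 + log 2 Q)^2)" if "q \<in> {Q..<2 * Q}" for q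
    using that by force
  define L where "L = 1 + log 2 Q"
  have X1: "1 \<le> X^2" using X by simp
  have Q1: "Q \<ge> 48" using X1 unfolding Q_def by linarith
  have L: "L \<ge> 1" using Q1 by (simp add: L_def)
  have q3: "q \<ge> 3" if "q \<in> {Q..<2 * Q}" for q using that Q1 by simp
  have finH: "finite (Hset q)" if "q \<in> {Q..<2 * Q}" for q
    using Kiss_Gq_ge(2) Cls_finite q3[OF that] by blast
  define P where "P = (SIGMA v:{1..X}. totatives v)"
  define N where "N = (\<lambda>(v, u). u^2 + 2 * v^2 :: nat)"
  define S where "S = (\<lambda>(x, r). {q \<in> {Q..<2 * Q}. int (N x) dvd int r * (int q - int r) - 1})"
  have finP: "finite P" unfolding P_def by auto
  have N: "3 \<le> N x" "16 * N x \<le> Q" if x: "x \<in> P" for x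
  proof -
    obtain v u where vu: "x = (v, u)" "1 \<le> v" "v \<le> X" "u \<in> totatives v" using x by (auto simp: P_def)
    have u: "0 < u" "u \<le> v" using vu by (auto simp: in_totatives_iff)
    have "1 \<le> u^2" "1 \<le> v^2" using u vu by auto
    then show "3 \<le> N x" by (simp add: N_def vu)
    have "u \<le> X" using u vu by simp
    then have "u^2 \<le> X^2" by (intro power_mono) auto
    moreover have "v^2 \<le> X^2" using vu by (intro power_mono) auto
    moreover have "16 * (i + 2 * j) \<le> 48 * k" if "i \<le> k" "j \<le> k" for i j k :: nat using that by simp
    ultimately have "16 * (u^2 + 2 * v^2) \<le> 48 * X^2" by blast
    then show "16 * N x \<le> Q" by (simp only: N_def vu(1) Q_def case_prod_conv)
  qed
  let ?T = "SIGMA y:(SIGMA x:P. totatives (N x)). S y"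
  let ?U = "SIGMA q:{Q..<2 * Q}. Hset q"
  define f where "f = (\<lambda>(((v, u), r), q :: nat). (q, (int u, int v, int r)))"
  have "f ` ?T \<subseteq> ?U"
  proof
    fix z assume "z \<in> f ` ?T"
    then obtain v u r q where z: "z = (q, (int u, int v, int r))" "(v, u) \<in> P" "r \<in> totatives (N (v, u))" "q \<in> S ((v, u), r)"
      by (auto simp: f_def)
    have q: "q \<in> {Q..<2 * Q}" "int (N (v, u)) dvd int r * (int q - int r) - 1" using z(4) by (auto simp: S_def)
    have vu: "1 \<le> v" "0 < u" "coprime u v" using z(2) by (auto simp: P_def in_totatives_iff)
    have n: "nf (int u) (int v) = int (N (v, u))" by (simp add: nf_def N_def)
    have "16 * nf (int u) (int v) \<le> int q" unfolding n using N(2)[OF z(2)] q(1) by simp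
    moreover have "r < N (v, u)"
    proof -
      \<comment> \<open>Needed for the strict bound r < N: the only totative of 1 is 1
        itself.\<close>
      have "1 < N (v, u)" using N(1)[OF z(2)] by simp
      then show ?thesis using z(3) by (simp add: totatives_less)
    qed
    ultimately show "z \<in> ?U" using q vu unfolding z(1) Hset_def by (auto simp: n)
  qed
  moreover have "inj_on f ?T" by (auto simp: inj_on_def f_def)
  moreover have finU: "finite ?U" using finH by auto
  ultimately have "card ?T \<le> card ?U" by (metis card_inj_on_le)
  moreover have "card ?U = (\<Sum>q\<in>{Q..<2 * Q}. card (Hset q))" using finH by (intro card_SigmaI) auto
  moreover have "card ?T = (\<Sum>x\<in>P. \<Sum>r\<in>totatives (N x). card (S (x, r)))"
  proof -
    have "card ?T = (\<Sum>y\<in>(SIGMA x:P. totatives (N x)). card (S y))"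
      using finP by (intro card_SigmaI) (auto simp: S_def)
    then show ?thesis using finP by (simp add: sum.Sigma)
  qed
  ultimately have le: "(\<Sum>x\<in>P. \<Sum>r\<in>totatives (N x). card (S (x, r))) \<le> (\<Sum>q\<in>{Q..<2 * Q}. card (Hset q))" by simp
  have summand: "real Q / (2 * L) \<le> real (\<Sum>r\<in>totatives (N x). card (S (x, r)))" if x: "x \<in> P" for x
  proof -
    have Nx: "N x \<ge> 1" "N x \<le> Q" using N[OF x] by auto
    have "totient (N x) * (Q div N x) = (\<Sum>r\<in>totatives (N x). Q div N x)" by (simp add: totient_def)
    also have "\<dots> \<le> (\<Sum>r\<in>totatives (N x). card (S (x, r)))"
      unfolding S_def case_prod_conv using Nx by (intro sum_mono card_residue_ge) (auto simp: in_totatives_iff)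
    finally have 1: "real (totient (N x)) * real (Q div N x) \<le> real (\<Sum>r\<in>totatives (N x). card (S (x, r)))"
      by (metis of_nat_le_iff of_nat_mult)
    \<comment> \<open>As N <= Q, the quotient is at least 1, and rounding it down loses at most a
      factor 2.\<close>
    have "Q < N x * (Q div N x) + N x" using Nx by (metis add.commute add_less_cancel_left div_mult_mod_eq mod_less_divisor mult.commute less_le_trans zero_less_one)
    moreover have "N x * 1 \<le> N x * (Q div N x)" using Nx by (intro mult_left_mono) (simp_all add: div_greater_zero_iff Suc_leI)
    ultimately have "Q \<le> 2 * (N x * (Q div N x))" by linarith
    then have 2: "real Q \<le> 2 * (real (N x) * real (Q div N x))" by (metis of_nat_le_iff of_nat_mult of_nat_numeral)
    have "real (N x) \<le> real (totient (N x)) * (1 + log 2 (N x))" using Nx by (intro totient_ge)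
    also have "\<dots> \<le> real (totient (N x)) * L" unfolding L_def using Nx by (intro mult_left_mono add_left_mono log_mono) auto
    finally have "real (N x) * real (Q div N x) \<le> real (totient (N x)) * L * real (Q div N x)" by (intro mult_right_mono) auto
    then have "real Q \<le> 2 * L * (real (totient (N x)) * real (Q div N x))" using 2 by (simp add: algebra_simps)
    also have "\<dots> \<le> 2 * L * real (\<Sum>r\<in>totatives (N x). card (S (x, r)))" using 1 L by (intro mult_left_mono) auto
    finally show ?thesis using L by (simp add: field_simps)
  qed
  have cP: "real X ^ 2 / (2 * L) \<le> real (card P)"
  proof -
    have "real X ^ 2 / 2 \<le> (\<Sum>v=1..X. real v)"
    proof -
      have "(\<Sum>v=1..n. real v) = real n * (real n + 1) / 2" for n
        by (induction n) (simp_all add: field_simps)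
      then show ?thesis by (simp add: power2_eq_square field_simps)
    qed
    also have "\<dots> \<le> (\<Sum>v=1..X. real (totient v) * L)"
    proof (rule sum_mono)
      fix v assume v: "v \<in> {1..X}"
      have "v \<le> Q"
      proof -
        have "X * 1 \<le> X * X" using X by (intro mult_left_mono) auto
        moreover have "v \<le> X" using v by simp
        ultimately show ?thesis unfolding Q_def power2_eq_square by linarith
      qed
      have "real v \<le> real (totient v) * (1 + log 2 v)" using v by (intro totient_ge) auto
      also have "\<dots> \<le> real (totient v) * L"
        unfolding L_def using v \<open>v \<le> Q\<close> by (intro mult_left_mono add_left_mono log_mono) auto
      finally show "real v \<le> real (totient v) * L" .
    qed
    also have "\<dots> = real (card P) * L"
      unfolding P_def by (subst card_SigmaI) (auto simp: totient_def sum_distrib_right)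
    finally show ?thesis using L by (simp add: field_simps)
  qed
  have "real X ^ 2 / (2 * L) * (real Q / (2 * L)) \<le> real (card P) * (real Q / (2 * L))"
    using cP L by (intro mult_right_mono) auto
  also have "\<dots> = (\<Sum>x\<in>P. real Q / (2 * L))" by simp
  also have "\<dots> \<le> (\<Sum>x\<in>P. real (\<Sum>r\<in>totatives (N x). card (S (x, r))))" by (intro sum_mono summand)
  also have "\<dots> = real (\<Sum>x\<in>P. \<Sum>r\<in>totatives (N x). card (S (x, r)))" by simp
  also have "\<dots> \<le> real (\<Sum>q\<in>{Q..<2 * Q}. card (Hset q))" using le by (simp only: of_nat_le_iff)
  also have "\<dots> = (\<Sum>q\<in>{Q..<2 * Q}. real (card (Hset q)))" by simp
  also have "\<dots> < (\<Sum>q\<in>{Q..<2 * Q}. real X ^ 2 / (4 * L^2))"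
    using neg Q1 unfolding L_def by (intro sum_strict_mono) auto
  also have "\<dots> = real Q * (real X ^ 2 / (4 * L^2))" by simp
  finally show False by (simp add: power2_eq_square field_simps)
qed

text \<open>Since q < 96 X^2, the count X^2 / (4 L^2) is q up to squared logarithms, which the gap
  between exponents 1 and 8/9 absorbs.\<close>

lemma exists_q:
  "\<exists>q\<ge>N. 3 \<le> q \<and> real q powr (8/9) \<le> real (card (Hset q))"
proof -
  have "eventually (\<lambda>X::real. (96 * X^2) powr (8/9) \<le> X^2 / (4 * (1 + log 2 (48 * X^2))^2)) at_top"
    by real_asymp
  then have "eventually (\<lambda>X::nat. (96 * real X^2) powr (8/9) \<le> real X^2 / (4 * (1 + log 2 (48 * real X^2))^2)) sequentially"
    by (rule eventually_compose_filterlim[OF _ filterlim_real_sequentially])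
  then obtain M where M: "\<And>X. X \<ge> M \<Longrightarrow> (96 * real X^2) powr (8/9) \<le> real X^2 / (4 * (1 + log 2 (48 * real X^2))^2)"
    unfolding eventually_sequentially by blast
  define X where "X = max M (N + 1)"
  have X: "X \<ge> N + 1" "(96 * real X^2) powr (8/9) \<le> real X^2 / (4 * (1 + log 2 (48 * real X^2))^2)"
    using M[of X] by (simp_all only: X_def max.cobounded1 max.cobounded2)
  have "X \<ge> 1" using X by simp
  then obtain q where q: "q \<in> {48 * X^2..<2 * (48 * X^2)}"
    "real X ^ 2 / (4 * (1 + log 2 (48 * X^2))^2) \<le> real (card (Hset q))"
    using exists_large_Hset by blast
  have "X * 1 \<le> X * X" using X by (intro mult_left_mono) auto
  then have "48 * X \<le> 48 * X^2" unfolding power2_eq_square by linarith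
  also have "\<dots> \<le> q" using q(1) by simp
  finally have "q \<ge> N" "q \<ge> 3" using X(1) by linarith+
  have "real q \<le> real (96 * X^2)" using q(1) by (intro of_nat_mono) auto
  then have "real q powr (8/9) \<le> (96 * real X^2) powr (8/9)" by (intro powr_mono2) auto
  also have "\<dots> \<le> real (card (Hset q))" using X(2) q(2) by simp
  finally show ?thesis using \<open>q \<ge> N\<close> \<open>q \<ge> 3\<close> by blast
qed

section \<open>Comparison of kissing number and volume\<close>

lemma V0_pos: "V0 > 0" unfolding V0_def by (simp add: add_nonneg_pos)

text \<open>With m the index and h = \<open>card (Hset q)\<close>, the kissing number is at least h
  m / 2, and vol <= V0 m. From m <= q^6 follows m^(4/27) <= q^(8/9) <= h, hence m^(31/27) <= h
  m.\<close>

lemma Kiss_lower: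
  assumes q: "q \<ge> 3" "real q powr (8/9) \<le> real (card (Hset q))"
  shows "1 / (2 * V0 powr (31/27)) * vol (Gq q) powr (31/27) \<le> real (Kiss (Gq q))"
proof -
  define m where "m = real (card (Reps q))"
  define h where "h = real (card (Hset q))"
  define V where "V = vol (Gq q)"
  have Vpos: "V \<ge> 0" unfolding V_def using vol_Gq(3)[OF q(1)] by (smt (verit) divide_nonneg_nonneg zero_le_power2)
  have V: "V \<le> V0 * m" unfolding V_def m_def by (rule vol_Gq(2)[OF q(1)])
  have m: "m \<le> real q ^ 6" unfolding m_def using Reps_finite(2)[of q] q(1) by (metis le_trans linorder_not_less not_numeral_le_zero of_nat_le_iff of_nat_power gr0I)
  have m0: "m \<ge> 0" by (simp add: m_def)
  have qp: "real q > 0" using q by simp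
  have "card (Hset q) * card (Reps q) \<le> 2 * Kiss (Gq q)" by (rule Kiss_Gq_ge(1)[OF q(1) Cls_finite[OF q(1)]])
  then have hm: "h * m \<le> 2 * real (Kiss (Gq q))" unfolding h_def m_def by (metis of_nat_le_iff of_nat_mult of_nat_numeral)
  have "V powr (31/27) \<le> (V0 * m) powr (31/27)" using V Vpos by (intro powr_mono2) auto
  also have "\<dots> = V0 powr (31/27) * (m powr 1 * m powr (4/27))"
  proof -
    have "m powr 1 * m powr (4/27) = m powr (31/27)" unfolding powr_add[symmetric] by simp
    then show ?thesis using V0_pos m0 by (simp add: powr_mult)
  qed
  also have "\<dots> \<le> V0 powr (31/27) * (m * h)"
  proof -
    have "m powr (4/27) \<le> (real q ^ 6) powr (4/27)" using m m0 by (intro powr_mono2) auto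
    also have "real q ^ 6 = real q powr 6" using qp by (simp add: powr_numeral)
    also have "(real q powr 6) powr (4/27) = real q powr (8/9)" by (subst powr_powr) simp
    also have "\<dots> \<le> h" using q(2) by (simp add: h_def)
    finally have "m powr (4/27) \<le> h" .
    moreover have "m powr 1 = m" using m0 by simp
    ultimately show ?thesis using m0 by (intro mult_left_mono) (auto intro: mult_left_mono)
  qed
  also have "\<dots> \<le> V0 powr (31/27) * (2 * real (Kiss (Gq q)))" using hm by (intro mult_left_mono) (auto simp: mult.commute)
  finally show ?thesis using V0_pos by (simp add: V_def field_simps)
qed

theorem theorem1p1:
  shows "\<exists>(G :: nat \<Rightarrow> cmat set) (c::real). c > 0 \<and>
     (\<forall>i. kleinian_tf (G i) \<and> \<not> cocompact (G i) \<and> covol (G i) < \<infinity>) \<and>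
     filterlim (\<lambda>i. vol (G i)) at_top sequentially \<and>
     (\<forall>\<epsilon>>0. \<exists>i0. \<forall>i>i0.
        real (Kiss (G i)) \<ge> (1 - \<epsilon>) * c * vol (G i) powr (31/27) / ln (vol (G i)))"
proof -
  \<comment> \<open>With q >= i + 20 the lower bound q^2/32 for the volume is at least i + 12: it
    tends to infinity and always exceeds e.\<close>
  have "\<forall>i. \<exists>q. i + 20 \<le> q \<and> 3 \<le> q \<and> real q powr (8/9) \<le> real (card (Hset q))"
    using exists_q by blast
  then obtain Q where Q: "\<And>i. i + 20 \<le> Q i" "\<And>i. 3 \<le> Q i" "\<And>i. real (Q i) powr (8/9) \<le> real (card (Hset (Q i)))"
    by metis
  define c where "c = 1 / (2 * V0 powr (31/27))"
  have c: "c > 0" using V0_pos by (simp add: c_def)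
  have V: "real i + 12 \<le> vol (Gq (Q i))" for i
  proof -
    have "(real i + 20)^2 \<le> (real (Q i))^2" using Q(1)[of i] by (intro power_mono) linarith+
    moreover have "32 * (real i + 12) \<le> (real i + 20)^2" by (simp add: power2_eq_square algebra_simps)
    moreover have "x \<le> y" if "s \<le> t" "32 * x \<le> s" "t / 32 \<le> y" for s t x y :: real using that by simp
    ultimately show ?thesis using vol_Gq(3)[OF Q(2)[of i]] by blast
  qed
  have "filterlim (\<lambda>i. real i + 12) at_top sequentially" by real_asymp
  then have lim: "filterlim (\<lambda>i. vol (Gq (Q i))) at_top sequentially"
    by (rule filterlim_at_top_mono) (simp add: V)
  have K: "(1 - \<epsilon>) * c * vol (Gq (Q i)) powr (31/27) / ln (vol (Gq (Q i))) \<le> real (Kiss (Gq (Q i)))"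
    if e: "\<epsilon> > 0" for i \<epsilon>
  proof -
    let ?V = "vol (Gq (Q i))"
    \<comment> \<open>Volume at least e makes the logarithm at least 1, so dividing by it only
      lowers the right-hand side.\<close>
    have "exp 1 \<le> ?V" using V[of i] exp_le by linarith
    then have ln: "ln ?V \<ge> 1" by (metis exp_gt_zero ln_exp ln_mono less_le_trans)
    have cV: "c * ?V powr (31/27) \<ge> 0" using c by simp
    have "(1 - \<epsilon>) * (c * ?V powr (31/27)) \<le> 1 * (c * ?V powr (31/27))" using e cV by (intro mult_right_mono) auto
    moreover have "c * ?V powr (31/27) * 1 \<le> c * ?V powr (31/27) * ln ?V" using cV ln by (intro mult_left_mono) auto
    ultimately have "(1 - \<epsilon>) * c * ?V powr (31/27) / ln ?V \<le> c * ?V powr (31/27)"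
      using ln by (simp add: divide_le_eq mult.assoc)
    also have "\<dots> \<le> real (Kiss (Gq (Q i)))" unfolding c_def by (rule Kiss_lower[OF Q(2,3)])
    finally show ?thesis .
  qed
  show ?thesis
  proof (intro exI[of _ "\<lambda>i. Gq (Q i)"] exI[of _ c] conjI allI impI)
    fix i
    show "kleinian_tf (Gq (Q i))" using Q(2)[of i] by (intro kleinian_tf_Gq) simp
    show "\<not> cocompact (Gq (Q i))" using Gq_Gam by (intro not_cocompact_Gam) blast
    show "covol (Gq (Q i)) < \<infinity>" by (rule vol_Gq(1)[OF Q(2)])
  next
    fix \<epsilon> :: real assume "\<epsilon> > 0"
    then show "\<exists>i0. \<forall>i>i0. real (Kiss (Gq (Q i))) \<ge> (1 - \<epsilon>) * c * vol (Gq (Q i)) powr (31/27) / ln (vol (Gq (Q i)))"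
      using K by blast
  qed (use c lim in auto)
qed

end
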